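(* Let $X$ and $Y$ be uniformly locally finite metric spaces such that $\mathrm{C}^*_u(X)$ is isomorphic to a hereditary $\mathrm{C}^*$-subalgebra of $\mathrm{C}^*_u(Y)$. Then: (i) If all the sparse subspaces of $Y$ yield only compact ghost projections, then $X$ coarsely embeds into $Y$. (ii) If, in addition, $Y$ has property A, then $X$ coarsely embeds into $Y$ by an injective map.
   Context: A metric space $(X,d)$ is uniformly locally finite (u.l.f.) if $\sup_{x\in X}|B_r(x)|<\infty$ for all $r>0$. Let $(\delta_x)_{x\in X}$ be the canonical basis of $\ell_2(X)$. An operator $a\in\mathcal{B}(\ell_2(X))$ has finite propagation if there is $r>0$ with $\langle a\delta_x,\delta_y\rangle=0$ whenever $d(x,y)>r$. The uniform Roe algebra $\mathrm{C}^*_u(X)$ is the norm closure in $\mathcal{B}(\ell_2(X))$ of the finite propagation operators. An operator $a\in\mathcal{B}(\ell_2(X))$ is a ghost if for all $\varepsilon>0$ there is a finite $A\subseteq X$ such that $|\langle a\delta_x,\delta_y\rangle|<\varepsilon$ for all $x,y\in X\setminus A$. The space $X$ yields only compact ghost projections if every ghost projection in $\mathrm{C}^*_u(X)$ is compact. The space $X$ is sparse if there is a partition $X=\bigsqcup_{n\in\mathbb{N}}X_n$ into finite subsets with $d(X_n,X_m)\to\infty$ as $n+m\to\infty$ ($n\neq m$). A sparse subspace of $Y$ is a subset of $Y$ which is sparse in the restricted metric. A map $f\colon(X,d)\to(Y,\partial)$ is coarse if $\sup\{\partial(f(x),f(y))\mid d(x,y)\leq r\}<\infty$ for all $r>0$,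 expanding if $\lim_{r\to\infty}\inf\{\partial(f(x),f(y))\mid d(x,y)\geq r\}=\infty$, and a coarse embedding if it is both coarse and expanding. Property A (Yu): $Y$ has property A if for all $r,\varepsilon>0$ there are $R>0$ and finite sets $A_x\subseteq Y\times\mathbb{N}$ ($x\in Y$) such that $(x,1)\in A_x$ for all $x$; $|A_x\triangle A_y|/|A_x\cap A_y|<\varepsilon$ whenever $\partial(x,y)\leq r$; and $\partial(y,z)\leq R$ whenever $(y,m),(z,n)\in A_x$ for some $x$. *)

theory Defs
  imports "HOL-Analysis.Analysis" "HOL-Library.Disjoint_Sets"
begin

section \<open>The Hilbert space of square-summable functions\<close>

typedef 'a ell2 = "{f :: 'a \<Rightarrow> complex. (\<lambda>x. (cmod (f x))\<^sup>2) summable_on UNIV}"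
  morphisms ell2_apply Abs_ell2
  by (rule exI[of _ "\<lambda>_. 0"]) simp

setup_lifting type_definition_ell2

lemma ell2_mult_abs_summable:
  assumes "(\<lambda>x. (cmod (f x))\<^sup>2) summable_on UNIV" "(\<lambda>x. (cmod (g x))\<^sup>2) summable_on UNIV"
  shows "(\<lambda>x. cmod (f x) * cmod (g x)) summable_on UNIV"
proof (rule summable_on_comparison_test)
  show "(\<lambda>x. (cmod (f x))\<^sup>2 + (cmod (g x))\<^sup>2) summable_on UNIV"
    using assms by (rule summable_on_add)
  fix x
  show "cmod (f x) * cmod (g x) \<le> (cmod (f x))\<^sup>2 + (cmod (g x))\<^sup>2"
    using sum_squares_bound[of "cmod (f x)" "cmod (g x)"]
      mult_nonneg_nonneg[OF norm_ge_zero[of "f x"] norm_ge_zero[of "g x"]] by linarith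
qed auto

lemma ell2_inner_summable:
  assumes "(\<lambda>x. (cmod (f x))\<^sup>2) summable_on UNIV" "(\<lambda>x. (cmod (g x))\<^sup>2) summable_on UNIV"
  shows "(\<lambda>x. f x \<bullet> g x) summable_on UNIV"
proof (rule abs_summable_summable, rule summable_on_comparison_test)
  show "(\<lambda>x. cmod (f x) * cmod (g x)) summable_on UNIV"
    using assms by (rule ell2_mult_abs_summable)
  fix x
  show "norm (f x \<bullet> g x) \<le> cmod (f x) * cmod (g x)"
    using Cauchy_Schwarz_ineq2[of "f x" "g x"] by simp
qed (rule norm_ge_zero)

lemma ell2_add_summable:
  assumes "(\<lambda>x. (cmod (f x))\<^sup>2) summable_on UNIV" "(\<lambda>x. (cmod (g x))\<^sup>2) summable_on UNIV"
  shows "(\<lambda>x. (cmod (f x + g x))\<^sup>2) summable_on UNIV"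
proof (rule summable_on_comparison_test)
  show "(\<lambda>x. (cmod (f x))\<^sup>2 + (cmod (g x))\<^sup>2 + 2 * (cmod (f x) * cmod (g x))) summable_on UNIV"
    using assms by (intro summable_on_add summable_on_cmult_right ell2_mult_abs_summable)
  fix x
  have "(cmod (f x + g x))\<^sup>2 \<le> (cmod (f x) + cmod (g x))\<^sup>2"
    by (intro power_mono norm_triangle_ineq) auto
  then show "(cmod (f x + g x))\<^sup>2 \<le> (cmod (f x))\<^sup>2 + (cmod (g x))\<^sup>2 + 2 * (cmod (f x) * cmod (g x))"
    by (simp add: power2_sum mult.assoc)
qed auto

lemma ell2_scale_summable:
  assumes "(\<lambda>x. (cmod (f x))\<^sup>2) summable_on UNIV"
  shows "(\<lambda>x. (cmod (c * f x))\<^sup>2) summable_on UNIV"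
  using summable_on_cmult_right[OF assms, of "(cmod c)\<^sup>2"] by (simp add: norm_mult power_mult_distrib)

instantiation ell2 :: (type) real_vector
begin

lift_definition zero_ell2 :: "'a ell2" is "\<lambda>_. 0" by simp

lift_definition plus_ell2 :: "'a ell2 \<Rightarrow> 'a ell2 \<Rightarrow> 'a ell2" is "\<lambda>f g x. f x + g x"
  by (rule ell2_add_summable)

lift_definition uminus_ell2 :: "'a ell2 \<Rightarrow> 'a ell2" is "\<lambda>f x. - f x" by simp

lift_definition minus_ell2 :: "'a ell2 \<Rightarrow> 'a ell2 \<Rightarrow> 'a ell2" is "\<lambda>f g x. f x - g x"
proof -
  fix f g :: "'a \<Rightarrow> complex"
  assume "(\<lambda>x. (cmod (f x))\<^sup>2) summable_on UNIV" "(\<lambda>x. (cmod (g x))\<^sup>2) summable_on UNIV"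
  then show "(\<lambda>x. (cmod (f x - g x))\<^sup>2) summable_on UNIV"
    using ell2_add_summable[of f "\<lambda>x. - g x"] by simp
qed

lift_definition scaleR_ell2 :: "real \<Rightarrow> 'a ell2 \<Rightarrow> 'a ell2" is "\<lambda>r f x. r *\<^sub>R f x"
  unfolding scaleR_conv_of_real by (rule ell2_scale_summable)

instance
proof
  fix f g h :: "'a ell2" and r s :: real
  show "f + g + h = f + (g + h)" by transfer (simp add: add.assoc)
  show "f + g = g + f" by transfer (simp add: add.commute)
  show "0 + f = f" "- f + f = 0" "f - g = f + - g" by (transfer; simp)+
  show "r *\<^sub>R (f + g) = r *\<^sub>R f + r *\<^sub>R g" by transfer (simp add: scaleR_add_right)
  show "(r + s) *\<^sub>R f = r *\<^sub>R f + s *\<^sub>R f" by transfer (simp add: scaleR_add_left)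
  show "r *\<^sub>R s *\<^sub>R f = (r * s) *\<^sub>R f" "1 *\<^sub>R f = f" by (transfer; simp)+
qed

end

text \<open>The inner product of the class \<^class>\<open>real_inner\<close> is the real part of the complex inner
  product \<open>cinner\<close> below; the induced norm is the usual one (\<open>norm_ell2\<close>).\<close>

instantiation ell2 :: (type) real_inner
begin

lift_definition inner_ell2 :: "'a ell2 \<Rightarrow> 'a ell2 \<Rightarrow> real" is "\<lambda>f g. \<Sum>\<^sub>\<infinity>x. f x \<bullet> g x" .

definition norm_ell2 :: "'a ell2 \<Rightarrow> real" where "norm_ell2 f = sqrt (f \<bullet> f)"

definition dist_ell2 :: "'a ell2 \<Rightarrow> 'a ell2 \<Rightarrow> real" where "dist_ell2 f g = norm (f - g)"

definition sgn_ell2 :: "'a ell2 \<Rightarrow> 'a ell2" where "sgn_ell2 f = f /\<^sub>R norm f"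

definition uniformity_ell2 :: "('a ell2 \<times> 'a ell2) filter" where
  "uniformity_ell2 = (INF e\<in>{0 <..}. principal {(f, g). dist f g < e})"

definition open_ell2 :: "'a ell2 set \<Rightarrow> bool" where
  "open_ell2 U \<longleftrightarrow> (\<forall>f\<in>U. eventually (\<lambda>(f', g). f' = f \<longrightarrow> g \<in> U) uniformity)"

instance
proof
  fix f g h :: "'a ell2" and r :: real
  show "dist f g = norm (f - g)" by (rule dist_ell2_def)
  show "sgn f = f /\<^sub>R norm f" by (rule sgn_ell2_def)
  show "uniformity = (INF e\<in>{0 <..}. principal {(f, g :: 'a ell2). dist f g < e})"
    by (rule uniformity_ell2_def)
  fix U :: "'a ell2 set"
  show "open U \<longleftrightarrow> (\<forall>f\<in>U. eventually (\<lambda>(f', g). f' = f \<longrightarrow> g \<in> U) uniformity)"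
    by (rule open_ell2_def)
  show "f \<bullet> g = g \<bullet> f" by transfer (simp add: inner_commute)
  show "(f + g) \<bullet> h = f \<bullet> h + g \<bullet> h"
    by transfer (simp add: inner_add_left infsum_add ell2_inner_summable)
  show "r *\<^sub>R f \<bullet> g = r * (f \<bullet> g)"
    by transfer (simp add: infsum_cmult_right')
  show "0 \<le> f \<bullet> f" by transfer (simp add: infsum_nonneg)
  show "f \<bullet> f = 0 \<longleftrightarrow> f = 0"
  proof transfer
    fix f :: "'a \<Rightarrow> complex"
    assume f: "(\<lambda>x. (cmod (f x))\<^sup>2) summable_on UNIV"
    show "(\<Sum>\<^sub>\<infinity>x. f x \<bullet> f x) = 0 \<longleftrightarrow> f = (\<lambda>_. 0)"
    proof
      assume "(\<Sum>\<^sub>\<infinity>x. f x \<bullet> f x) = 0"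
      then have "f x \<bullet> f x = 0" for x
        by (intro nonneg_infsum_le_0D[where A=UNIV]) (auto simp: ell2_inner_summable f)
      then show "f = (\<lambda>_. 0)" by auto
    qed simp
  qed
  show "norm f = sqrt (f \<bullet> f)" by (rule norm_ell2_def)
qed

end

lemma norm_ell2: "norm f = sqrt (\<Sum>\<^sub>\<infinity>x. (cmod (ell2_apply f x))\<^sup>2)"
  unfolding norm_ell2_def by transfer (simp add: dot_square_norm)

lift_definition ell2_scaleC :: "complex \<Rightarrow> 'a ell2 \<Rightarrow> 'a ell2" is "\<lambda>c f x. c * f x"
  by (rule ell2_scale_summable)

lift_definition cinner :: "'a ell2 \<Rightarrow> 'a ell2 \<Rightarrow> complex" is "\<lambda>f g. \<Sum>\<^sub>\<infinity>x. f x * cnj (g x)" .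

lift_definition ell2_delta :: "'a \<Rightarrow> 'a ell2" is "\<lambda>x y. if y = x then 1 else 0"
proof -
  fix x :: 'a
  have "(\<lambda>y. (cmod (if y = x then 1 else 0))\<^sup>2) summable_on {x}" by simp
  then show "(\<lambda>y. (cmod (if y = x then 1 else 0))\<^sup>2) summable_on UNIV"
    by (subst summable_on_cong_neutral[where T="{x}"]) auto
qed

lemma Re_cinner: "Re (cinner f g) = f \<bullet> g"
proof transfer
  fix f g :: "'a \<Rightarrow> complex"
  assume "(\<lambda>x. (cmod (f x))\<^sup>2) summable_on UNIV" "(\<lambda>x. (cmod (g x))\<^sup>2) summable_on UNIV"
  then have "(\<lambda>x. norm (f x * cnj (g x))) summable_on UNIV"
    by (simp add: norm_mult ell2_mult_abs_summable)
  then have "(\<lambda>x. f x * cnj (g x)) summable_on UNIV"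
    by (rule abs_summable_summable)
  then show "Re (\<Sum>\<^sub>\<infinity>x. f x * cnj (g x)) = (\<Sum>\<^sub>\<infinity>x. f x \<bullet> g x)"
    by (subst infsum_Re[symmetric]) (simp_all add: inner_complex_def)
qed

lemma norm_ell2_scaleC: "norm (ell2_scaleC c f) = cmod c * norm f"
  unfolding norm_ell2
  by transfer (simp add: norm_mult power_mult_distrib infsum_cmult_right' real_sqrt_mult)


section \<open>Operators\<close>

type_synonym 'a op = "'a ell2 \<Rightarrow>\<^sub>L 'a ell2"

text \<open>For \<open>X \<subseteq> UNIV\<close>, the Hilbert space \<open>\<ell>\<^sub>2(X)\<close> is the closed subspace of the functions that
  vanish off \<open>X\<close>, and an operator on it is extended by zero on the orthogonal complement.  This
  identification preserves norms, sums, products and adjoints.  Elements of \<^typ>\<open>'a op\<close> are only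
  real-linear, so complex homogeneity is required explicitly.\<close>

definition bounded_ops :: "'a set \<Rightarrow> 'a op set" where
  "bounded_ops X = {a.
     (\<forall>c f. blinfun_apply a (ell2_scaleC c f) = ell2_scaleC c (blinfun_apply a f)) \<and>
     (\<forall>f. \<forall>x. x \<notin> X \<longrightarrow> ell2_apply (blinfun_apply a f) x = 0) \<and>
     (\<forall>f. (\<forall>x\<in>X. ell2_apply f x = 0) \<longrightarrow> blinfun_apply a f = 0)}"

lemma bounded_linear_ell2_scaleC: "bounded_linear (ell2_scaleC c)"
proof (rule bounded_linear_intro)
  fix f g :: "'a ell2" and r :: real
  show "ell2_scaleC c (f + g) = ell2_scaleC c f + ell2_scaleC c g"
    by (simp flip: ell2_apply_inject
        add: ell2_scaleC.rep_eq plus_ell2.rep_eq fun_eq_iff distrib_left)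
  show "ell2_scaleC c (r *\<^sub>R f) = r *\<^sub>R ell2_scaleC c f"
    by (simp flip: ell2_apply_inject add: ell2_scaleC.rep_eq scaleR_ell2.rep_eq fun_eq_iff)
  show "norm (ell2_scaleC c f) \<le> norm f * cmod c"
    by (simp add: norm_ell2_scaleC)
qed

definition op_scaleC :: "complex \<Rightarrow> 'a op \<Rightarrow> 'a op" where
  "op_scaleC c a = Blinfun (ell2_scaleC c) o\<^sub>L a"

lemma op_scaleC_apply: "blinfun_apply (op_scaleC c a) f = ell2_scaleC c (blinfun_apply a f)"
  by (simp add: op_scaleC_def bounded_linear_Blinfun_apply[OF bounded_linear_ell2_scaleC])

text \<open>Adjoint and order are meant for complex-linear operators, where the adjoint exists and is
  unique.  \<open>op_le 0 a\<close> is the usual notion of a positive operator.\<close>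

definition op_adjoint :: "'a op \<Rightarrow> 'a op" where
  "op_adjoint a = (THE b. \<forall>f g. cinner (blinfun_apply a f) g = cinner f (blinfun_apply b g))"

definition op_le :: "'a op \<Rightarrow> 'a op \<Rightarrow> bool" where
  "op_le a b \<longleftrightarrow> (\<forall>f. cinner (blinfun_apply (b - a) f) f \<in> \<real>\<^sub>\<ge>\<^sub>0)"

definition compact_op :: "'a op \<Rightarrow> bool" where
  "compact_op a \<longleftrightarrow> compact (closure (blinfun_apply a ` cball 0 1))"

definition projection_op :: "'a op \<Rightarrow> bool" where
  "projection_op p \<longleftrightarrow> p o\<^sub>L p = p \<and> op_adjoint p = p"

definition matrix_coeff :: "'a op \<Rightarrow> 'a \<Rightarrow> 'a \<Rightarrow> complex" where
  "matrix_coeff a x y = cinner (blinfun_apply a (ell2_delta x)) (ell2_delta y)"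

definition cstar_subalgebra :: "'a op set \<Rightarrow> 'a op set \<Rightarrow> bool" where
  "cstar_subalgebra B A \<longleftrightarrow> B \<subseteq> A \<and> closed B \<and> 0 \<in> B \<and>
     (\<forall>a\<in>B. \<forall>b\<in>B. a + b \<in> B \<and> a o\<^sub>L b \<in> B) \<and>
     (\<forall>c. \<forall>a\<in>B. op_scaleC c a \<in> B) \<and>
     (\<forall>a\<in>B. op_adjoint a \<in> B)"

definition hereditary_cstar_subalgebra :: "'a op set \<Rightarrow> 'a op set \<Rightarrow> bool" where
  "hereditary_cstar_subalgebra B A \<longleftrightarrow> cstar_subalgebra B A \<and>
     (\<forall>a\<in>A. \<forall>b\<in>B. op_le 0 a \<and> op_le a b \<longrightarrow> a \<in> B)"

definition cstar_isomorphic :: "'a op set \<Rightarrow> 'b op set \<Rightarrow> bool" where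
  "cstar_isomorphic A B \<longleftrightarrow> (\<exists>\<Phi>. bij_betw \<Phi> A B \<and>
     (\<forall>a\<in>A. \<forall>b\<in>A. \<Phi> (a + b) = \<Phi> a + \<Phi> b \<and> \<Phi> (a o\<^sub>L b) = \<Phi> a o\<^sub>L \<Phi> b) \<and>
     (\<forall>c. \<forall>a\<in>A. \<Phi> (op_scaleC c a) = op_scaleC c (\<Phi> a)) \<and>
     (\<forall>a\<in>A. \<Phi> (op_adjoint a) = op_adjoint (\<Phi> a)))"


section \<open>Coarse geometry and uniform Roe algebras\<close>

definition uniformly_locally_finite :: "'a set \<Rightarrow> ('a \<Rightarrow> 'a \<Rightarrow> real) \<Rightarrow> bool" where
  "uniformly_locally_finite X d \<longleftrightarrow> (\<forall>r>0. \<exists>N. \<forall>x\<in>X.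
     finite (Metric_space.mcball X d x r) \<and> card (Metric_space.mcball X d x r) \<le> N)"

definition finite_propagation :: "'a set \<Rightarrow> ('a \<Rightarrow> 'a \<Rightarrow> real) \<Rightarrow> 'a op \<Rightarrow> bool" where
  "finite_propagation X d a \<longleftrightarrow> (\<exists>r>0. \<forall>x\<in>X. \<forall>y\<in>X. d x y > r \<longrightarrow> matrix_coeff a x y = 0)"

definition uniform_Roe :: "'a set \<Rightarrow> ('a \<Rightarrow> 'a \<Rightarrow> real) \<Rightarrow> 'a op set" where
  "uniform_Roe X d = closure {a \<in> bounded_ops X. finite_propagation X d a}"

definition ghost :: "'a set \<Rightarrow> 'a op \<Rightarrow> bool" where
  "ghost X a \<longleftrightarrow> (\<forall>\<epsilon>>0. \<exists>A. finite A \<and> A \<subseteq> X \<and>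
     (\<forall>x\<in>X - A. \<forall>y\<in>X - A. cmod (matrix_coeff a x y) < \<epsilon>))"

definition only_compact_ghost_projections :: "'a set \<Rightarrow> ('a \<Rightarrow> 'a \<Rightarrow> real) \<Rightarrow> bool" where
  "only_compact_ghost_projections X d \<longleftrightarrow>
     (\<forall>p\<in>uniform_Roe X d. projection_op p \<and> ghost X p \<longrightarrow> compact_op p)"

text \<open>Distances and infima are taken in \<^typ>\<open>ereal\<close>, so that the infimum over the empty set
  is \<open>\<infinity>\<close>; in particular, every map from a bounded space is expanding.\<close>

definition set_distance :: "('a \<Rightarrow> 'a \<Rightarrow> real) \<Rightarrow> 'a set \<Rightarrow> 'a set \<Rightarrow> ereal" where
  "set_distance d A B = (INF (x, y)\<in>A \<times> B. ereal (d x y))"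

definition sparse_space :: "'a set \<Rightarrow> ('a \<Rightarrow> 'a \<Rightarrow> real) \<Rightarrow> bool" where
  "sparse_space X d \<longleftrightarrow> (\<exists>P :: nat \<Rightarrow> 'a set.
     disjoint_family P \<and> (\<Union>n. P n) = X \<and> (\<forall>n. finite (P n) \<and> P n \<noteq> {}) \<and>
     (\<forall>K :: real. \<exists>N. \<forall>n m. n \<noteq> m \<and> n + m \<ge> N \<longrightarrow> set_distance d (P n) (P m) \<ge> ereal K))"

definition coarse_map ::
  "'a set \<Rightarrow> ('a \<Rightarrow> 'a \<Rightarrow> real) \<Rightarrow> ('b \<Rightarrow> 'b \<Rightarrow> real) \<Rightarrow> ('a \<Rightarrow> 'b) \<Rightarrow> bool" where
  "coarse_map X dX dY f \<longleftrightarrow>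
     (\<forall>r>0. bdd_above {dY (f x) (f y) | x y. x \<in> X \<and> y \<in> X \<and> dX x y \<le> r})"

definition expanding_map ::
  "'a set \<Rightarrow> ('a \<Rightarrow> 'a \<Rightarrow> real) \<Rightarrow> ('b \<Rightarrow> 'b \<Rightarrow> real) \<Rightarrow> ('a \<Rightarrow> 'b) \<Rightarrow> bool" where
  "expanding_map X dX dY f \<longleftrightarrow>
     ((\<lambda>r. INF (x, y)\<in>{(x, y). x \<in> X \<and> y \<in> X \<and> dX x y \<ge> r}. ereal (dY (f x) (f y)))
       \<longlongrightarrow> \<infinity>) (at_top :: real filter)"

definition coarse_embedding ::
  "'a set \<Rightarrow> ('a \<Rightarrow> 'a \<Rightarrow> real) \<Rightarrow> 'b set \<Rightarrow> ('b \<Rightarrow> 'b \<Rightarrow> real) \<Rightarrow> ('a \<Rightarrow> 'b) \<Rightarrow> bool" where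
  "coarse_embedding X dX Y dY f \<longleftrightarrow>
     f \<in> X \<rightarrow> Y \<and> coarse_map X dX dY f \<and> expanding_map X dX dY f"

text \<open>The condition that \<open>A x \<inter> A y\<close> is nonempty is implicit in the quotient being defined; it
  must be explicit here because division by zero yields zero.\<close>

definition property_A :: "'a set \<Rightarrow> ('a \<Rightarrow> 'a \<Rightarrow> real) \<Rightarrow> bool" where
  "property_A Y d \<longleftrightarrow> (\<forall>r>0. \<forall>\<epsilon>>0. \<exists>R>0. \<exists>A :: 'a \<Rightarrow> ('a \<times> nat) set.
     (\<forall>x\<in>Y. finite (A x) \<and> A x \<subseteq> Y \<times> UNIV \<and> (x, 1) \<in> A x) \<and>
     (\<forall>x\<in>Y. \<forall>y\<in>Y. d x y \<le> r \<longrightarrow> A x \<inter> A y \<noteq> {} \<and>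
        real (card (sym_diff (A x) (A y))) / real (card (A x \<inter> A y)) < \<epsilon>) \<and>
     (\<forall>x\<in>Y. \<forall>y z m n. (y, m) \<in> A x \<and> (z, n) \<in> A x \<longrightarrow> d y z \<le> R))"

end

theory Submission
  imports Defs
begin

text \<open>The isomorphism \<open>\<Phi>\<close> from \<open>C*_u(X)\<close> onto the hereditary subalgebra \<open>B\<close> is spatial. A matrix unit
\<open>e_xx\<close> cuts \<open>C*_u(X)\<close> down to the scalars. As \<open>B\<close> is hereditary and \<open>C*_u(Y)\<close> contains every
rank one operator, \<open>\<Phi>(e_xx)\<close> must be the projection onto a single unit vector \<open>\<xi>_x\<close>, and \<open>\<Phi>(1)\<close>
is the projection onto the closed span of these vectors. Hence \<open>\<Phi>(a) = u a u*\<close> for the isometry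
\<open>u\<close> with \<open>u \<delta>_x = \<xi>_x\<close>, and, again because \<open>B\<close> is hereditary, \<open>u* b u\<close> lies in \<open>C*_u(X)\<close> for
every \<open>b\<close> in \<open>C*_u(Y)\<close> (\<open>spatial_implementation\<close>).

Both \<open>a \<mapsto> u a u*\<close> and \<open>b \<mapsto> u* b u\<close> send the operators \<open>\<Sum> e_xy\<close>, summed over the finite sets
\<open>E\<close> of pairs at distance at most \<open>r\<close>, to operators that are within \<open>\<epsilon>\<close> of propagation at most
\<open>s\<close>, where \<open>s\<close> depends on \<open>r\<close> and \<open>\<epsilon>\<close> but not on \<open>E\<close> (\<open>equi_approx\<close>). The reason is a gliding
hump: from finite sets violating this for larger and larger \<open>s\<close> one extracts almost orthogonal
ones, and the union of these gives an operator in \<open>C*_u(X)\<close> whose image is not in \<open>C*_u(Y)\<close>.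
Applied to single pairs, this says that if the coordinates \<open>\<xi>_x(y)\<close> and \<open>\<xi>_x'(y')\<close> are bounded
below, then \<open>d(x,x')\<close> and \<open>d(y,y')\<close> control each other (\<open>coarse_on_atoms\<close>). So every map \<open>f\<close>
with \<open>|\<xi>_x(f x)| \<ge> c > 0\<close> for all \<open>x\<close> is a coarse embedding.

Such a map exists if sparse subspaces of \<open>Y\<close> yield only compact ghost projections
(\<open>uniformly_large_coordinates\<close>). Otherwise there are \<open>x_n\<close> for which the largest coordinate of
\<open>\<xi>_{x_n}\<close> tends to zero; after thinning out, these vectors almost live on finite sets that move
apart, and the projection onto the span of the truncated vectors is a noncompact ghost projection
of a sparse subspace.

For the injective version, Hall's marriage theorem is applied to the balls of a fixed radius
around the points \<open>f x\<close>. Hall's condition is a statement about ranks. If a finite set \<open>F \<subseteq> X\<close> had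
more elements than the set \<open>K\<close> of all points of \<open>Y\<close> at which some \<open>\<xi>_x\<close>, \<open>x \<in> F\<close>, has a coordinate
above a threshold \<open>\<delta>\<close>, then some nonzero vector in the range of \<open>q = u \<chi>_F u*\<close> would vanish on
\<open>K\<close>. Property A cuts this vector into pieces supported on sets of bounded diameter, one of which is
nearly fixed by \<open>q\<close> (\<open>property_A_localization\<close>). So \<open>q \<delta>_z\<close> is bounded below for a point \<open>z\<close>
outside \<open>K\<close>. But then some \<open>\<xi>_x(z)\<close> with \<open>x \<in> F\<close> is bounded below too: otherwise signs on \<open>F\<close> can
be chosen for which the image of \<open>\<delta>_z\<close> has little mass near \<open>z\<close>, contradicting the uniform
approximation (\<open>large_column_large_coordinate\<close>). With \<open>\<delta>\<close> chosen to be this bound, \<open>z\<close> lies in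
\<open>K\<close>, a contradiction.\<close>

section \<open>Square-summable functions\<close>

notation blinfun_compose (infixl "\<odot>" 70)
notation ell2_apply (infixl "$$" 90)

lemma ell2_eqI: "(\<And>x. f $$ x = g $$ x) \<Longrightarrow> f = g"
  by (metis ell2_apply_inject ext)

lemmas ell2_apply_simps [simp] = zero_ell2.rep_eq plus_ell2.rep_eq minus_ell2.rep_eq
  uminus_ell2.rep_eq scaleR_ell2.rep_eq ell2_scaleC.rep_eq ell2_delta.rep_eq

lemma ell2_apply_sum [simp]: "(\<Sum>i\<in>I. f i) $$ x = (\<Sum>i\<in>I. f i $$ x)"
  by (induction I rule: infinite_finite_induct) auto

lemma ell2_summable: "(\<lambda>x. (cmod (f $$ x))^2) summable_on UNIV"
  using ell2_apply[of f] by simp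

lemma norm_ell2_sq: "(norm f)^2 = (\<Sum>\<^sub>\<infinity>x. (cmod (f $$ x))^2)"
  by (simp add: norm_ell2 infsum_nonneg)

lemma sum_sq_le_norm: "(\<Sum>x\<in>F. (cmod (f $$ x))^2) \<le> (norm f)^2"
proof (cases "finite F")
  case True
  then show ?thesis
    unfolding norm_ell2_sq by (intro finite_sum_le_infsum ell2_summable) auto
qed auto

lemma norm_leI:
  assumes "\<And>F. finite F \<Longrightarrow> (\<Sum>x\<in>F. (cmod (f $$ x))^2) \<le> C^2" "0 \<le> C"
  shows "norm f \<le> C"
proof -
  have "(norm f)^2 \<le> C^2"
    unfolding norm_ell2_sq by (rule infsum_le_finite_sums[OF ell2_summable assms(1)])
  then show ?thesis using assms(2) by (rule power2_le_imp_le)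
qed

lemma cmod_le_norm: "cmod (f $$ x) \<le> norm f"
  by (rule power2_le_imp_le[OF _ norm_ge_zero]) (use sum_sq_le_norm[of f "{x}"] in simp)

lemma norm_sq_supported:
  assumes "finite F" "\<And>x. x \<notin> F \<Longrightarrow> f $$ x = 0"
  shows "(norm f)^2 = (\<Sum>x\<in>F. (cmod (f $$ x))^2)"
proof -
  have "(\<Sum>\<^sub>\<infinity>x. (cmod (f $$ x))^2) = (\<Sum>\<^sub>\<infinity>x\<in>F. (cmod (f $$ x))^2)"
    by (rule infsum_cong_neutral) (use assms(2) in auto)
  then show ?thesis using assms(1) by (simp add: norm_ell2_sq)
qed

lemma norm_delta [simp]: "norm (ell2_delta x :: 'a ell2) = 1"
proof -
  have "(norm (ell2_delta x :: 'a ell2))^2 = 1"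
    by (subst norm_sq_supported[of "{x}"]) auto
  then show ?thesis by (smt (verit) norm_ge_zero power2_eq_1_iff)
qed

lemma scaleC_add: "ell2_scaleC c (f + g) = ell2_scaleC c f + ell2_scaleC c g"
  by (rule ell2_eqI) (simp add: distrib_left)
lemma scaleC_diff: "ell2_scaleC c (f - g) = ell2_scaleC c f - ell2_scaleC c g"
  by (rule ell2_eqI) (simp add: right_diff_distrib)
lemma scaleC_add_left: "ell2_scaleC (c + d) f = ell2_scaleC c f + ell2_scaleC d f"
  by (rule ell2_eqI) (simp add: distrib_right)
lemma scaleC_scaleC [simp]: "ell2_scaleC c (ell2_scaleC d f) = ell2_scaleC (c * d) f"
  by (rule ell2_eqI) simp
lemma scaleC_0 [simp]: "ell2_scaleC 0 f = 0" "ell2_scaleC c 0 = 0"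
  by (rule ell2_eqI; simp)+
lemma scaleC_1 [simp]: "ell2_scaleC 1 f = f"
  by (rule ell2_eqI) simp
lemma scaleC_of_real: "ell2_scaleC (of_real r) f = r *\<^sub>R f"
  by (rule ell2_eqI) (simp add: scaleR_conv_of_real)
lemma scaleC_scaleR: "ell2_scaleC c (r *\<^sub>R f) = r *\<^sub>R ell2_scaleC c f"
  by (rule ell2_eqI) simp

lemma cinner_summable: "(\<lambda>x. f $$ x * cnj (g $$ x)) summable_on UNIV"
  by (rule abs_summable_summable)
     (simp add: norm_mult ell2_mult_abs_summable ell2_summable)

lemma cinner_add_left: "cinner (f + g) h = cinner f h + cinner g h"
  by (simp add: cinner.rep_eq distrib_right infsum_add cinner_summable)

lemma cinner_scaleC_left: "cinner (ell2_scaleC c f) g = c * cinner f g"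
  by (simp add: cinner.rep_eq mult.assoc infsum_cmult_right')

lemma cnj_cinner: "cnj (cinner f g) = cinner g f"
  by (simp add: cinner.rep_eq mult.commute flip: infsum_cnj)

lemma cinner_add_right: "cinner h (f + g) = cinner h f + cinner h g"
  by (metis cinner_add_left cnj_cinner complex_cnj_add)

lemma cinner_scaleC_right: "cinner f (ell2_scaleC c g) = cnj c * cinner f g"
  by (metis cinner_scaleC_left cnj_cinner complex_cnj_mult)

lemma cinner_0 [simp]: "cinner 0 f = 0" "cinner f 0 = 0"
  by (metis scaleC_0(1) cinner_scaleC_left mult_zero_left)
     (metis scaleC_0(1) cinner_scaleC_right mult_zero_left complex_cnj_zero)

lemma cinner_scaleR_left: "cinner (r *\<^sub>R f) g = of_real r * cinner f g"
  by (metis cinner_scaleC_left scaleC_of_real)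
lemma cinner_scaleR_right: "cinner f (r *\<^sub>R g) = of_real r * cinner f g"
  by (metis cinner_scaleC_right scaleC_of_real complex_cnj_complex_of_real)

lemma cinner_minus_left: "cinner (- f) g = - cinner f g"
  using cinner_scaleR_left[of "-1"] by simp
lemma cinner_minus_right: "cinner f (- g) = - cinner f g"
  using cinner_scaleR_right[of _ "-1"] by simp

lemma cinner_diff_left: "cinner (f - g) h = cinner f h - cinner g h"
  using cinner_add_left[of f "-g" h] by (simp add: cinner_minus_left)
lemma cinner_diff_right: "cinner h (f - g) = cinner h f - cinner h g"
  using cinner_add_right[of h f "-g"] by (simp add: cinner_minus_right)

lemma cinner_sum_left: "cinner (\<Sum>i\<in>I. f i) g = (\<Sum>i\<in>I. cinner (f i) g)"
  by (induction I rule: infinite_finite_induct) (auto simp: cinner_add_left)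
lemma cinner_sum_right: "cinner g (\<Sum>i\<in>I. f i) = (\<Sum>i\<in>I. cinner g (f i))"
  by (induction I rule: infinite_finite_induct) (auto simp: cinner_add_right)

lemma cinner_self: "cinner f f = of_real ((norm f)^2)"
proof -
  have "Im (cinner f f) = 0"
    using arg_cong[OF cnj_cinner[of f f], of Im] by simp
  moreover have "Re (cinner f f) = (norm f)^2"
    by (simp add: Re_cinner dot_square_norm)
  ultimately show ?thesis by (simp add: complex_eq_iff)
qed

lemma cinner_delta_right [simp]: "cinner f (ell2_delta x) = f $$ x"
proof -
  have "cinner f (ell2_delta x) = (\<Sum>\<^sub>\<infinity>y\<in>{x}. f $$ x)"
    unfolding cinner.rep_eq by (rule infsum_cong_neutral) auto
  then show ?thesis by simp
qed

lemma cinner_delta_left [simp]: "cinner (ell2_delta x) f = cnj (f $$ x)"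
  by (metis cnj_cinner cinner_delta_right)

lemma norm_eq_1I: "cinner f f = 1 \<Longrightarrow> norm f = 1"
  using of_real_eq_1_iff[of "(norm f)^2", where 'a=complex] power2_eq_imp_eq[of "norm f" 1]
  by (simp add: cinner_self)

lemma cinner_Cauchy_Schwarz: "cmod (cinner f g) \<le> norm f * norm g"
proof (cases "cinner f g = 0")
  case False
  let ?c = "cinner f g" and ?w = "cnj (cinner f g) / of_real (cmod (cinner f g))"
  have "?w * ?c = of_real ((cmod ?c)^2) / of_real (cmod ?c)"
    unfolding complex_norm_square by (simp add: mult.commute)
  also have "\<dots> = of_real (cmod ?c)"
    using False by (simp add: power2_eq_square)
  finally have "cmod ?c = Re (?w * ?c)" by simp
  also have "\<dots> = ell2_scaleC ?w f \<bullet> g" by (metis Re_cinner cinner_scaleC_left)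
  also have "\<dots> \<le> norm (ell2_scaleC ?w f) * norm g" by (rule norm_cauchy_schwarz)
  also have "\<dots> = norm f * norm g" using False by (simp add: norm_ell2_scaleC norm_divide)
  finally show ?thesis .
qed auto


section \<open>Complex-linear operators given by coordinates\<close>

text \<open>Operators are only real-linear by type, and adjoints exist for the complex-linear ones.\<close>

definition clin :: "('a ell2 \<Rightarrow>\<^sub>L 'b ell2) \<Rightarrow> bool" where
  "clin a \<longleftrightarrow> (\<forall>c f. a (ell2_scaleC c f) = ell2_scaleC c (a f))"

text \<open>The common pattern of the operators below: a bound on the finite partial sums of squared
coordinates gives both square-summability and the norm estimate.\<close>

definition coord_op :: "('a ell2 \<Rightarrow> 'b \<Rightarrow> complex) \<Rightarrow> 'a ell2 \<Rightarrow>\<^sub>L 'b ell2" where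
  "coord_op \<phi> = Blinfun (\<lambda>f. Abs_ell2 (\<phi> f))"

lemma coord_op:
  assumes add: "\<And>f g y. \<phi> (f + g) y = \<phi> f y + \<phi> g y"
    and scale: "\<And>c f y. \<phi> (ell2_scaleC c f) y = c * \<phi> f y"
    and bound: "\<And>f F. finite F \<Longrightarrow> (\<Sum>y\<in>F. (cmod (\<phi> f y))^2) \<le> (C * norm f)^2"
    and C: "0 \<le> C"
  shows "coord_op \<phi> f $$ y = \<phi> f y" "clin (coord_op \<phi>)" "norm (coord_op \<phi>) \<le> C"
proof -
  have summable: "(\<lambda>y. (cmod (\<phi> f y))^2) summable_on UNIV" for f
    by (rule nonneg_bdd_above_summable_on) (auto intro!: bdd_aboveI bound)
  have ap: "Abs_ell2 (\<phi> f) $$ y = \<phi> f y" for f y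
    using summable by (simp add: Abs_ell2_inverse)
  have bd: "norm (Abs_ell2 (\<phi> f)) \<le> C * norm f" for f
    by (rule norm_leI) (use bound C in \<open>auto simp: ap\<close>)
  have "bounded_linear (\<lambda>f. Abs_ell2 (\<phi> f))"
  proof (rule bounded_linear_intro)
    fix f g show "Abs_ell2 (\<phi> (f + g)) = Abs_ell2 (\<phi> f) + Abs_ell2 (\<phi> g)"
      by (rule ell2_eqI) (simp add: ap add)
    fix r show "Abs_ell2 (\<phi> (r *\<^sub>R f)) = r *\<^sub>R Abs_ell2 (\<phi> f)"
      by (rule ell2_eqI) (simp add: ap scale scaleR_conv_of_real flip: scaleC_of_real)
    show "norm (Abs_ell2 (\<phi> f)) \<le> norm f * C" using bd[of f] by (simp add: mult.commute)
  qed
  then have app: "coord_op \<phi> f = Abs_ell2 (\<phi> f)" for f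
    by (simp add: coord_op_def bounded_linear_Blinfun_apply)
  show "coord_op \<phi> f $$ y = \<phi> f y" by (simp add: app ap)
  show "clin (coord_op \<phi>)"
    unfolding clin_def by (intro allI ell2_eqI) (simp add: app ap scale)
  show "norm (coord_op \<phi>) \<le> C"
    using C bd by (intro norm_blinfun_bound) (auto simp: app)
qed

lemma clinD: "clin a \<Longrightarrow> a (ell2_scaleC c f) = ell2_scaleC c (a f)"
  by (simp add: clin_def)

lemma clin_intros [intro, simp]:
  "clin 0" "clin id_blinfun"
  "clin a \<Longrightarrow> clin b \<Longrightarrow> clin (a + b)" "clin a \<Longrightarrow> clin b \<Longrightarrow> clin (a - b)"
  "clin a \<Longrightarrow> clin (r *\<^sub>R a)"
  by (auto simp: clin_def blinfun.add_left blinfun.diff_left scaleC_add scaleC_diff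
      blinfun.scaleR_left scaleC_scaleR)

lemma clin_compose [intro, simp]: "clin a \<Longrightarrow> clin b \<Longrightarrow> clin (a \<odot> b)"
  by (simp add: clin_def)


definition cutoff :: "'a set \<Rightarrow> 'a op" where
  "cutoff A = coord_op (\<lambda>f x. if x \<in> A then f $$ x else 0)"

lemma cutoff_aux:
  "(\<Sum>y\<in>F. (cmod (if y \<in> A then f $$ y else 0))^2) \<le> (1 * norm f)^2"
proof -
  have "(\<Sum>y\<in>F. (cmod (if y \<in> A then f $$ y else 0))^2) \<le> (\<Sum>y\<in>F. (cmod (f $$ y))^2)"
    by (rule sum_mono) simp
  also have "\<dots> \<le> (1 * norm f)^2" using sum_sq_le_norm[of f F] by simp
  finally show ?thesis .
qed

lemma cutoff_apply [simp]: "cutoff A f $$ x = (if x \<in> A then f $$ x else 0)"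
  and clin_cutoff [simp, intro]: "clin (cutoff A)"
  and norm_cutoff: "norm (cutoff A) \<le> 1"
  unfolding cutoff_def by (rule coord_op[OF _ _ cutoff_aux]; simp)+

lemma norm_cutoff_le: "norm (cutoff A f) \<le> norm f"
  using norm_blinfun[of "cutoff A" f] mult_right_mono[OF norm_cutoff[of A] norm_ge_zero[of f]] by simp

lemma cutoff_compose: "cutoff A \<odot> cutoff B = cutoff (A \<inter> B)"
  by (rule blinfun_eqI, rule ell2_eqI) simp

lemma cutoff_cutoff [simp]: "cutoff A (cutoff B f) = cutoff (A \<inter> B) f"
  by (rule ell2_eqI) simp

lemma norm_sq_finite_cutoff:
  "finite A \<Longrightarrow> (norm (cutoff A f))^2 = (\<Sum>x\<in>A. (cmod (f $$ x))^2)"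
  by (subst norm_sq_supported[of A]) auto

lemma norm_cutoff_mono: "A \<subseteq> B \<Longrightarrow> norm (cutoff A f) \<le> norm (cutoff B f)"
  by (metis cutoff_cutoff inf.absorb1 norm_cutoff_le)

lemma cutoff_finite_eq_sum:
  "finite A \<Longrightarrow> cutoff A f = (\<Sum>x\<in>A. ell2_scaleC (f $$ x) (ell2_delta x))"
  by (rule ell2_eqI) (auto simp: if_distrib cong: if_cong)

text \<open>Finitely supported functions are dense; the estimate is kept for all supersets of the finite set
so that several approximations can be made at once.\<close>

lemma cutoff_approx:
  assumes "e > 0"
  obtains F where "finite F" "\<And>G. F \<subseteq> G \<Longrightarrow> norm (f - cutoff G f) < e"
proof -
  let ?S = "\<Sum>\<^sub>\<infinity>x. (cmod (f $$ x))^2"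
  have "((\<lambda>x. (cmod (f $$ x))^2) has_sum ?S) UNIV"
    using ell2_summable by (rule has_sum_infsum)
  then have "\<forall>\<^sub>F F in finite_subsets_at_top UNIV. dist (\<Sum>x\<in>F. (cmod (f $$ x))^2) ?S < (e/2)^2"
    unfolding has_sum_def using assms by (intro tendstoD) auto
  then obtain F where F: "finite F" "dist (\<Sum>x\<in>F. (cmod (f $$ x))^2) ?S < (e/2)^2"
    unfolding eventually_finite_subsets_at_top by blast
  have "norm (f - cutoff G f) < e" if FG: "F \<subseteq> G" for G
  proof -
    have "norm (f - cutoff G f) \<le> e/2"
    proof (rule norm_leI)
      fix H :: "'a set" assume H: "finite H"
      have "(\<Sum>x\<in>H. (cmod ((f - cutoff G f) $$ x))^2) = (\<Sum>x\<in>H - G. (cmod (f $$ x))^2)"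
        by (rule sum.mono_neutral_cong_right) (use H in auto)
      also have "\<dots> \<le> (\<Sum>x\<in>H - F. (cmod (f $$ x))^2)"
        by (rule sum_mono2) (use H FG in auto)
      also have "\<dots> = (\<Sum>x\<in>H \<union> F. (cmod (f $$ x))^2) - (\<Sum>x\<in>F. (cmod (f $$ x))^2)"
        by (metis F(1) H Un_Diff_cancel2 add_diff_cancel_right' Diff_disjoint finite_Diff sum.union_disjoint inf_commute)
      also have "\<dots> \<le> ?S - (\<Sum>x\<in>F. (cmod (f $$ x))^2)"
        using sum_sq_le_norm[of f "H \<union> F"] by (simp add: norm_ell2_sq)
      also have "\<dots> \<le> (e/2)^2" using F(2) by (simp add: dist_real_def)
      finally show "(\<Sum>x\<in>H. (cmod ((f - cutoff G f) $$ x))^2) \<le> (e/2)^2" .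
    qed (use assms in auto)
    then show ?thesis using assms by simp
  qed
  with F(1) show ?thesis using that by blast
qed

lemma mult_divide_plus_one_le:
  fixes M e :: real
  assumes "0 \<le> M" "0 < e"
  shows "M * (e / (M + 1)) \<le> e"
proof -
  have "M * e \<le> e * (M + 1)" using assms by (simp add: distrib_left mult.commute)
  then show ?thesis using assms by (simp add: pos_divide_le_eq)
qed

text \<open>By density of the finitely supported functions, complex-linear operators are determined by their
matrices.\<close>

lemma blinfun_eq_on_delta:
  fixes a b :: "'a ell2 \<Rightarrow>\<^sub>L 'b ell2"
  assumes "clin a" "clin b" and eq: "\<And>x. a (ell2_delta x) = b (ell2_delta x)"
  shows "a = b"
proof (rule blinfun_eqI)
  fix f :: "'a ell2"
  let ?d = "a - b"
  have "norm (?d f) \<le> 0"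
  proof (rule field_le_epsilon)
    fix e :: real assume e: "e > 0"
    obtain F where F: "finite F" "\<And>G. F \<subseteq> G \<Longrightarrow> norm (f - cutoff G f) < e / (norm ?d + 1)"
      using cutoff_approx[of "e / (norm ?d + 1)" f] e
      by (smt (verit) divide_pos_pos norm_ge_zero)
    have "?d (cutoff F f) = 0"
      using F(1) eq assms
      by (simp add: cutoff_finite_eq_sum blinfun.sum_right clinD blinfun.diff_left)
    then have "norm (?d f) = norm (?d (f - cutoff F f))"
      by (simp add: blinfun.diff_right)
    also have "\<dots> \<le> norm ?d * norm (f - cutoff F f)" by (rule norm_blinfun)
    also have "\<dots> \<le> norm ?d * (e / (norm ?d + 1))"
      using F(2)[of F] by (intro mult_left_mono) auto
    also have "\<dots> \<le> e" using e by (intro mult_divide_plus_one_le) auto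
    finally show "norm (?d f) \<le> 0 + e" by simp
  qed
  then show "a f = b f" by (simp add: blinfun.diff_left)
qed

section \<open>Adjoints and rank one operators\<close>

definition adj :: "('a ell2 \<Rightarrow>\<^sub>L 'b ell2) \<Rightarrow> 'b ell2 \<Rightarrow>\<^sub>L 'a ell2" where
  "adj a = coord_op (\<lambda>g x. cinner g (a (ell2_delta x)))"

text \<open>Testing the operator on the finitely supported function \<open>\<Sum> c_x \<delta>_x\<close> with \<open>c_x = <g, a \<delta>_x>\<close> gives
\<open>\<Sum> |c_x|^2 \<le> |g| |a| (\<Sum> |c_x|^2)^(1/2)\<close>, a
bound on the coordinates of the adjoint.\<close>

lemma adj_aux:
  assumes a: "clin a" and F: "finite F"
  shows "(\<Sum>x\<in>F. (cmod (cinner g (a (ell2_delta x))))^2) \<le> (norm a * norm g)^2"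
proof -
  define c where "c x = cinner g (a (ell2_delta x))" for x
  define h where "h = (\<Sum>x\<in>F. ell2_scaleC (c x) (ell2_delta x))"
  define S where "S = (\<Sum>x\<in>F. (cmod (c x))^2)"
  have hx: "h $$ x = (if x \<in> F then c x else 0)" for x
    using F by (auto simp: h_def if_distrib cong: if_cong)
  have h2: "(norm h)^2 = S"
    unfolding S_def by (subst norm_sq_supported[OF F]) (auto simp: hx)
  have S0: "0 \<le> S" unfolding S_def by (intro sum_nonneg) auto
  have "cinner g (a h) = (\<Sum>x\<in>F. cnj (c x) * c x)"
    using a by (simp add: h_def blinfun.sum_right clinD cinner_sum_right cinner_scaleC_right c_def)
  also have "\<dots> = of_real S"
    unfolding S_def of_real_sum by (rule sum.cong) (simp_all only: complex_norm_square mult.commute)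
  finally have "cmod (cinner g (a h)) = S" using S0 by simp
  then have "S \<le> norm g * norm (a h)" by (metis cinner_Cauchy_Schwarz)
  also have "\<dots> \<le> norm g * (norm a * norm h)" by (intro mult_left_mono norm_blinfun) auto
  finally have le: "(norm h)^2 \<le> norm g * norm a * norm h" using h2 by (simp add: mult.assoc)
  have "norm h \<le> norm g * norm a"
  proof (cases "norm h = 0")
    case False
    then show ?thesis using le by (simp add: power2_eq_square)
  qed simp
  then have "(norm h)^2 \<le> (norm g * norm a)^2" by (intro power_mono) auto
  then show ?thesis using h2 by (simp add: S_def c_def mult.commute)
qed

lemma
  assumes "clin a"
  shows adj_apply: "adj a g $$ x = cinner g (a (ell2_delta x))"
    and clin_adj [intro, simp]: "clin (adj a)"
    and norm_adj_le: "norm (adj a) \<le> norm a"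
  unfolding adj_def
  by (rule coord_op[OF _ _ adj_aux[OF assms]]; simp add: cinner_add_left cinner_scaleC_left)+

lemma cinner_adj_right:
  fixes a :: "'a ell2 \<Rightarrow>\<^sub>L 'b ell2"
  assumes a: "clin a"
  shows "cinner f (adj a g) = cinner (a f) g"
proof -
  have "cmod (cinner (a f) g - cinner f (adj a g)) \<le> 0"
  proof (rule field_le_epsilon)
    fix e :: real assume e: "e > 0"
    let ?M = "norm a * norm g + norm (adj a g)"
    obtain F where F: "finite F" "\<And>G. F \<subseteq> G \<Longrightarrow> norm (f - cutoff G f) < e / (?M + 1)"
      using cutoff_approx[of "e / (?M + 1)" f] e
      by (smt (verit) divide_pos_pos norm_ge_zero mult_nonneg_nonneg)
    let ?h = "f - cutoff F f"
    have "cinner (a (cutoff F f)) g = cinner (cutoff F f) (adj a g)"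
      using F(1) a
      by (simp add: cutoff_finite_eq_sum blinfun.sum_right clinD cinner_sum_left cinner_scaleC_left
          adj_apply cnj_cinner)
    then have "cmod (cinner (a f) g - cinner f (adj a g)) = cmod (cinner (a ?h) g - cinner ?h (adj a g))"
      by (simp add: blinfun.diff_right cinner_diff_left)
    also have "\<dots> \<le> cmod (cinner (a ?h) g) + cmod (cinner ?h (adj a g))" by (rule norm_triangle_ineq4)
    also have "\<dots> \<le> (norm a * norm ?h) * norm g + norm ?h * norm (adj a g)"
      by (intro add_mono order_trans[OF cinner_Cauchy_Schwarz] mult_right_mono norm_blinfun) auto
    also have "\<dots> = ?M * norm ?h" by (simp add: algebra_simps)
    also have "\<dots> \<le> ?M * (e / (?M + 1))"
      using F(2)[of F] by (intro mult_left_mono) auto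
    also have "\<dots> \<le> e" using e by (intro mult_divide_plus_one_le) auto
    finally show "cmod (cinner (a f) g - cinner f (adj a g)) \<le> 0 + e" by simp
  qed
  then show ?thesis by simp
qed

lemma cinner_adj_left: "clin a \<Longrightarrow> cinner (adj a g) f = cinner g (a f)"
  by (metis cinner_adj_right cnj_cinner)

lemma adj_unique:
  fixes a :: "'a ell2 \<Rightarrow>\<^sub>L 'b ell2" and b :: "'b ell2 \<Rightarrow>\<^sub>L 'a ell2"
  assumes "clin a" "\<And>f g. cinner (a f) g = cinner f (b g)"
  shows "adj a = b"
proof (rule blinfun_eqI, rule ell2_eqI)
  fix g x show "adj a g $$ x = b g $$ x"
    using assms(2)[of "ell2_delta x" g] assms(1) cnj_cinner[of "a (ell2_delta x)" g]
    by (metis adj_apply cinner_delta_left complex_cnj_cnj)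
qed

lemma op_adjoint_eq_adj: "clin a \<Longrightarrow> op_adjoint a = adj a"
  unfolding op_adjoint_def
proof (rule the_equality)
  assume a: "clin a"
  then show "\<forall>f g. cinner (a f) g = cinner f (adj a g)" by (simp add: cinner_adj_right)
  fix b assume "\<forall>f g. cinner (a f) g = cinner f (blinfun_apply b g)"
  then show "b = adj a" using adj_unique[OF a, of b] by blast
qed

lemma adj_adj [simp]: "clin a \<Longrightarrow> adj (adj a) = a"
  by (rule adj_unique) (auto simp: cinner_adj_left)

lemma norm_adj [simp]: "clin a \<Longrightarrow> norm (adj a) = norm a"
  by (metis adj_adj clin_adj norm_adj_le order_antisym)

lemma adj_compose: "clin a \<Longrightarrow> clin b \<Longrightarrow> adj (a \<odot> b) = adj b \<odot> adj a"
  by (rule adj_unique) (auto simp: cinner_adj_right)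

lemma adj_add: "clin a \<Longrightarrow> clin b \<Longrightarrow> adj (a + b) = adj a + adj b"
  by (rule adj_unique) (auto simp: cinner_adj_right blinfun.add_left cinner_add_left cinner_add_right)

lemma adj_diff: "clin a \<Longrightarrow> clin b \<Longrightarrow> adj (a - b) = adj a - adj b"
  by (rule adj_unique) (auto simp: cinner_adj_right blinfun.diff_left cinner_diff_left cinner_diff_right)

lemma adj_scaleR: "clin a \<Longrightarrow> adj (r *\<^sub>R a) = r *\<^sub>R adj a"
  by (rule adj_unique) (auto simp: cinner_adj_right blinfun.scaleR_left cinner_scaleR_left cinner_scaleR_right)

lemma adj_cutoff [simp]: "adj (cutoff A) = cutoff A"
proof (rule adj_unique)
  fix f g :: "'a ell2"
  show "cinner (cutoff A f) g = cinner f (cutoff A g)"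
    unfolding cinner.rep_eq by (rule infsum_cong) simp
qed simp

definition rank1 :: "'b ell2 \<Rightarrow> 'a ell2 \<Rightarrow> 'a ell2 \<Rightarrow>\<^sub>L 'b ell2" where
  "rank1 v w = coord_op (\<lambda>f y. cinner f w * v $$ y)"

lemma rank1_aux:
  "(\<Sum>y\<in>F. (cmod (cinner f w * v $$ y))^2) \<le> (norm v * norm w * norm f)^2"
proof -
  have "(\<Sum>y\<in>F. (cmod (cinner f w * v $$ y))^2)
      = (cmod (cinner f w))^2 * (\<Sum>y\<in>F. (cmod (v $$ y))^2)"
    by (simp add: norm_mult power_mult_distrib sum_distrib_left)
  also have "\<dots> \<le> (norm f * norm w)^2 * (norm v)^2"
    by (intro mult_mono power_mono cinner_Cauchy_Schwarz sum_sq_le_norm) (auto intro: sum_nonneg)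
  finally show ?thesis by (simp add: power_mult_distrib mult_ac)
qed

lemma rank1_coord: "rank1 v w f $$ y = cinner f w * v $$ y"
  and clin_rank1 [simp, intro]: "clin (rank1 v w)"
  and norm_rank1: "norm (rank1 v w) \<le> norm v * norm w"
  unfolding rank1_def
  by (rule coord_op[OF _ _ rank1_aux]; simp add: cinner_add_left cinner_scaleC_left distrib_right)+

lemma rank1_apply [simp]: "rank1 v w f = ell2_scaleC (cinner f w) v"
  by (rule ell2_eqI) (simp add: rank1_coord)

lemma adj_rank1 [simp]: "adj (rank1 v w) = rank1 w v"
  by (rule adj_unique) (auto simp: cinner_scaleC_left cinner_scaleC_right cnj_cinner)

lemma compose_rank1: "clin a \<Longrightarrow> a \<odot> rank1 v w = rank1 (a v) w"
  by (rule blinfun_eqI) (simp add: clinD)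

lemma rank1_compose: "clin a \<Longrightarrow> rank1 v w \<odot> a = rank1 v (adj a w)"
  by (rule blinfun_eqI) (simp add: cinner_adj_right)

section \<open>The uniform Roe algebra\<close>

lemma matrix_coeff_eq [simp]: "matrix_coeff a x y = a (ell2_delta x) $$ y"
  by (simp add: matrix_coeff_def)

text \<open>The algebraic form of the support conditions is the one that is stable under limits and products.\<close>

lemma bounded_ops_iff:
  "a \<in> bounded_ops X \<longleftrightarrow> clin a \<and> cutoff X \<odot> a = a \<and> a \<odot> cutoff X = a"
proof
  assume a: "a \<in> bounded_ops X"
  have "cutoff X \<odot> a = a"
    by (rule blinfun_eqI, rule ell2_eqI) (use a in \<open>auto simp: bounded_ops_def\<close>)
  moreover have "a \<odot> cutoff X = a"
  proof (rule blinfun_eqI)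
    fix f
    have "a (f - cutoff X f) = 0" using a by (simp add: bounded_ops_def)
    then show "(a \<odot> cutoff X) f = a f" by (simp add: blinfun.diff_right)
  qed
  ultimately show "clin a \<and> cutoff X \<odot> a = a \<and> a \<odot> cutoff X = a"
    using a by (simp add: bounded_ops_def clin_def)
next
  assume a: "clin a \<and> cutoff X \<odot> a = a \<and> a \<odot> cutoff X = a"
  have 1: "a f $$ x = 0" if "x \<notin> X" for f x
  proof -
    have "a f = cutoff X (a f)" using a by (metis blinfun_apply_blinfun_compose)
    then have "a f $$ x = cutoff X (a f) $$ x" by simp
    then show ?thesis using that by simp
  qed
  have 2: "a f = 0" if "\<forall>x\<in>X. f $$ x = 0" for f
  proof -
    have "cutoff X f = 0" by (rule ell2_eqI) (use that in simp)
    then show ?thesis using a by (metis blinfun_apply_blinfun_compose blinfun.zero_right)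
  qed
  show "a \<in> bounded_ops X" using a 1 2 by (auto simp: bounded_ops_def clin_def)
qed

lemma closed_bounded_ops: "closed (bounded_ops X)"
proof -
  have "continuous_on UNIV (\<lambda>a :: 'a op. ell2_scaleC c (a f))" for c f
    by (rule continuous_on_compose2[OF linear_continuous_on[OF bounded_linear_ell2_scaleC]])
       (auto intro!: continuous_intros)
  then have "closed {a :: 'a op. a (ell2_scaleC c f) = ell2_scaleC c (a f)}" for c f
    by (intro closed_Collect_eq continuous_intros)
  then have 1: "closed {a :: 'a op. clin a}"
    unfolding clin_def by (intro closed_Collect_all)
  have "closed {a :: 'a op. cutoff X \<odot> a = a}" "closed {a :: 'a op. a \<odot> cutoff X = a}"
    by (intro closed_Collect_eq continuous_intros
        bounded_bilinear.continuous_on[OF bounded_bilinear_blinfun_compose])+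
  moreover have "bounded_ops X = {a. clin a} \<inter> ({a. cutoff X \<odot> a = a} \<inter> {a. a \<odot> cutoff X = a})"
    by (auto simp: bounded_ops_iff)
  ultimately show ?thesis using 1 by (auto intro!: closed_Int)
qed


lemma norm_compose_contr_left: "norm a \<le> 1 \<Longrightarrow> norm (a \<odot> b) \<le> norm b"
  using norm_blinfun_compose[of a b] mult_right_mono[of "norm a" 1 "norm b"] by simp

lemma norm_compose_contr_right: "norm b \<le> 1 \<Longrightarrow> norm (a \<odot> b) \<le> norm a"
  using norm_blinfun_compose[of a b] mult_left_mono[of "norm b" 1 "norm a"] by simp

lemma compose_assoc: "(a \<odot> b) \<odot> c = a \<odot> (b \<odot> c)"
  by (rule blinfun_eqI) simp

lemma compose_diff_left: "(a - b) \<odot> c = a \<odot> c - b \<odot> c"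
  and compose_diff_right: "c \<odot> (x - y) = c \<odot> x - c \<odot> y"
  and compose_add_left: "(a + b) \<odot> c = a \<odot> c + b \<odot> c"
  and compose_add_right: "c \<odot> (x + y) = c \<odot> x + c \<odot> y"
  by (rule blinfun_eqI; simp add: blinfun.diff_left blinfun.diff_right blinfun.add_left blinfun.add_right)+

lemma compose_zero [simp]: "0 \<odot> c = 0" "c \<odot> 0 = 0"
  by (rule blinfun_eqI; simp)+

lemma clin_op_scaleC [simp, intro]: "clin a \<Longrightarrow> clin (op_scaleC c a)"
  by (simp add: clin_def op_scaleC_apply mult.commute)

lemma norm_op_scaleC: "norm (op_scaleC c a) \<le> cmod c * norm a"
  by (rule norm_blinfun_bound)
     (auto simp: op_scaleC_apply norm_ell2_scaleC mult.assoc intro!: mult_left_mono norm_blinfun)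

lemma op_scaleC_diff: "op_scaleC c (a - b) = op_scaleC c a - op_scaleC c b"
  by (rule blinfun_eqI) (simp add: op_scaleC_apply blinfun.diff_left scaleC_diff)

lemma op_scaleC_compose_left: "op_scaleC c a \<odot> b = op_scaleC c (a \<odot> b)"
  by (rule blinfun_eqI) (simp add: op_scaleC_apply)

lemma op_scaleC_compose_right: "clin a \<Longrightarrow> a \<odot> op_scaleC c b = op_scaleC c (a \<odot> b)"
  by (rule blinfun_eqI) (simp add: op_scaleC_apply clinD)

lemma op_scaleC_of_real: "op_scaleC (of_real r) a = r *\<^sub>R a"
  by (rule blinfun_eqI) (simp add: op_scaleC_apply scaleC_of_real blinfun.scaleR_left)

text \<open>Propagation with an explicit bound; membership in \<open>bounded_ops\<close> is part of the predicate, so that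
these are exactly the approximants of elements of the uniform Roe algebra.\<close>

definition prop_le :: "'a set \<Rightarrow> ('a \<Rightarrow> 'a \<Rightarrow> real) \<Rightarrow> real \<Rightarrow> 'a op \<Rightarrow> bool" where
  "prop_le X d r a \<longleftrightarrow> a \<in> bounded_ops X \<and>
     (\<forall>x\<in>X. \<forall>y\<in>X. d x y > r \<longrightarrow> a (ell2_delta x) $$ y = 0)"

lemma prop_le_mono: "prop_le X d r a \<Longrightarrow> r \<le> s \<Longrightarrow> prop_le X d s a"
  unfolding prop_le_def by (meson order_le_less_trans)

lemma uniform_Roe_iff:
  "a \<in> uniform_Roe X d \<longleftrightarrow> (\<forall>e>0. \<exists>r b. prop_le X d r b \<and> norm (a - b) \<le> e)"
proof -
  have *: "(\<exists>r. prop_le X d r b) \<longleftrightarrow> b \<in> {b \<in> bounded_ops X. finite_propagation X d b}" for b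
  proof
    assume "\<exists>r. prop_le X d r b"
    then obtain r where "prop_le X d r b" by blast
    then have "prop_le X d (max r 1) b" by (rule prop_le_mono) simp
    then show "b \<in> {b \<in> bounded_ops X. finite_propagation X d b}"
      unfolding prop_le_def finite_propagation_def by (auto intro!: exI[of _ "max r 1"])
  qed (auto simp: prop_le_def finite_propagation_def)
  show ?thesis
  proof
    assume "a \<in> uniform_Roe X d"
    then have "\<forall>e>0. \<exists>b\<in>{b \<in> bounded_ops X. finite_propagation X d b}. dist b a < e"
      by (simp add: uniform_Roe_def closure_approachable)
    then show "\<forall>e>0. \<exists>r b. prop_le X d r b \<and> norm (a - b) \<le> e"
      unfolding Bex_def by (metis * dist_norm norm_minus_commute less_imp_le)
  next
    assume R: "\<forall>e>0. \<exists>r b. prop_le X d r b \<and> norm (a - b) \<le> e"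
    have "\<exists>b\<in>{b \<in> bounded_ops X. finite_propagation X d b}. dist b a < e" if "e > 0" for e
    proof -
      obtain r b where "prop_le X d r b" "norm (a - b) \<le> e/2"
        using R \<open>e > 0\<close> half_gt_zero by blast
      then show ?thesis using * \<open>e > 0\<close>
        by (intro bexI[of _ b]) (auto simp: dist_norm norm_minus_commute)
    qed
    then show "a \<in> uniform_Roe X d"
      by (simp add: uniform_Roe_def closure_approachable)
  qed
qed

lemma prop_le_uniform_Roe: "prop_le X d r a \<Longrightarrow> a \<in> uniform_Roe X d"
  unfolding uniform_Roe_iff by (intro allI impI exI[of _ r] exI[of _ a]) auto

lemma uniform_Roe_bounded_ops: "a \<in> uniform_Roe X d \<Longrightarrow> a \<in> bounded_ops X"
proof -
  assume a: "a \<in> uniform_Roe X d"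
  have "closure {a \<in> bounded_ops X. finite_propagation X d a} \<subseteq> bounded_ops X"
    by (rule closure_minimal[OF _ closed_bounded_ops]) auto
  then show ?thesis using a unfolding uniform_Roe_def by (rule subsetD)
qed

lemma uniform_RoeD:
  assumes "a \<in> uniform_Roe X d"
  shows "clin a" "cutoff X \<odot> a = a" "a \<odot> cutoff X = a"
  using uniform_Roe_bounded_ops[OF assms] by (auto simp: bounded_ops_iff)

lemma bounded_ops_add: "a \<in> bounded_ops X \<Longrightarrow> b \<in> bounded_ops X \<Longrightarrow> a + b \<in> bounded_ops X"
  by (simp add: bounded_ops_iff compose_add_left compose_add_right)

lemma bounded_ops_scaleC: "a \<in> bounded_ops X \<Longrightarrow> op_scaleC c a \<in> bounded_ops X"
  by (simp add: bounded_ops_iff op_scaleC_compose_left op_scaleC_compose_right)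

lemma bounded_ops_compose: "a \<in> bounded_ops X \<Longrightarrow> b \<in> bounded_ops X \<Longrightarrow> a \<odot> b \<in> bounded_ops X"
  by (simp add: bounded_ops_iff) (metis compose_assoc)

lemma bounded_ops_adj: "a \<in> bounded_ops X \<Longrightarrow> adj a \<in> bounded_ops X"
  by (metis adj_compose adj_cutoff bounded_ops_iff clin_adj clin_cutoff)

lemma prop_le_add:
  "prop_le X d r a \<Longrightarrow> prop_le X d s b \<Longrightarrow> prop_le X d (max r s) (a + b)"
  by (auto simp: prop_le_def bounded_ops_add blinfun.add_left)

lemma prop_le_scaleC: "prop_le X d r a \<Longrightarrow> prop_le X d r (op_scaleC c a)"
  by (auto simp: prop_le_def bounded_ops_scaleC op_scaleC_apply)

lemma bounded_ops_apply_outside: "a \<in> bounded_ops X \<Longrightarrow> x \<notin> X \<Longrightarrow> a f $$ x = 0"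
  by (simp add: bounded_ops_def)

lemma compose_coord:
  "clin a \<Longrightarrow> a (b f) $$ y = (\<Sum>\<^sub>\<infinity>z. b f $$ z * a (ell2_delta z) $$ y)"
proof -
  assume a: "clin a"
  have "a (b f) $$ y = cinner (b f) (adj a (ell2_delta y))"
    using a by (simp add: cinner_adj_right)
  also have "\<dots> = (\<Sum>\<^sub>\<infinity>z. b f $$ z * a (ell2_delta z) $$ y)"
    unfolding cinner.rep_eq[of "b f"] using a by (simp add: adj_apply)
  finally show ?thesis .
qed

text \<open>The matrix entry of a product is a sum over intermediate points, each term violating one of the two bounds.\<close>

lemma prop_le_compose:
  assumes X: "Metric_space X d" and a: "prop_le X d r a" and b: "prop_le X d s b"
  shows "prop_le X d (r + s) (a \<odot> b)"
proof -
  have "a (b (ell2_delta x)) $$ y = 0" if xy: "x \<in> X" "y \<in> X" "d x y > r + s" for x y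
  proof -
    have z0: "b (ell2_delta x) $$ z * a (ell2_delta z) $$ y = 0" for z
    proof (cases "z \<in> X")
      case True
      then have "d x y \<le> d x z + d z y" using X xy by (simp add: Metric_space.triangle)
      then have "d x z > s \<or> d z y > r" using xy by linarith
      then show ?thesis using a b True xy by (auto simp: prop_le_def)
    next
      case False
      then have "b (ell2_delta x) $$ z = 0"
        using b bounded_ops_apply_outside by (metis prop_le_def)
      then show ?thesis by simp
    qed
    have ca: "clin a" using a unfolding prop_le_def bounded_ops_iff by blast
    show ?thesis
      by (subst compose_coord[OF ca]) (rule infsum_0, rule z0)
  qed
  then show ?thesis using a b by (auto simp: prop_le_def bounded_ops_compose)
qed

lemma prop_le_adj:
  assumes X: "Metric_space X d" and a: "prop_le X d r a"
  shows "prop_le X d r (adj a)"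
proof -
  have "clin a" using a unfolding prop_le_def bounded_ops_iff by blast
  then show ?thesis
    using a Metric_space.commute[OF X] by (auto simp: prop_le_def bounded_ops_adj adj_apply)
qed

lemma uniform_Roe_add:
  assumes "a \<in> uniform_Roe X d" "b \<in> uniform_Roe X d"
  shows "a + b \<in> uniform_Roe X d"
  unfolding uniform_Roe_iff
proof (intro allI impI)
  fix e :: real assume "e > 0"
  then obtain r s a' b' where "prop_le X d r a'" "norm (a - a') \<le> e/2" "prop_le X d s b'" "norm (b - b') \<le> e/2"
    using assms unfolding uniform_Roe_iff by (meson half_gt_zero)
  then show "\<exists>r c. prop_le X d r c \<and> norm (a + b - c) \<le> e"
    using norm_triangle_ineq[of "a - a'" "b - b'"]
    by (intro exI[of _ "max r s"] exI[of _ "a' + b'"]) (auto simp: prop_le_add algebra_simps)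
qed

lemma uniform_Roe_scaleC:
  assumes "a \<in> uniform_Roe X d"
  shows "op_scaleC c a \<in> uniform_Roe X d"
  unfolding uniform_Roe_iff
proof (intro allI impI)
  fix e :: real assume e: "e > 0"
  then have "e / (cmod c + 1) > 0" by (intro divide_pos_pos) (auto intro: add_nonneg_pos)
  then obtain r b where b: "prop_le X d r b" "norm (a - b) \<le> e / (cmod c + 1)"
    using assms unfolding uniform_Roe_iff by blast
  have "norm (op_scaleC c a - op_scaleC c b) \<le> cmod c * norm (a - b)"
    by (metis norm_op_scaleC op_scaleC_diff)
  also have "\<dots> \<le> cmod c * (e / (cmod c + 1))" using b(2) by (intro mult_left_mono) auto
  also have "\<dots> \<le> e" using e by (intro mult_divide_plus_one_le) auto
  finally show "\<exists>r b. prop_le X d r b \<and> norm (op_scaleC c a - b) \<le> e"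
    using b(1) prop_le_scaleC by blast
qed

lemma uniform_Roe_scaleR: "a \<in> uniform_Roe X d \<Longrightarrow> r *\<^sub>R a \<in> uniform_Roe X d"
  by (metis op_scaleC_of_real uniform_Roe_scaleC)

lemma uniform_Roe_diff: "a \<in> uniform_Roe X d \<Longrightarrow> b \<in> uniform_Roe X d \<Longrightarrow> a - b \<in> uniform_Roe X d"
  using uniform_Roe_add[of a X d "(-1) *\<^sub>R b"] uniform_Roe_scaleR[of b X d "-1"] by simp

lemma uniform_Roe_0: "0 \<in> uniform_Roe X d"
  by (rule prop_le_uniform_Roe[of _ _ 0]) (simp add: prop_le_def bounded_ops_iff)

lemma uniform_Roe_sum: "(\<And>i. i \<in> I \<Longrightarrow> a i \<in> uniform_Roe X d) \<Longrightarrow> (\<Sum>i\<in>I. a i) \<in> uniform_Roe X d"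
  by (induction I rule: infinite_finite_induct) (auto simp: uniform_Roe_0 uniform_Roe_add)

lemma uniform_Roe_adj:
  assumes X: "Metric_space X d" and a: "a \<in> uniform_Roe X d"
  shows "adj a \<in> uniform_Roe X d"
  unfolding uniform_Roe_iff
proof (intro allI impI)
  fix e :: real assume "e > 0"
  then obtain r b where b: "prop_le X d r b" "norm (a - b) \<le> e"
    using a unfolding uniform_Roe_iff by blast
  have "clin a" "clin b" using uniform_RoeD(1)[OF a] b unfolding prop_le_def bounded_ops_iff by blast+
  then have "norm (adj a - adj b) = norm (a - b)"
    by (metis adj_diff clin_intros(4) norm_adj)
  then show "\<exists>r c. prop_le X d r c \<and> norm (adj a - c) \<le> e"
    using b prop_le_adj[OF X] by metis
qed

lemma uniform_Roe_compose:
  assumes X: "Metric_space X d" and a: "a \<in> uniform_Roe X d" and b: "b \<in> uniform_Roe X d"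
  shows "a \<odot> b \<in> uniform_Roe X d"
  unfolding uniform_Roe_iff
proof (intro allI impI)
  fix e :: real assume e: "e > 0"
  obtain r a' where a': "prop_le X d r a'" "norm (a - a') \<le> (e/2) / (norm b + 1)"
    using a e unfolding uniform_Roe_iff
    by (metis add_nonneg_pos divide_pos_pos half_gt_zero norm_ge_zero zero_less_one)
  obtain s b' where b': "prop_le X d s b'" "norm (b - b') \<le> (e/2) / (norm a' + 1)"
    using b e unfolding uniform_Roe_iff
    by (metis add_nonneg_pos divide_pos_pos half_gt_zero norm_ge_zero zero_less_one)
  have "a \<odot> b - a' \<odot> b' = (a - a') \<odot> b + a' \<odot> (b - b')"
    by (simp add: compose_diff_left compose_diff_right)
  then have "norm (a \<odot> b - a' \<odot> b') \<le> norm (a - a') * norm b + norm a' * norm (b - b')"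
    by (metis norm_triangle_mono norm_blinfun_compose)
  also have "norm (a - a') * norm b \<le> (e/2) / (norm b + 1) * norm b"
    using a'(2) by (intro mult_right_mono) auto
  also have "\<dots> \<le> e/2" using mult_divide_plus_one_le[of "norm b" "e/2"] e by (simp add: mult.commute)
  also have "norm a' * norm (b - b') \<le> norm a' * ((e/2) / (norm a' + 1))"
    using b'(2) by (intro mult_left_mono) auto
  also have "\<dots> \<le> e/2" using e by (intro mult_divide_plus_one_le) auto
  finally have "norm (a \<odot> b - a' \<odot> b') \<le> e" by simp
  then show "\<exists>r c. prop_le X d r c \<and> norm (a \<odot> b - c) \<le> e"
    using prop_le_compose[OF X a'(1) b'(1)] by blast
qed

lemma prop_le_cutoff:
  assumes "Metric_space X d" "A \<subseteq> X"
  shows "prop_le X d 0 (cutoff A)"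
  using assms Metric_space.zero
  by (fastforce simp: prop_le_def bounded_ops_iff cutoff_compose Int_absorb1 Int_absorb2)

lemma uniform_Roe_cutoff: "Metric_space X d \<Longrightarrow> A \<subseteq> X \<Longrightarrow> cutoff A \<in> uniform_Roe X d"
  by (rule prop_le_uniform_Roe[OF prop_le_cutoff])

lemma prop_le_rank1_finite:
  assumes X: "Metric_space X d" and F: "finite F" "F \<subseteq> X"
    and v: "cutoff F v = v" and w: "cutoff F w = w"
  shows "\<exists>r. prop_le X d r (rank1 v w)"
proof -
  define r where "r = Max (insert 0 ((\<lambda>(x,y). d x y) ` (F \<times> F)))"
  have r: "d x y \<le> r" if "x \<in> F" "y \<in> F" for x y
    unfolding r_def by (rule Max_ge) (use F that in auto)
  have XF: "cutoff X v = v" "cutoff X w = w"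
    by (metis v F(2) cutoff_cutoff inf.absorb2, metis w F(2) cutoff_cutoff inf.absorb2)
  have v0: "v $$ y = 0" if "y \<notin> F" for y
    using arg_cong[OF v, of "\<lambda>f. f $$ y"] that by simp
  have w0: "w $$ y = 0" if "y \<notin> F" for y
    using arg_cong[OF w, of "\<lambda>f. f $$ y"] that by simp
  have "rank1 v w \<in> bounded_ops X"
    by (simp add: bounded_ops_iff compose_rank1 rank1_compose XF)
  moreover have "rank1 v w (ell2_delta x) $$ y = 0" if "d x y > r" for x y
    using r[of x y] that v0[of y] w0[of x] by fastforce
  ultimately have "prop_le X d r (rank1 v w)" by (auto simp: prop_le_def)
  then show ?thesis by blast
qed

text \<open>Finite subsets of a metric space are bounded, so truncating both vectors to finite sets gives an
operator of finite propagation.\<close>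

lemma uniform_Roe_rank1:
  assumes X: "Metric_space X d" and v: "cutoff X v = v" and w: "cutoff X w = w"
  shows "rank1 v w \<in> uniform_Roe X d"
  unfolding uniform_Roe_iff
proof (intro allI impI)
  fix e :: real assume e: "e > 0"
  obtain F where F: "finite F" "\<And>G. F \<subseteq> G \<Longrightarrow> norm (v - cutoff G v) < (e/2) / (norm w + 1)"
    using cutoff_approx[of "(e/2) / (norm w + 1)" v] e
    by (metis add_nonneg_pos divide_pos_pos half_gt_zero norm_ge_zero zero_less_one)
  obtain G where G: "finite G" "\<And>H. G \<subseteq> H \<Longrightarrow> norm (w - cutoff H w) < (e/2) / (norm v + 1)"
    using cutoff_approx[of "(e/2) / (norm v + 1)" w] e
    by (metis add_nonneg_pos divide_pos_pos half_gt_zero norm_ge_zero zero_less_one)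
  define H where "H = (F \<union> G) \<inter> X"
  let ?v = "cutoff H v" and ?w = "cutoff H w"
  have vw: "?v = cutoff (F \<union> G) v" "?w = cutoff (F \<union> G) w"
    unfolding H_def by (metis v cutoff_cutoff, metis w cutoff_cutoff)
  obtain r where r: "prop_le X d r (rank1 ?v ?w)"
    using prop_le_rank1_finite[OF X, of H ?v ?w] F(1) G(1) by (auto simp: H_def)
  have "rank1 v w - rank1 ?v ?w = rank1 (v - ?v) w + rank1 ?v (w - ?w)"
    by (rule blinfun_eqI, rule ell2_eqI)
       (simp add: blinfun.diff_left blinfun.add_left cinner_diff_right algebra_simps)
  then have "norm (rank1 v w - rank1 ?v ?w) \<le> norm (v - ?v) * norm w + norm ?v * norm (w - ?w)"
    by (metis norm_triangle_mono norm_rank1)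
  also have "\<dots> \<le> norm w * ((e/2) / (norm w + 1)) + norm v * ((e/2) / (norm v + 1))"
    using F(2)[of "F \<union> G"] G(2)[of "F \<union> G"]
    by (subst mult.commute[of "norm (v - ?v)"], intro add_mono mult_mono norm_cutoff_le) (auto simp: vw)
  also have "\<dots> \<le> e/2 + e/2" using e by (intro add_mono mult_divide_plus_one_le) auto
  finally show "\<exists>r b. prop_le X d r b \<and> norm (rank1 v w - b) \<le> e" using r by auto
qed

section \<open>Isomorphisms onto hereditary subalgebras are spatial\<close>

lemma orthonormal_isometry:
  fixes \<xi> :: "'i \<Rightarrow> 'b ell2"
  assumes orth: "\<And>i j. i \<in> I \<Longrightarrow> j \<in> I \<Longrightarrow> cinner (\<xi> i) (\<xi> j) = (if i = j then 1 else 0)"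
    and zero: "\<And>i. i \<notin> I \<Longrightarrow> \<xi> i = 0"
  obtains u :: "'i ell2 \<Rightarrow>\<^sub>L 'b ell2" where "clin u" "\<And>i. u (ell2_delta i) = \<xi> i"
    "adj u \<odot> u = cutoff I" "norm u \<le> 1"
proof -
  have bound: "(\<Sum>i\<in>F. (cmod (cinner g (\<xi> i)))^2) \<le> (1 * norm g)^2" if F: "finite F" for g F
  proof -
    define c where "c i = cinner g (\<xi> i)" for i
    define K where "K = F \<inter> I"
    define h where "h = (\<Sum>i\<in>K. ell2_scaleC (c i) (\<xi> i))"
    define S where "S = (\<Sum>i\<in>F. (cmod (c i))^2)"
    have S0: "0 \<le> S" unfolding S_def by (intro sum_nonneg) auto
    have "S = (\<Sum>i\<in>K. (cmod (c i))^2)"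
      unfolding S_def K_def using F zero by (intro sum.mono_neutral_right) (auto simp: c_def)
    then have SK: "of_real S = (\<Sum>i\<in>K. c i * cnj (c i))"
      by (simp only: of_real_sum complex_norm_square)
    have "cinner h h = (\<Sum>i\<in>K. \<Sum>j\<in>K. cnj (c i) * (c j * cinner (\<xi> j) (\<xi> i)))"
      unfolding h_def
      by (simp add: cinner_sum_left cinner_sum_right cinner_scaleC_left cinner_scaleC_right sum_distrib_left)
    also have "\<dots> = (\<Sum>i\<in>K. \<Sum>j\<in>K. if i = j then c i * cnj (c i) else 0)"
      by (intro sum.cong refl) (auto simp: orth K_def)
    also have "\<dots> = of_real S" unfolding SK using F by (simp add: K_def)
    finally have hS: "(norm h)^2 = S" unfolding cinner_self of_real_eq_iff .
    have "cinner g h = (\<Sum>i\<in>K. cnj (c i) * c i)"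
      by (simp add: h_def cinner_sum_right cinner_scaleC_right c_def)
    also have "\<dots> = of_real S" unfolding SK by (simp add: mult.commute)
    finally have "S \<le> norm g * norm h" using S0 cinner_Cauchy_Schwarz[of g h] by simp
    then have le: "norm h * norm h \<le> norm g * norm h" using hS by (simp add: power2_eq_square)
    have "norm h \<le> norm g"
    proof (cases "norm h = 0")
      case False
      then show ?thesis using le by simp
    qed simp
    then have "(norm h)^2 \<le> (1 * norm g)^2" by (simp add: power_mono)
    then show ?thesis using hS by (simp add: S_def c_def)
  qed
  define v where "v = coord_op (\<lambda>g i. cinner g (\<xi> i))"
  have v: "v g $$ i = cinner g (\<xi> i)" "clin v" "norm v \<le> 1" for g i
    unfolding v_def by (rule coord_op[OF _ _ bound]; simp add: cinner_add_left cinner_scaleC_left)+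
  have ud: "adj v (ell2_delta i) = \<xi> i" for i
    by (rule ell2_eqI) (simp add: adj_apply[OF v(2)] v(1))
  have "adj (adj v) \<odot> adj v = cutoff I"
  proof (rule blinfun_eq_on_delta)
    fix j show "(adj (adj v) \<odot> adj v) (ell2_delta j) = cutoff I (ell2_delta j)"
      using zero by (intro ell2_eqI, cases "j \<in> I") (auto simp: v ud orth)
  qed (use v in auto)
  then show thesis using that[of "adj v"] v ud by simp
qed

lemma op_le_0_rank1: "op_le 0 (rank1 v v)"
proof -
  have "cinner (rank1 v v f) f = of_real ((cmod (cinner f v))^2)" for f
    by (simp only: rank1_apply cinner_scaleC_left complex_norm_square cnj_cinner)
  then show ?thesis by (simp add: op_le_def)
qed

lemma cinner_projection:
  assumes "clin q" "adj q = q" "q \<odot> q = q"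
  shows "cinner (q f) f = of_real ((norm (q f))^2)"
proof -
  have "cinner (q f) f = cinner (q (q f)) f" using assms(3) by (metis blinfun_apply_blinfun_compose)
  also have "\<dots> = cinner (q f) (q f)" using assms(1,2) cinner_adj_right[of q "q f" f] by simp
  finally show ?thesis by (simp add: cinner_self)
qed

text \<open>This is how rank one operators enter a hereditary subalgebra: they lie below a multiple of any
projection that fixes their vector.\<close>

lemma op_le_rank1_projection:
  assumes q: "clin q" "adj q = q" "q \<odot> q = q" and v: "q v = v"
  shows "op_le (rank1 v v) ((norm v)^2 *\<^sub>R q)"
  unfolding op_le_def
proof
  fix f
  have "cinner f v = cinner (q f) v" using cinner_adj_right[OF q(1), of f v] q v by simp
  then have "cmod (cinner f v) \<le> norm (q f) * norm v" by (simp add: cinner_Cauchy_Schwarz)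
  then have le: "(cmod (cinner f v))^2 \<le> (norm (q f) * norm v)^2" by (intro power_mono) auto
  have "cinner (rank1 v v f) f = of_real ((cmod (cinner f v))^2)"
    by (simp only: rank1_apply cinner_scaleC_left complex_norm_square cnj_cinner)
  then have "cinner (((norm v)^2 *\<^sub>R q - rank1 v v) f) f
      = of_real ((norm (q f) * norm v)^2 - (cmod (cinner f v))^2)"
    by (simp add: blinfun.diff_left blinfun.scaleR_left cinner_diff_left cinner_scaleR_left
        cinner_projection[OF q] power_mult_distrib mult.commute)
  then show "cinner (((norm v)^2 *\<^sub>R q - rank1 v v) f) f \<in> \<real>\<^sub>\<ge>\<^sub>0"
    using le by (simp only: nonneg_Reals_of_real_iff)
qed

lemma adj_op_scaleC: "clin a \<Longrightarrow> adj (op_scaleC c a) = op_scaleC (cnj c) (adj a)"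
  by (rule adj_unique) (auto simp: op_scaleC_apply cinner_scaleC_left cinner_scaleC_right cinner_adj_right)

text \<open>For self-adjoint \<open>h\<close> the operator \<open>p (|h| + h) p\<close> lies between \<open>0\<close> and \<open>2 |h| p\<close>, so it belongs to
the hereditary subalgebra; the general case splits \<open>b\<close> into real and imaginary part.\<close>

lemma hereditary_compression:
  assumes her: "hereditary_cstar_subalgebra B (uniform_Roe Y d)" and Y: "Metric_space Y d"
    and p: "p \<in> B" "adj p = p" "p \<odot> p = p" and b: "b \<in> uniform_Roe Y d"
  shows "p \<odot> b \<odot> p \<in> B"
proof -
  have sub: "B \<subseteq> uniform_Roe Y d"
    and Badd: "\<And>a b. a \<in> B \<Longrightarrow> b \<in> B \<Longrightarrow> a + b \<in> B" and Bsc: "\<And>c a. a \<in> B \<Longrightarrow> op_scaleC c a \<in> B"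
    and Bher: "\<And>a b. a \<in> uniform_Roe Y d \<Longrightarrow> b \<in> B \<Longrightarrow> op_le 0 a \<Longrightarrow> op_le a b \<Longrightarrow> a \<in> B"
    using her by (auto simp: hereditary_cstar_subalgebra_def cstar_subalgebra_def)
  have pR: "p \<in> uniform_Roe Y d" and pc: "clin p" using p sub uniform_RoeD(1) by auto
  have sa: "p \<odot> h \<odot> p \<in> B" if h: "h \<in> uniform_Roe Y d" "adj h = h" for h
  proof -
    have hc: "clin h" using uniform_RoeD(1)[OF h(1)] .
    let ?c = "norm h"
    define m where "m = ?c *\<^sub>R p + p \<odot> h \<odot> p"
    have mR: "m \<in> uniform_Roe Y d"
      unfolding m_def by (intro uniform_Roe_add uniform_Roe_scaleR uniform_Roe_compose[OF Y] pR h)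
    have quad: "\<exists>t::real. cinner ((p \<odot> h \<odot> p) f) f = of_real t \<and> \<bar>t\<bar> \<le> ?c * (norm (p f))^2" for f
    proof -
      let ?g = "p f"
      define z where "z = cinner (h ?g) ?g"
      have "cnj z = z" unfolding z_def using cinner_adj_right[OF hc, of ?g ?g] h(2) by (simp add: cnj_cinner)
      then have zr: "z = of_real (Re z)" by (metis complex_cnj_cancel_iff complex_eq_iff Im_complex_of_real Re_complex_of_real complex_cnj neg_equal_zero cnj.sel(2))
      have "cmod z \<le> norm (h ?g) * norm ?g" unfolding z_def by (rule cinner_Cauchy_Schwarz)
      also have "\<dots> \<le> ?c * norm ?g * norm ?g" by (intro mult_right_mono norm_blinfun) auto
      finally have "\<bar>Re z\<bar> \<le> ?c * (norm ?g)^2"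
        using abs_Re_le_cmod[of z] by (simp add: power2_eq_square)
      moreover have "cinner ((p \<odot> h \<odot> p) f) f = z"
        unfolding z_def using cinner_adj_right[OF pc, of "h ?g" f] p(2) by simp
      ultimately show ?thesis using zr by metis
    qed
    have "op_le 0 m"
      unfolding op_le_def
    proof
      fix f obtain t :: real where t: "cinner ((p \<odot> h \<odot> p) f) f = of_real t" "\<bar>t\<bar> \<le> ?c * (norm (p f))^2"
        using quad by blast
      have "cinner ((m - 0) f) f = of_real (?c * (norm (p f))^2 + t)"
        unfolding m_def diff_zero blinfun.add_left cinner_add_left t(1)
        by (simp add: blinfun.scaleR_left cinner_scaleR_left cinner_projection[OF pc p(2,3)])
      then show "cinner ((m - 0) f) f \<in> \<real>\<^sub>\<ge>\<^sub>0" using t(2) by (simp only: nonneg_Reals_of_real_iff)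
    qed
    moreover have "op_le m ((2 * ?c) *\<^sub>R p)"
      unfolding op_le_def
    proof
      fix f obtain t :: real where t: "cinner ((p \<odot> h \<odot> p) f) f = of_real t" "\<bar>t\<bar> \<le> ?c * (norm (p f))^2"
        using quad by blast
      have "(2 * ?c) *\<^sub>R p - m = ?c *\<^sub>R p - p \<odot> h \<odot> p" unfolding m_def by (simp add: algebra_simps flip: scaleR_add_left)
      then have "cinner (((2 * ?c) *\<^sub>R p - m) f) f = of_real (?c * (norm (p f))^2 - t)"
        unfolding blinfun.diff_left[of "?c *\<^sub>R p"] cinner_diff_left t(1)
        by (simp add: blinfun.scaleR_left cinner_scaleR_left cinner_projection[OF pc p(2,3)]
            blinfun.diff_left cinner_diff_left t(1)[simplified])
      then show "cinner (((2 * ?c) *\<^sub>R p - m) f) f \<in> \<real>\<^sub>\<ge>\<^sub>0"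
        using t(2) by (simp only: nonneg_Reals_of_real_iff)
    qed
    moreover have "(2 * ?c) *\<^sub>R p \<in> B" using Bsc[OF p(1)] by (metis op_scaleC_of_real)
    ultimately have "m \<in> B" using Bher[OF mR] by blast
    then have "m + op_scaleC (of_real (- ?c)) p \<in> B" using Badd Bsc p(1) by blast
    then show ?thesis by (simp add: m_def op_scaleC_of_real del: of_real_minus)
  qed
  have bc: "clin b" using uniform_RoeD(1)[OF b] .
  define h1 h2 where "h1 = (1/2) *\<^sub>R (b + adj b)" and "h2 = op_scaleC (- \<i>/2) (b - adj b)"
  have bR: "adj b \<in> uniform_Roe Y d" using uniform_Roe_adj[OF Y b] .
  have h1: "h1 \<in> uniform_Roe Y d" "adj h1 = h1"
    unfolding h1_def using b bR bc
    by (auto intro!: uniform_Roe_scaleR uniform_Roe_add simp: adj_scaleR adj_add add.commute)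
  have h2: "h2 \<in> uniform_Roe Y d" "adj h2 = h2"
  proof -
    show "h2 \<in> uniform_Roe Y d" unfolding h2_def by (intro uniform_Roe_scaleC uniform_Roe_diff b bR)
    show "adj h2 = h2" unfolding h2_def using bc
      by (intro blinfun_eqI ell2_eqI) (simp add: adj_op_scaleC adj_diff op_scaleC_apply blinfun.diff_left algebra_simps)
  qed
  have beq: "b = h1 + op_scaleC \<i> h2"
    unfolding h1_def h2_def
    by (intro blinfun_eqI ell2_eqI)
       (simp add: op_scaleC_apply blinfun.diff_left blinfun.add_left blinfun.scaleR_left scaleR_conv_of_real field_simps)
  have "p \<odot> b \<odot> p = p \<odot> h1 \<odot> p + op_scaleC \<i> (p \<odot> h2 \<odot> p)"
    unfolding beq compose_add_right compose_add_left
    using pc by (simp add: op_scaleC_compose_right op_scaleC_compose_left)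
  then show ?thesis using sa[OF h1] sa[OF h2] Badd Bsc by metis
qed

text \<open>Write \<open>0\<close> for a base point of \<open>X\<close>. The vectors \<open>\<xi>_x\<close> are obtained by moving one unit vector \<open>\<xi>_0\<close> in
the range of \<open>\<Phi>(e_00)\<close> with the partial isometries \<open>\<Phi>(e_x0)\<close>. Two uses of heredity make this work: \<open>\<xi>_0 \<otimes> \<xi>_0*\<close> is in \<open>B\<close>, hence is
the image of a scalar multiple of \<open>e_00\<close>, so \<open>\<Phi>(e_00)\<close> has rank one; and if \<open>v\<close> in the range of
\<open>\<Phi>(1)\<close> were orthogonal to all \<open>\<xi>_x\<close>, then \<open>v \<otimes> v*\<close> would be the image of an operator annihilated by
all \<open>e_xx\<close>, so \<open>v = 0\<close>. For empty \<open>X\<close> there is no base point and \<open>u = 0\<close> serves.\<close>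

lemma spatial_implementation:
  fixes X :: "'a set" and Y :: "'b set"
  assumes X: "Metric_space X dX" and Y: "Metric_space Y dY"
    and her: "hereditary_cstar_subalgebra B (uniform_Roe Y dY)"
    and iso: "cstar_isomorphic (uniform_Roe X dX) B"
  obtains u :: "'a ell2 \<Rightarrow>\<^sub>L 'b ell2" where "clin u" "norm u \<le> 1" "adj u \<odot> u = cutoff X" "cutoff Y \<odot> u = u"
    "\<And>a. a \<in> uniform_Roe X dX \<Longrightarrow> u \<odot> a \<odot> adj u \<in> uniform_Roe Y dY"
    "\<And>b. b \<in> uniform_Roe Y dY \<Longrightarrow> adj u \<odot> b \<odot> u \<in> uniform_Roe X dX"
proof (cases "X = {}")
  case True
  have adj0: "adj (0 :: 'a ell2 \<Rightarrow>\<^sub>L 'b ell2) = 0" by (rule adj_unique) auto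
  have "cutoff {} = (0 :: 'a op)" by (intro blinfun_eqI ell2_eqI) simp
  then show thesis using that[of 0] True by (simp add: uniform_Roe_0 adj0)
next
  case False
  then obtain x0 where x0: "x0 \<in> X" by blast
  let ?A = "uniform_Roe X dX" and ?C = "uniform_Roe Y dY"
  obtain \<Phi> where bij: "bij_betw \<Phi> ?A B"
    and \<Phi>add: "\<And>a b. a \<in> ?A \<Longrightarrow> b \<in> ?A \<Longrightarrow> \<Phi> (a + b) = \<Phi> a + \<Phi> b"
    and \<Phi>mult: "\<And>a b. a \<in> ?A \<Longrightarrow> b \<in> ?A \<Longrightarrow> \<Phi> (a \<odot> b) = \<Phi> a \<odot> \<Phi> b"
    and \<Phi>sc: "\<And>c a. a \<in> ?A \<Longrightarrow> \<Phi> (op_scaleC c a) = op_scaleC c (\<Phi> a)"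
    and \<Phi>ad: "\<And>a. a \<in> ?A \<Longrightarrow> \<Phi> (op_adjoint a) = op_adjoint (\<Phi> a)"
    using iso unfolding cstar_isomorphic_def by blast
  have sub: "B \<subseteq> ?C" and Bsc: "\<And>c a. a \<in> B \<Longrightarrow> op_scaleC c a \<in> B"
    and Bher: "\<And>a b. a \<in> ?C \<Longrightarrow> b \<in> B \<Longrightarrow> op_le 0 a \<Longrightarrow> op_le a b \<Longrightarrow> a \<in> B"
    using her by (auto simp: hereditary_cstar_subalgebra_def cstar_subalgebra_def)
  have \<Phi>B: "\<Phi> a \<in> B" if "a \<in> ?A" for a using bij that by (auto simp: bij_betw_def)
  have \<Phi>C: "\<Phi> a \<in> ?C" and \<Phi>clin: "clin (\<Phi> a)" and \<Phi>Y: "cutoff Y \<odot> \<Phi> a = \<Phi> a" if "a \<in> ?A" for a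
    using \<Phi>B[OF that] sub uniform_RoeD by blast+
  have \<Phi>inj: "a = b" if "a \<in> ?A" "b \<in> ?A" "\<Phi> a = \<Phi> b" for a b
    using bij that by (auto simp: bij_betw_def inj_on_def)
  have \<Phi>surj: "\<exists>a\<in>?A. \<Phi> a = b" if "b \<in> B" for b using bij that by (auto simp: bij_betw_def)
  have \<Phi>adj: "\<Phi> (adj a) = adj (\<Phi> a)" if "a \<in> ?A" for a
    using \<Phi>ad[OF that] op_adjoint_eq_adj uniform_RoeD(1)[OF that] \<Phi>clin[OF that] by metis
  have \<Phi>0: "\<Phi> 0 = 0" using \<Phi>add[of 0 0] by (simp add: uniform_Roe_0)
  have Amult: "a \<odot> b \<in> ?A" if "a \<in> ?A" "b \<in> ?A" for a b
    using uniform_Roe_compose[OF X that] .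
  have rank1_B: "rank1 v v \<in> B" if "q \<in> B" "adj q = q" "q \<odot> q = q" "q v = v" for q v
  proof -
    have q: "clin q" "cutoff Y \<odot> q = q" using that(1) sub uniform_RoeD by blast+
    have "cutoff Y v = v" by (metis q(2) that(4) blinfun_apply_blinfun_compose)
    then have "rank1 v v \<in> ?C" by (intro uniform_Roe_rank1[OF Y])
    moreover have "(norm v)^2 *\<^sub>R q \<in> B" by (metis Bsc that(1) op_scaleC_of_real)
    ultimately show ?thesis
      using Bher op_le_0_rank1 op_le_rank1_projection[OF q(1) that(2,3,4)] by blast
  qed
  define e :: "'a \<Rightarrow> 'a \<Rightarrow> 'a op" where "e x y = rank1 (ell2_delta x) (ell2_delta y)" for x y
  have eA: "e x y \<in> ?A" if "x \<in> X" "y \<in> X" for x y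
    unfolding e_def using that by (intro uniform_Roe_rank1[OF X] ell2_eqI) auto
  have ee: "e x y \<odot> e y' z = (if y = y' then e x z else 0)" for x y y' z
    unfolding e_def by (intro blinfun_eqI ell2_eqI) auto
  have eadj: "adj (e x y) = e y x" for x y by (simp add: e_def)
  have eae: "e y y \<odot> a \<odot> e x x = op_scaleC (a (ell2_delta x) $$ y) (e y x)" if "clin a" for a x y
    unfolding e_def using that
    by (intro blinfun_eqI ell2_eqI) (simp add: op_scaleC_apply clinD)
  define q where "q = \<Phi> (e x0 x0)"
  have q: "q \<in> B" "adj q = q" "q \<odot> q = q" "clin q"
    using \<Phi>B[OF eA[OF x0 x0]] \<Phi>adj[OF eA[OF x0 x0]] \<Phi>mult[OF eA[OF x0 x0] eA[OF x0 x0]] \<Phi>clin[OF eA[OF x0 x0]]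
    by (simp_all add: q_def eadj ee)
  have "e x0 x0 \<noteq> 0"
  proof
    assume "e x0 x0 = 0"
    then have "e x0 x0 (ell2_delta x0) $$ x0 = 0" by simp
    then show False by (simp add: e_def)
  qed
  then have "q \<noteq> 0" using \<Phi>inj[OF eA[OF x0 x0] uniform_Roe_0] \<Phi>0 by (auto simp: q_def)
  then obtain f where f: "q f \<noteq> 0" by (metis blinfun_eqI zero_blinfun.rep_eq)
  define \<xi>0 where "\<xi>0 = (1 / norm (q f)) *\<^sub>R q f"
  have q\<xi>: "q \<xi>0 = \<xi>0"
    using q(3) by (simp add: \<xi>0_def blinfun.scaleR_right) (metis blinfun_apply_blinfun_compose)
  have n\<xi>: "norm \<xi>0 = 1" using f by (simp add: \<xi>0_def)
  \<comment> \<open>the projection is minimal: \<open>k\<close> is below \<open>q\<close>, so it comes from a scalar multiple of \<open>e_00\<close>\<close>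
  have q_eq: "q = rank1 \<xi>0 \<xi>0"
  proof -
    let ?k = "rank1 \<xi>0 \<xi>0"
    obtain a where a: "a \<in> ?A" "\<Phi> a = ?k" using \<Phi>surj[OF rank1_B[OF q(1,2,3) q\<xi>]] by blast
    have "q \<odot> ?k \<odot> q = ?k" using q q\<xi> by (simp add: compose_rank1 rank1_compose)
    then have "\<Phi> (e x0 x0 \<odot> a \<odot> e x0 x0) = \<Phi> a"
      using a eA[OF x0 x0] by (simp add: \<Phi>mult Amult q_def)
    then have "e x0 x0 \<odot> a \<odot> e x0 x0 = a" using \<Phi>inj a eA[OF x0 x0] Amult by blast
    then obtain l where l: "a = op_scaleC l (e x0 x0)"
      using eae[OF uniform_RoeD(1)[OF a(1)], of x0 x0] by metis
    then have k: "?k = op_scaleC l q" using \<Phi>sc[OF eA[OF x0 x0]] a by (simp add: q_def)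
    have "ell2_scaleC 1 \<xi>0 = ?k \<xi>0" by (simp add: cinner_self n\<xi>)
    also have "\<dots> = ell2_scaleC l \<xi>0" unfolding k by (simp add: op_scaleC_apply q\<xi>)
    finally have "ell2_scaleC (l - 1) \<xi>0 = 0"
      using scaleC_add_left[of "l - 1" 1 \<xi>0] by simp
    then have "cmod (l - 1) * norm \<xi>0 = 0" by (metis norm_ell2_scaleC norm_zero)
    then have "l = 1" using n\<xi> by simp
    then show ?thesis using k by (simp add: op_scaleC_of_real[of 1, simplified])
  qed
  define \<xi> where "\<xi> x = (if x \<in> X then \<Phi> (e x x0) \<xi>0 else 0)" for x
  have \<Phi>e: "\<Phi> (e x y) = rank1 (\<xi> x) (\<xi> y)" if "x \<in> X" "y \<in> X" for x y
  proof -
    have "e x y = e x x0 \<odot> e x0 x0 \<odot> e x0 y" by (simp add: ee)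
    then have "\<Phi> (e x y) = \<Phi> (e x x0) \<odot> rank1 \<xi>0 \<xi>0 \<odot> \<Phi> (e x0 y)"
      using that x0 by (simp only: \<Phi>mult Amult eA q_eq[symmetric] q_def)
    also have "\<dots> = rank1 (\<Phi> (e x x0) \<xi>0) (adj (\<Phi> (e x0 y)) \<xi>0)"
      using that x0 by (simp add: compose_rank1 rank1_compose \<Phi>clin eA)
    also have "adj (\<Phi> (e x0 y)) = \<Phi> (e y x0)" using \<Phi>adj[OF eA[OF x0 that(2)]] by (simp add: eadj)
    finally show ?thesis using that by (simp add: \<xi>_def)
  qed
  have orth: "cinner (\<xi> x) (\<xi> y) = (if x = y then 1 else 0)" if "x \<in> X" "y \<in> X" for x y
  proof -
    have "cinner (\<xi> x) (\<xi> y) = cinner (\<Phi> (e x x0) \<xi>0) (\<Phi> (e y x0) \<xi>0)" using that by (simp add: \<xi>_def)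
    also have "\<dots> = cinner (adj (\<Phi> (e y x0)) (\<Phi> (e x x0) \<xi>0)) \<xi>0"
      using that x0 by (simp add: cinner_adj_left \<Phi>clin eA)
    also have "adj (\<Phi> (e y x0)) = \<Phi> (e x0 y)" using \<Phi>adj[OF eA[OF that(2) x0]] by (simp add: eadj)
    also have "\<Phi> (e x0 y) (\<Phi> (e x x0) \<xi>0) = \<Phi> (e x0 y \<odot> e x x0) \<xi>0"
      using that x0 by (simp add: \<Phi>mult eA)
    also have "cinner \<dots> \<xi>0 = (if x = y then 1 else 0)"
      unfolding ee by (simp add: \<Phi>0 q_def[symmetric] q\<xi> cinner_self n\<xi>)
    finally show ?thesis .
  qed
  obtain u where u: "clin u" "\<And>x. u (ell2_delta x) = \<xi> x" "adj u \<odot> u = cutoff X" "norm u \<le> 1"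
    using orthonormal_isometry[of X \<xi>] orth by (auto simp: \<xi>_def)
  have cX: "cutoff X \<in> ?A" by (rule uniform_Roe_cutoff[OF X order_refl])
  define p where "p = \<Phi> (cutoff X)"
  have p: "p \<in> B" "adj p = p" "p \<odot> p = p" "clin p"
    using \<Phi>B[OF cX] \<Phi>adj[OF cX] \<Phi>mult[OF cX cX] \<Phi>clin[OF cX] by (simp_all add: p_def cutoff_compose)
  have p\<Phi>: "p \<odot> \<Phi> a = \<Phi> a" "\<Phi> a \<odot> p = \<Phi> a" if "a \<in> ?A" for a
    using \<Phi>mult[OF cX that] \<Phi>mult[OF that cX] uniform_RoeD[OF that] by (simp_all add: p_def)
  have p\<xi>: "p (\<xi> x) = \<xi> x" for x
    using p\<Phi>(1)[OF eA[OF _ x0], of x] by (simp add: \<xi>_def) (metis blinfun_apply_blinfun_compose)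
  have pu: "p \<odot> u = u"
    by (rule blinfun_eq_on_delta) (use u p p\<xi> in auto)
  have Yu: "cutoff Y \<odot> u = u"
  proof (rule blinfun_eq_on_delta)
    fix x show "(cutoff Y \<odot> u) (ell2_delta x) = u (ell2_delta x)"
      using \<Phi>Y[OF eA[OF _ x0], of x] by (simp add: u \<xi>_def) (metis blinfun_apply_blinfun_compose)
  qed (use u in auto)
  \<comment> \<open>the vectors \<open>\<xi>_x\<close> exhaust the range of \<open>p\<close>\<close>
  have uu: "u \<odot> adj u = p"
  proof (rule blinfun_eqI)
    fix f
    define v where "v = p f - u (adj u f)"
    have pv: "p v = v"
    proof -
      have "p (p f) = p f" "p (u (adj u f)) = u (adj u f)"
        using p(3) pu by (metis blinfun_apply_blinfun_compose)+
      then show ?thesis by (simp add: v_def blinfun.diff_right)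
    qed
    have v\<xi>: "cinner v (\<xi> x) = 0" if "x \<in> X" for x
    proof -
      have "cinner (p f) (\<xi> x) = cinner f (\<xi> x)" using cinner_adj_right[OF p(4), of f "\<xi> x"] p p\<xi> by simp
      moreover have "cinner (u (adj u f)) (\<xi> x) = cinner (adj u f) ((adj u \<odot> u) (ell2_delta x))"
        unfolding u(2)[symmetric] by (simp add: cinner_adj_right[OF u(1)])
      moreover have "(adj u \<odot> u) (ell2_delta x) = ell2_delta x"
        unfolding u(3) using that by (intro ell2_eqI) simp
      moreover have "cinner (adj u f) (ell2_delta x) = cinner f (\<xi> x)"
        using u by (simp add: adj_apply)
      ultimately show ?thesis by (simp add: v_def cinner_diff_left)
    qed
    obtain a where a: "a \<in> ?A" "\<Phi> a = rank1 v v" using \<Phi>surj[OF rank1_B[OF p(1,2,3) pv]] by blast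
    have "e x x \<odot> a = 0" if "x \<in> X" for x
    proof -
      have "\<Phi> (e x x \<odot> a) = rank1 (\<xi> x) (\<xi> x) \<odot> rank1 v v"
        using \<Phi>mult[OF eA a(1), of x x] that \<Phi>e a by simp
      also have "\<dots> = 0" by (rule blinfun_eqI) (use v\<xi> that in \<open>simp add: cinner_scaleC_left\<close>)
      finally show ?thesis using \<Phi>inj[OF Amult[OF eA a(1)] uniform_Roe_0] that \<Phi>0 by metis
    qed
    then have eaf: "e x x (a g) = 0" if "x \<in> X" for x g
      using that by (metis blinfun_apply_blinfun_compose zero_blinfun.rep_eq)
    have "a = 0"
    proof (rule blinfun_eqI, rule ell2_eqI)
      fix g x
      show "a g $$ x = blinfun_apply 0 g $$ x"
      proof (cases "x \<in> X")
        case True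
        have "e x x (a g) $$ x = a g $$ x" by (simp add: e_def)
        then show ?thesis using eaf[OF True, of g] by simp
      qed (use bounded_ops_apply_outside[OF uniform_Roe_bounded_ops[OF a(1)]] in simp)
    qed
    then have "rank1 v v v = 0" using a \<Phi>0 by simp
    then have "ell2_scaleC (of_real ((norm v)^2)) v = 0" by (simp add: cinner_self)
    then have "v = 0" unfolding scaleC_of_real by simp
    then show "(u \<odot> adj u) f = p f" by (simp add: v_def)
  qed
  \<comment> \<open>compressing by matrix units recovers the matrix of \<open>a\<close> from that of \<open>\<Phi> a\<close>\<close>
  have u\<Phi>u: "adj u \<odot> \<Phi> a \<odot> u = a" if a: "a \<in> ?A" for a
  proof (rule blinfun_eq_on_delta)
    have ac: "clin a" using uniform_RoeD(1)[OF a] .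
    show "clin (adj u \<odot> \<Phi> a \<odot> u)" "clin a" using u \<Phi>clin[OF a] ac by auto
    fix x
    have lhs: "(adj u \<odot> \<Phi> a \<odot> u) (ell2_delta x) $$ y = cinner (\<Phi> a (\<xi> x)) (\<xi> y)" for y
      using u by (simp add: adj_apply)
    show "(adj u \<odot> \<Phi> a \<odot> u) (ell2_delta x) = a (ell2_delta x)"
    proof (rule ell2_eqI)
      fix y
      consider "x \<notin> X" | "y \<notin> X" | "x \<in> X" "y \<in> X" by blast
      then show "(adj u \<odot> \<Phi> a \<odot> u) (ell2_delta x) $$ y = a (ell2_delta x) $$ y"
      proof cases
        case 1
        have "cutoff X (ell2_delta x) = 0" using 1 by (intro ell2_eqI) auto
        then have "a (ell2_delta x) = 0"
          using uniform_RoeD(3)[OF a] by (metis blinfun_apply_blinfun_compose blinfun.zero_right)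
        then show ?thesis unfolding lhs using 1 by (simp add: \<xi>_def)
      next
        case 2
        then show ?thesis unfolding lhs
          using bounded_ops_apply_outside[OF uniform_Roe_bounded_ops[OF a]] by (simp add: \<xi>_def)
      next
        case 3
        let ?c = "a (ell2_delta x) $$ y"
        have "rank1 (\<xi> y) (\<xi> y) \<odot> \<Phi> a \<odot> rank1 (\<xi> x) (\<xi> x) = \<Phi> (e y y \<odot> a \<odot> e x x)"
          using 3 a by (simp add: \<Phi>mult Amult eA \<Phi>e)
        also have "\<dots> = op_scaleC ?c (rank1 (\<xi> y) (\<xi> x))"
          using 3 by (simp add: eae[OF ac] \<Phi>sc eA \<Phi>e)
        finally have "(rank1 (\<xi> y) (\<xi> y) \<odot> \<Phi> a \<odot> rank1 (\<xi> x) (\<xi> x)) (\<xi> x) = op_scaleC ?c (rank1 (\<xi> y) (\<xi> x)) (\<xi> x)"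
          by simp
        then have "ell2_scaleC (cinner (\<Phi> a (\<xi> x)) (\<xi> y)) (\<xi> y) = ell2_scaleC ?c (\<xi> y)"
          using 3 by (simp add: orth op_scaleC_apply)
        from arg_cong[OF this, of "\<lambda>f. cinner f (\<xi> y)"]
        show ?thesis unfolding lhs using 3 by (simp add: orth cinner_scaleC_left)
      qed
    qed
  qed
  have \<Phi>u: "\<Phi> a = u \<odot> a \<odot> adj u" if a: "a \<in> ?A" for a
  proof -
    have "\<Phi> a = p \<odot> \<Phi> a \<odot> p" using p\<Phi>[OF a] by simp
    also have "\<dots> = u \<odot> (adj u \<odot> \<Phi> a \<odot> u) \<odot> adj u" unfolding uu[symmetric] by (simp only: compose_assoc)
    also have "\<dots> = u \<odot> a \<odot> adj u" by (simp only: u\<Phi>u[OF a])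
    finally show ?thesis .
  qed
  show thesis
  proof (rule that[OF u(1,4,3) Yu])
    show "u \<odot> a \<odot> adj u \<in> ?C" if "a \<in> ?A" for a using \<Phi>C[OF that] \<Phi>u[OF that] by simp
    fix b assume b: "b \<in> ?C"
    obtain a where a: "a \<in> ?A" "\<Phi> a = p \<odot> b \<odot> p"
      using \<Phi>surj[OF hereditary_compression[OF her Y p(1,2,3) b]] by blast
    have up: "adj u \<odot> p = adj u" using pu p u by (metis adj_compose)
    have "adj u \<odot> b \<odot> u = (adj u \<odot> p) \<odot> b \<odot> (p \<odot> u)" by (simp only: up pu)
    also have "\<dots> = adj u \<odot> \<Phi> a \<odot> u" unfolding a(2) by (simp only: compose_assoc)
    also have "\<dots> = a" by (rule u\<Phi>u[OF a(1)])
    finally show "adj u \<odot> b \<odot> u \<in> ?A" using a by simp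
  qed
qed

section \<open>Operators of controlled relations\<close>

text \<open>Bounded degree in both directions makes the sum of the matrix units a bounded operator.\<close>

definition bdd_rel :: "nat \<Rightarrow> ('a \<times> 'a) set \<Rightarrow> bool" where
  "bdd_rel N E \<longleftrightarrow> (\<forall>x. finite (E `` {x}) \<and> card (E `` {x}) \<le> N) \<and>
     (\<forall>x. finite (E\<inverse> `` {x}) \<and> card (E\<inverse> `` {x}) \<le> N)"

text \<open>The sum of the matrix units \<open>e_xy\<close> over all \<open>(x, y) \<in> E\<close>. Diagonal relations give the cutoff
projections, singletons the matrix units.\<close>

definition rel_op :: "('a \<times> 'a) set \<Rightarrow> 'a op" where
  "rel_op E = coord_op (\<lambda>f x. \<Sum>x'\<in>E `` {x}. f $$ x')"

lemma bdd_rel_converse: "bdd_rel N E \<Longrightarrow> bdd_rel N (E\<inverse>)"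
  by (auto simp: bdd_rel_def)

lemma bdd_rel_mono: "bdd_rel N E \<Longrightarrow> E' \<subseteq> E \<Longrightarrow> bdd_rel N E'"
  unfolding bdd_rel_def
  by (meson Image_mono card_mono converse_mono finite_subset order_refl order_trans)

text \<open>The Schur test for a matrix of zeros and ones: Cauchy-Schwarz costs one factor \<open>N\<close> for each row,
and exchanging the sums another one for each column.\<close>

lemma rel_op_aux:
  assumes E: "bdd_rel N E" and F: "finite F"
  shows "(\<Sum>x\<in>F. (cmod (\<Sum>x'\<in>E `` {x}. f $$ x'))^2) \<le> (real N * norm f)^2"
proof -
  let ?h = "\<lambda>x. (cmod (f $$ x))^2"
  define G where "G = E `` F"
  have G: "finite G" unfolding G_def using E F
    by (subst Image_eq_UN) (auto simp: bdd_rel_def)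
  have "(cmod (\<Sum>x'\<in>E `` {x}. f $$ x'))^2 \<le> real N * (\<Sum>x'\<in>E `` {x}. ?h x')" for x
  proof -
    have "(cmod (\<Sum>x'\<in>E `` {x}. f $$ x'))^2 \<le> (\<Sum>x'\<in>E `` {x}. cmod (f $$ x'))^2"
      by (intro power_mono norm_sum) auto
    also have "\<dots> \<le> (\<Sum>x'\<in>E `` {x}. ?h x') * real (card (E `` {x}))"
      using sum_squared_le_sum_of_squares[of "\<lambda>x'. cmod (f $$ x')" "E `` {x}"] by simp
    also have "\<dots> \<le> (\<Sum>x'\<in>E `` {x}. ?h x') * real N"
      using E by (intro mult_left_mono sum_nonneg) (auto simp: bdd_rel_def)
    finally show ?thesis by (simp add: mult.commute)
  qed
  then have "(\<Sum>x\<in>F. (cmod (\<Sum>x'\<in>E `` {x}. f $$ x'))^2) \<le> (\<Sum>x\<in>F. real N * (\<Sum>x'\<in>E `` {x}. ?h x'))"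
    by (intro sum_mono)
  also have "\<dots> = real N * (\<Sum>x\<in>F. \<Sum>x' | x' \<in> G \<and> (x, x') \<in> E. ?h x')"
    unfolding sum_distrib_left[symmetric]
    by (intro arg_cong2[of _ _ _ _ "(*)"] sum.cong refl) (auto simp: G_def)
  also have "(\<Sum>x\<in>F. \<Sum>x' | x' \<in> G \<and> (x, x') \<in> E. ?h x') = (\<Sum>x'\<in>G. \<Sum>x | x \<in> F \<and> (x, x') \<in> E. ?h x')"
    by (rule sum.swap_restrict[OF F G])
  also have "\<dots> \<le> (\<Sum>x'\<in>G. real N * ?h x')"
  proof (rule sum_mono)
    fix x' assume "x' \<in> G"
    have "card {x \<in> F. (x, x') \<in> E} \<le> card (E\<inverse> `` {x'})"
      using E by (intro card_mono) (auto simp: bdd_rel_def)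
    also have "\<dots> \<le> N" using E by (auto simp: bdd_rel_def)
    finally show "(\<Sum>x | x \<in> F \<and> (x, x') \<in> E. ?h x') \<le> real N * ?h x'"
      by (simp add: mult_right_mono)
  qed
  also have "\<dots> = real N * (\<Sum>x'\<in>G. ?h x')" by (simp add: sum_distrib_left)
  also have "\<dots> \<le> real N * (norm f)^2" by (intro mult_left_mono sum_sq_le_norm) auto
  finally have "(\<Sum>x\<in>F. (cmod (\<Sum>x'\<in>E `` {x}. f $$ x'))^2) \<le> real N * (real N * (norm f)^2)"
    by (simp add: mult_left_mono)
  then show ?thesis by (simp add: power_mult_distrib power2_eq_square[of "real N"] mult.assoc)
qed

lemma
  assumes "bdd_rel N E"
  shows rel_op_apply: "rel_op E f $$ x = (\<Sum>x'\<in>E `` {x}. f $$ x')"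
    and clin_rel_op: "clin (rel_op E)"
    and norm_rel_op: "norm (rel_op E) \<le> real N"
  unfolding rel_op_def
  by (rule coord_op[OF _ _ rel_op_aux[OF assms]]; simp add: sum.distrib sum_distrib_left)+

lemma rel_op_delta:
  assumes "bdd_rel N E"
  shows "rel_op E (ell2_delta y) $$ x = (if (x, y) \<in> E then 1 else 0)"
proof -
  have "finite (E `` {x})" using assms by (simp add: bdd_rel_def)
  then show ?thesis by (simp add: rel_op_apply[OF assms])
qed

lemma adj_rel_op:
  assumes E: "bdd_rel N E"
  shows "adj (rel_op E) = rel_op (E\<inverse>)"
proof (rule blinfun_eq_on_delta)
  note c = clin_rel_op[OF E] clin_rel_op[OF bdd_rel_converse[OF E]]
  show "clin (adj (rel_op E))" "clin (rel_op (E\<inverse>))" using c by auto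
  fix x
  show "adj (rel_op E) (ell2_delta x) = rel_op (E\<inverse>) (ell2_delta x)"
    by (rule ell2_eqI) (simp add: adj_apply[OF c(1)] rel_op_delta[OF E] rel_op_delta[OF bdd_rel_converse[OF E]])
qed

lemma rel_op_Un:
  assumes E: "bdd_rel N (E \<union> E')" and disj: "E \<inter> E' = {}"
  shows "rel_op (E \<union> E') = rel_op E + rel_op E'"
proof -
  have E1: "bdd_rel N E" "bdd_rel N E'" using E by (auto intro: bdd_rel_mono)
  show ?thesis
    using disj by (intro blinfun_eq_on_delta clin_intros clin_rel_op[OF E] clin_rel_op[OF E1(1)]
        clin_rel_op[OF E1(2)] ell2_eqI)
      (auto simp: blinfun.add_left rel_op_delta[OF E] rel_op_delta[OF E1(1)] rel_op_delta[OF E1(2)])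
qed

lemma cutoff_rel_op:
  assumes E: "bdd_rel N E" and "E \<subseteq> A \<times> UNIV"
  shows "cutoff A \<odot> rel_op E = rel_op E"
proof (rule blinfun_eqI, rule ell2_eqI)
  fix f x
  have "E `` {x} = {}" if "x \<notin> A" using assms(2) that by auto
  then show "(cutoff A \<odot> rel_op E) f $$ x = rel_op E f $$ x"
    by (auto simp: rel_op_apply[OF E])
qed

lemma rel_op_cutoff:
  assumes E: "bdd_rel N E" and "E \<subseteq> UNIV \<times> A"
  shows "rel_op E \<odot> cutoff A = rel_op E"
  by (rule blinfun_eqI, rule ell2_eqI)
     (use assms(2) in \<open>auto simp: rel_op_apply[OF E] intro!: sum.cong\<close>)

lemma rel_op_Id_on: "rel_op (Id_on A) = cutoff A"
proof -
  have *: "Id_on A `` {x} = (if x \<in> A then {x} else {})" for x by auto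
  have "bdd_rel 1 (Id_on A)" unfolding bdd_rel_def converse_Id_on * by simp
  then show ?thesis
    by (intro blinfun_eqI ell2_eqI) (simp add: rel_op_apply *)
qed

lemma rel_op_single: "rel_op {(x, x')} = rank1 (ell2_delta x) (ell2_delta x')"
proof -
  have *: "{(x, x')} `` {y} = (if y = x then {x'} else {})"
    "{(x', x)} `` {y} = (if y = x' then {x} else {})" for y by auto
  have "{(x, x')}\<inverse> = {(x', x)}" by auto
  then have "bdd_rel 1 {(x, x')}" by (simp add: bdd_rel_def *)
  then show ?thesis
    by (intro blinfun_eqI ell2_eqI) (simp add: rel_op_apply *)
qed

definition entourage :: "'a set \<Rightarrow> ('a \<Rightarrow> 'a \<Rightarrow> real) \<Rightarrow> real \<Rightarrow> ('a \<times> 'a) set" where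
  "entourage X d r = {(x, y). x \<in> X \<and> y \<in> X \<and> d x y \<le> r}"

lemma ulf_ball_bound:
  assumes X: "Metric_space X d" and ulf: "uniformly_locally_finite X d"
  obtains N :: nat where "\<And>x. x \<in> X \<Longrightarrow> finite {y\<in>X. d x y \<le> r}" "\<And>x. x \<in> X \<Longrightarrow> card {y\<in>X. d x y \<le> r} \<le> N"
proof -
  obtain N where N: "\<And>x. x \<in> X \<Longrightarrow> finite (Metric_space.mcball X d x (max r 1))"
    "\<And>x. x \<in> X \<Longrightarrow> card (Metric_space.mcball X d x (max r 1)) \<le> N"
    using ulf unfolding uniformly_locally_finite_def by (metis max.strict_coboundedI2 zero_less_one)
  have sub: "{y\<in>X. d x y \<le> r} \<subseteq> Metric_space.mcball X d x (max r 1)" if "x \<in> X" for x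
    using that by (auto simp: Metric_space.in_mcball[OF X])
  show thesis
    using N sub by (intro that[of N]) (meson finite_subset card_mono order_trans)+
qed

lemma entourage_bdd_rel:
  assumes X: "Metric_space X d" and ulf: "uniformly_locally_finite X d"
  obtains N where "\<And>E. E \<subseteq> entourage X d r \<Longrightarrow> bdd_rel N E"
proof -
  obtain N where N: "\<And>x. x \<in> X \<Longrightarrow> finite {y\<in>X. d x y \<le> r}" "\<And>x. x \<in> X \<Longrightarrow> card {y\<in>X. d x y \<le> r} \<le> N"
    using ulf_ball_bound[OF X ulf] by blast
  have im: "entourage X d r `` {x} = (if x \<in> X then {y\<in>X. d x y \<le> r} else {})" for x
    by (auto simp: entourage_def)
  have cv: "(entourage X d r)\<inverse> = entourage X d r"
    using Metric_space.commute[OF X] by (auto simp: entourage_def)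
  have "bdd_rel N (entourage X d r)"
    unfolding bdd_rel_def cv im using N by simp
  then show thesis using that bdd_rel_mono by blast
qed

lemma prop_le_rel_op:
  assumes X: "Metric_space X d" and E: "E \<subseteq> entourage X d r" and N: "bdd_rel N E"
  shows "prop_le X d r (rel_op E)"
proof -
  have "E \<subseteq> X \<times> UNIV" "E \<subseteq> UNIV \<times> X" using E by (auto simp: entourage_def)
  then have "rel_op E \<in> bounded_ops X"
    using N by (simp add: bounded_ops_iff clin_rel_op cutoff_rel_op rel_op_cutoff)
  moreover have "(y, x) \<notin> E" if "d x y > r" for x y
    using E that Metric_space.commute[OF X, of x y] by (auto simp: entourage_def)
  ultimately show ?thesis by (auto simp: prop_le_def rel_op_delta[OF N])
qed

section \<open>Uniform approximation by finite propagation operators\<close>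

definition approx :: "'a set \<Rightarrow> ('a \<Rightarrow> 'a \<Rightarrow> real) \<Rightarrow> real \<Rightarrow> real \<Rightarrow> 'a op \<Rightarrow> bool" where
  "approx Y d s e a \<longleftrightarrow> (\<exists>b. prop_le Y d s b \<and> norm (a - b) \<le> e)"

lemma approx_add: "approx Y d s e a \<Longrightarrow> approx Y d t e' a' \<Longrightarrow> approx Y d (max s t) (e + e') (a + a')"
  unfolding approx_def using prop_le_add
  by (metis add_diff_add norm_triangle_mono)

lemma approx_mono: "approx Y d s e a \<Longrightarrow> s \<le> t \<Longrightarrow> e \<le> e' \<Longrightarrow> approx Y d t e' a"
  unfolding approx_def using prop_le_mono order_trans by blast

lemma uniform_Roe_approx: "a \<in> uniform_Roe Y d \<Longrightarrow> e > 0 \<Longrightarrow> \<exists>s. approx Y d s e a"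
  unfolding approx_def uniform_Roe_iff by blast

lemma prop_le_cutoff_conj:
  assumes "prop_le Y d s b"
  shows "prop_le Y d s (cutoff W \<odot> b \<odot> cutoff W)"
proof -
  have b: "clin b" "cutoff Y \<odot> b = b" "b \<odot> cutoff Y = b"
    using assms unfolding prop_le_def bounded_ops_iff by blast+
  have "cutoff Y \<odot> (cutoff W \<odot> b \<odot> cutoff W) = cutoff W \<odot> (cutoff Y \<odot> b) \<odot> cutoff W"
    by (simp only: compose_assoc[symmetric] cutoff_compose Int_commute)
  moreover have "(cutoff W \<odot> b \<odot> cutoff W) \<odot> cutoff Y = cutoff W \<odot> (b \<odot> cutoff Y) \<odot> cutoff W"
    by (simp only: compose_assoc cutoff_compose Int_commute)
  moreover have "cutoff W (ell2_delta x) = (if x \<in> W then ell2_delta x else 0)" for x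
    by (rule ell2_eqI) simp
  ultimately show ?thesis
    using assms b by (auto simp: prop_le_def bounded_ops_iff)
qed

text \<open>Truncation to a finite set leaves a finite rank operator, whose range is almost supported on a finite set.\<close>

lemma finite_tail_left:
  assumes T: "clin T" and G: "finite G" and e: "e > 0"
  shows "\<exists>V. finite V \<and> (\<forall>V'. V \<subseteq> V' \<longrightarrow> norm (cutoff (- V') \<odot> T \<odot> cutoff G) \<le> e)"
proof -
  let ?e = "e / (real (card G) + 1)"
  have "?e > 0" using e by simp
  then have "\<exists>V. finite V \<and> (\<forall>V'. V \<subseteq> V' \<longrightarrow> norm (T (ell2_delta x) - cutoff V' (T (ell2_delta x))) < ?e)" for x
    by (metis cutoff_approx)
  then obtain V where V: "\<And>x. finite (V x)"
    "\<And>x V'. V x \<subseteq> V' \<Longrightarrow> norm (T (ell2_delta x) - cutoff V' (T (ell2_delta x))) < ?e"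
    by metis
  have "norm (cutoff (- V') \<odot> T \<odot> cutoff G) \<le> e" if V': "(\<Union>x\<in>G. V x) \<subseteq> V'" for V'
  proof (rule norm_blinfun_bound)
    fix f :: "'a ell2"
    have comp: "cutoff (- V') g = g - cutoff V' g" for g :: "'b ell2"
      by (rule ell2_eqI) simp
    have "(cutoff (- V') \<odot> T \<odot> cutoff G) f
        = (\<Sum>x\<in>G. ell2_scaleC (f $$ x) (cutoff (- V') (T (ell2_delta x))))"
      using G by (simp add: cutoff_finite_eq_sum blinfun.sum_right clinD[OF T] clinD[OF clin_cutoff])
    also have "norm \<dots> \<le> (\<Sum>x\<in>G. norm f * ?e)"
    proof (rule sum_norm_le)
      fix x assume "x \<in> G"
      then have "norm (cutoff (- V') (T (ell2_delta x))) \<le> ?e"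
        unfolding comp using V(2)[of x V'] V' by (meson UN_upper less_imp_le order_trans)
      then show "norm (ell2_scaleC (f $$ x) (cutoff (- V') (T (ell2_delta x)))) \<le> norm f * ?e"
        unfolding norm_ell2_scaleC by (intro mult_mono cmod_le_norm) auto
    qed
    also have "\<dots> = (real (card G) * ?e) * norm f" by simp
    also have "\<dots> \<le> e * norm f" using e by (intro mult_right_mono mult_divide_plus_one_le) auto
    finally show "norm ((cutoff (- V') \<odot> T \<odot> cutoff G) f) \<le> e * norm f" .
  qed (use e in auto)
  then show ?thesis using V(1) G by (intro exI[of _ "\<Union>x\<in>G. V x"]) auto
qed

lemma finite_tail_right:
  assumes T: "clin T" and V: "finite V" and e: "e > 0"
  shows "\<exists>F. finite F \<and> (\<forall>F'. F \<subseteq> F' \<longrightarrow> norm (cutoff V \<odot> T \<odot> cutoff (- F')) \<le> e)"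
proof -
  have "norm (cutoff V \<odot> T \<odot> cutoff (- F')) = norm (cutoff (- F') \<odot> adj T \<odot> cutoff V)" for F'
  proof -
    have "adj (cutoff V \<odot> T \<odot> cutoff (- F')) = cutoff (- F') \<odot> adj T \<odot> cutoff V"
      using T by (simp add: adj_compose compose_assoc)
    then show ?thesis using T by (metis clin_compose clin_cutoff norm_adj)
  qed
  then show ?thesis using finite_tail_left[of "adj T" V e] T V e by auto
qed

text \<open>The operator factors through the block of \<open>T\<close> from \<open>Q\<close> to \<open>P\<close>, which has norm at most \<open>h\<close>, and the
remaining factors contribute at most \<open>N\<close>.\<close>

lemma block_left:
  assumes T: "clin T" "norm T \<le> 1" and E: "bdd_rel N E" "E \<subseteq> Q \<times> UNIV" and "W \<subseteq> P"
    and small: "norm (cutoff P \<odot> T \<odot> cutoff Q) \<le> h"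
  shows "norm (cutoff W \<odot> (T \<odot> rel_op E \<odot> adj T)) \<le> h * N"
proof -
  have "cutoff W \<odot> (T \<odot> rel_op E \<odot> adj T)
      = cutoff W \<odot> (cutoff P \<odot> T \<odot> cutoff Q) \<odot> (rel_op E \<odot> adj T)"
    by (subst cutoff_rel_op[OF E, symmetric])
       (simp only: compose_assoc[symmetric] cutoff_compose Int_absorb2[OF \<open>W \<subseteq> P\<close>])
  also have "norm \<dots> \<le> norm (cutoff W \<odot> (cutoff P \<odot> T \<odot> cutoff Q)) * norm (rel_op E \<odot> adj T)"
    by (rule norm_blinfun_compose)
  also have "\<dots> \<le> h * N"
  proof (rule mult_mono)
    show "norm (cutoff W \<odot> (cutoff P \<odot> T \<odot> cutoff Q)) \<le> h"
      using small norm_compose_contr_left[OF norm_cutoff] order_trans by blast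
    show "norm (rel_op E \<odot> adj T) \<le> N"
      using norm_compose_contr_right[of "adj T" "rel_op E"] norm_rel_op[OF E(1)] T by simp
    show "0 \<le> h" using small norm_ge_zero order_trans by blast
  qed auto
  finally show ?thesis .
qed

lemma block_right:
  assumes T: "clin T" "norm T \<le> 1" and E: "bdd_rel N E" "E \<subseteq> UNIV \<times> Q" and "W \<subseteq> P"
    and small: "norm (cutoff P \<odot> T \<odot> cutoff Q) \<le> h"
  shows "norm ((T \<odot> rel_op E \<odot> adj T) \<odot> cutoff W) \<le> h * N"
proof -
  have c: "clin (rel_op E)" by (rule clin_rel_op[OF E(1)])
  have "adj ((T \<odot> rel_op E \<odot> adj T) \<odot> cutoff W) = cutoff W \<odot> (T \<odot> rel_op (E\<inverse>) \<odot> adj T)"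
    using T c by (simp add: adj_compose compose_assoc adj_rel_op[OF E(1)])
  then have "norm ((T \<odot> rel_op E \<odot> adj T) \<odot> cutoff W) = norm (cutoff W \<odot> (T \<odot> rel_op (E\<inverse>) \<odot> adj T))"
    using T c by (metis clin_adj clin_compose clin_cutoff norm_adj)
  also have "\<dots> \<le> h * N"
    by (rule block_left[OF T bdd_rel_converse[OF E(1)] _ \<open>W \<subseteq> P\<close> small]) (use E(2) in auto)
  finally show ?thesis .
qed

text \<open>A gliding hump. If the claim fails, then finite relations for which approximation fails can be found
far away from any prescribed finite set, because the finitely many relations near that set can be
approximated simultaneously. Choosing such relations \<open>E_n\<close> successively, with finite sets
\<open>V_n \<subseteq> Y\<close> on which their images almost live, makes the image of the union nearly block diagonal:
compressing it to \<open>V_(n+1) - V_n\<close> almost gives the image of \<open>E_n\<close>. Approximating the image of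
the union therefore approximates the image of each \<open>E_n\<close> equally well, a contradiction for large
\<open>n\<close>.\<close>

lemma equi_approx:
  fixes X :: "'a set" and Y :: "'b set" and T :: "'a ell2 \<Rightarrow>\<^sub>L 'b ell2"
  assumes X: "Metric_space X dX" and ulf: "uniformly_locally_finite X dX"
    and T: "clin T" "norm T \<le> 1"
    and TR: "\<And>a. a \<in> uniform_Roe X dX \<Longrightarrow> T \<odot> a \<odot> adj T \<in> uniform_Roe Y dY"
    and e: "e > 0"
  shows "\<exists>s. \<forall>E. finite E \<and> E \<subseteq> entourage X dX r \<longrightarrow> approx Y dY s e (T \<odot> rel_op E \<odot> adj T)"
proof (rule ccontr)
  define S where "S E = T \<odot> rel_op E \<odot> adj T" for E
  define ent where "ent = entourage X dX r"
  assume "\<not> ?thesis"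
  then have bad: "\<exists>E. finite E \<and> E \<subseteq> ent \<and> \<not> approx Y dY s e (S E)" for s
    by (auto simp: S_def ent_def)
  obtain N where N: "\<And>E. E \<subseteq> ent \<Longrightarrow> bdd_rel N E"
    unfolding ent_def using entourage_bdd_rel[OF X ulf] by blast
  have SR: "S E \<in> uniform_Roe Y dY" if "E \<subseteq> ent" for E
    unfolding S_def using TR prop_le_uniform_Roe[OF prop_le_rel_op[OF X]] that N
    by (metis ent_def)
  have SUn: "S (E \<union> E') = S E + S E'" if "E \<union> E' \<subseteq> ent" "E \<inter> E' = {}" for E E'
    unfolding S_def by (simp add: rel_op_Un[OF N[OF that(1)] that(2)] compose_add_left compose_add_right)
  \<comment> \<open>failure persists, with half the error, away from every finite set\<close>
  have bad_far: "\<exists>E. finite E \<and> E \<subseteq> ent \<and> Field E \<inter> F = {} \<and> \<not> approx Y dY s (e/2) (S E)"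
    if F: "finite F" for F s
  proof (rule ccontr)
    assume no: "\<not> ?thesis"
    define P where "P = {z \<in> ent. fst z \<in> F \<or> snd z \<in> F}"
    have "P \<subseteq> (\<Union>x\<in>F. Pair x ` (ent `` {x})) \<union> (\<Union>x\<in>F. (\<lambda>y. (y, x)) ` (ent\<inverse> `` {x}))"
      by (force simp: P_def)
    moreover have "finite \<dots>"
      using F N[of ent] by (auto simp: bdd_rel_def)
    ultimately have P: "finite P" by (rule finite_subset)
    have "\<exists>t. approx Y dY t (e/2) (S E)" if "E \<subseteq> P" for E
      using uniform_Roe_approx[OF SR, of E "e/2"] that e by (auto simp: P_def)
    then obtain t where t: "\<And>E. E \<subseteq> P \<Longrightarrow> approx Y dY (t E) (e/2) (S E)" by metis
    define s' where "s' = max s (Max (t ` Pow P))"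
    have t': "approx Y dY s' (e/2) (S E)" if "E \<subseteq> P" for E
      using t[OF that] by (rule approx_mono) (use that P in \<open>auto simp: s'_def le_max_iff_disj\<close>)
    obtain E where E: "finite E" "E \<subseteq> ent" "\<not> approx Y dY s' e (S E)" using bad by blast
    have "Field (E - P) \<inter> F = {}" using E(2) by (force simp: P_def Field_def)
    then have "approx Y dY s (e/2) (S (E - P))" using no E(1,2) by blast
    then have "approx Y dY s' (e/2) (S (E - P))" by (rule approx_mono) (auto simp: s'_def)
    from approx_add[OF this t'[of "E \<inter> P"]]
    have "approx Y dY s' e (S (E - P) + S (E \<inter> P))" by simp
    moreover have "S E = S (E - P) + S (E \<inter> P)"
      using SUn[of "E - P" "E \<inter> P"] E(2) by (subgoal_tac "E - P \<union> E \<inter> P = E \<and> (E - P) \<inter> (E \<inter> P) = {}") (metis, blast)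
    ultimately show False using E(3) by simp
  qed
  \<comment> \<open>six small blocks of norm \<open>h N\<close> and one approximation error \<open>h\<close> add up to \<open>e/2\<close>\<close>
  define h where "h = e / 2 / (6 * real N + 1)"
  have h: "h > 0" "6 * (h * N) + h = e/2"
  proof -
    have pos: "6 * real N + 1 > 0" by simp
    show "h > 0" using e pos by (simp add: h_def)
    have "h * (6 * real N + 1) = e/2" by (metis h_def nonzero_eq_divide_eq pos less_irrefl)
    then show "6 * (h * N) + h = e/2" by (simp add: algebra_simps)
  qed
  \<comment> \<open>\<open>G\<close> contains the points used so far, \<open>V\<close> almost carries their images, and \<open>F\<close> is so large that
    points outside \<open>F\<close> have almost no image in \<open>V\<close>; \<open>E\<close> is a bad relation outside \<open>F\<close>\<close>
  define Q where "Q n = (\<lambda>(G, V, F, E). finite G \<and> finite V \<and> finite F \<and> G \<subseteq> F \<and>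
      finite E \<and> E \<subseteq> ent \<and> Field E \<inter> F = {} \<and> \<not> approx Y dY (real n) (e/2) (S E) \<and>
      norm (cutoff (- V) \<odot> T \<odot> cutoff G) \<le> h \<and> norm (cutoff V \<odot> T \<odot> cutoff (- F)) \<le> h)" for n
  have step: "\<exists>V F E. Q n (G, V, F, E) \<and> V0 \<subseteq> V" if fin: "finite G" "finite V0" for n G V0
  proof -
    obtain V where V: "finite V" "V0 \<subseteq> V" "norm (cutoff (- V) \<odot> T \<odot> cutoff G) \<le> h"
      using finite_tail_left[OF T(1) fin(1) h(1)] fin(2) by (metis finite_Un sup_ge1 sup_ge2)
    obtain F where F: "finite F" "G \<subseteq> F" "norm (cutoff V \<odot> T \<odot> cutoff (- F)) \<le> h"
      using finite_tail_right[OF T(1) V(1) h(1)] fin(1) by (metis finite_Un sup_ge1 sup_ge2)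
    obtain E where "finite E" "E \<subseteq> ent" "Field E \<inter> F = {}" "\<not> approx Y dY (real n) (e/2) (S E)"
      using bad_far[OF F(1)] by blast
    then show ?thesis using V F fin unfolding Q_def by blast
  qed
  obtain z where z: "\<And>n. Q n (z n)"
    "\<And>n. fst (snd (snd (z n))) \<union> Field (snd (snd (snd (z n)))) \<subseteq> fst (z (Suc n))"
    "\<And>n. fst (snd (z n)) \<subseteq> fst (snd (z (Suc n)))"
  proof -
    have "\<exists>f. \<forall>n. Q n (f n) \<and> (fst (snd (snd (f n))) \<union> Field (snd (snd (snd (f n)))) \<subseteq> fst (f (Suc n)) \<and>
      fst (snd (f n)) \<subseteq> fst (snd (f (Suc n))))"
    proof (rule dependent_nat_choice)
      show "\<exists>x. Q 0 x" using step[of "{}" "{}" 0] by auto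
      fix x n assume "Q n x"
      then obtain G V F E where x: "x = (G, V, F, E)" "finite V" "finite F" "finite E"
        unfolding Q_def by auto
      then have "finite (F \<union> Field E)" using finite_Field by blast
      from step[OF this x(2), of "Suc n"] show "\<exists>y. Q (Suc n) y \<and>
        fst (snd (snd x)) \<union> Field (snd (snd (snd x))) \<subseteq> fst y \<and> fst (snd x) \<subseteq> fst (snd y)"
        using x(1) by fastforce
    qed
    then show thesis using that by blast
  qed
  define G V F E where "G n = fst (z n)" and "V n = fst (snd (z n))"
    and "F n = fst (snd (snd (z n)))" and "E n = snd (snd (snd (z n)))" for n
  have GF: "G n \<subseteq> F n" and Eent: "E n \<subseteq> ent" and EF: "Field (E n) \<inter> F n = {}"
    and Ebad: "\<not> approx Y dY (real n) (e/2) (S (E n))"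
    and VG: "norm (cutoff (- V n) \<odot> T \<odot> cutoff (G n)) \<le> h"
    and VF: "norm (cutoff (V n) \<odot> T \<odot> cutoff (- F n)) \<le> h" for n
    using z(1)[of n] by (auto simp: Q_def G_def V_def F_def E_def split_beta)
  have FG: "F n \<union> Field (E n) \<subseteq> G (Suc n)" and VV: "V n \<subseteq> V (Suc n)" for n
    using z(2,3)[of n] by (auto simp: G_def V_def F_def E_def)
  have Gmono: "G m \<subseteq> G n" if "m \<le> n" for m n
    using that by (rule lift_Suc_mono_le[rotated]) (use FG GF in blast)
  have EG: "Field (E m) \<subseteq> G n" if "m < n" for m n
    using Gmono[of "Suc m" n] FG[of m] that by auto
  have Eout: "Field (E m) \<inter> F n = {}" if "n \<le> m" for m n
    using EF[of m] Gmono[of "Suc n" m] FG[of n] GF[of m] that by (cases "n = m") auto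
  obtain s where "approx Y dY s h (S (\<Union>n. E n))"
    using uniform_Roe_approx[OF SR, of "\<Union>n. E n" h] Eent h by blast
  then obtain b where b: "prop_le Y dY s b" "norm (S (\<Union>n. E n) - b) \<le> h"
    by (auto simp: approx_def)
  define n where "n = nat \<lceil>s\<rceil>"
  have sn: "s \<le> real n" unfolding n_def by linarith
  \<comment> \<open>the relations before \<open>E n\<close> do not reach \<open>W\<close> since it avoids \<open>V n\<close>, the later ones since \<open>W \<subseteq> V (Suc n)\<close>\<close>
  define W where "W = V (Suc n) - V n"
  define El Eg where "El = (\<Union>m\<in>{..<n}. E m)" and "Eg = (\<Union>m\<in>{n<..}. E m)"
  have idx: "(UNIV :: nat set) = insert n ({..<n} \<union> {n<..})" by auto
  have Un: "(\<Union>m. E m) = E n \<union> (El \<union> Eg)"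
    unfolding El_def Eg_def by (subst idx) blast
  have FE: "Field E' \<inter> A = {} \<Longrightarrow> E' \<subseteq> (- A) \<times> (- A)" and FE': "Field E' \<subseteq> A \<Longrightarrow> E' \<subseteq> A \<times> A"
    for E' and A :: "'a set"
    by (force simp: Field_def)+
  have ent: "El \<subseteq> ent" "Eg \<subseteq> ent" using Eent by (auto simp: El_def Eg_def)
  have El: "El \<subseteq> G n \<times> G n"
    unfolding El_def by (intro UN_least FE' EG) simp
  have Eg: "Eg \<subseteq> (- F (Suc n)) \<times> (- F (Suc n))"
    unfolding Eg_def by (intro UN_least FE Eout) simp
  have En: "E n \<subseteq> (- F n) \<times> (- F n)" "E n \<subseteq> G (Suc n) \<times> G (Suc n)"
    using FE[OF EF] FE'[OF EG] by blast+
  have "fst z \<notin> F n \<and> fst z \<in> F (Suc n)" if "z \<in> E n" for z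
    using subsetD[OF En(1) that] subsetD[OF En(2) that] GF[of "Suc n"] by (auto simp: mem_Times_iff)
  moreover have "fst z \<in> F n \<and> fst z \<in> F (Suc n)" if "z \<in> El" for z
    using subsetD[OF El that] GF[of n] FG[of n] GF[of "Suc n"] by (auto simp: mem_Times_iff)
  moreover have "fst z \<notin> F (Suc n)" if "z \<in> Eg" for z
    using subsetD[OF Eg that] by (auto simp: mem_Times_iff)
  ultimately have disj: "E n \<inter> (El \<union> Eg) = {}" "El \<inter> Eg = {}"
    by blast+
  have sum: "S (\<Union>m. E m) = S (E n) + (S El + S Eg)"
    unfolding Un using SUn[of "E n" "El \<union> Eg"] SUn[of El Eg] disj ent Eent by simp
  let ?W = "cutoff W"
  have l: "norm (?W \<odot> S El) \<le> h * N"
    unfolding S_def by (rule block_left[OF T N[OF ent(1)] _ _ VG[of n]]) (use El in \<open>auto simp: W_def\<close>)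
  have g: "norm (?W \<odot> S Eg) \<le> h * N"
    unfolding S_def by (rule block_left[OF T N[OF ent(2)] _ _ VF[of "Suc n"]]) (use Eg in \<open>auto simp: W_def\<close>)
  have cW: "cutoff (- W) = cutoff (- V (Suc n)) + cutoff (V n)"
    by (rule blinfun_eqI, rule ell2_eqI) (use VV[of n] in \<open>auto simp: W_def blinfun.add_left\<close>)
  have c1: "norm (cutoff (- W) \<odot> S (E n)) \<le> h * N + h * N"
    unfolding cW compose_add_left S_def
    by (intro norm_triangle_mono block_left[OF T N[OF Eent] _ _ VG[of "Suc n"]]
        block_left[OF T N[OF Eent] _ _ VF[of n]]) (use En in auto)
  have c2: "norm (S (E n) \<odot> cutoff (- W)) \<le> h * N + h * N"
    unfolding cW compose_add_right S_def
    by (intro norm_triangle_mono block_right[OF T N[OF Eent] _ _ VG[of "Suc n"]]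
        block_right[OF T N[OF Eent] _ _ VF[of n]]) (use En in auto)
  have id: "cutoff (- W) \<odot> a + ?W \<odot> a = a" "a \<odot> cutoff (- W) + a \<odot> ?W = a" for a :: "'b op"
  proof -
    have 1: "cutoff (- W) f + ?W f = f" for f by (rule ell2_eqI) simp
    show "cutoff (- W) \<odot> a + ?W \<odot> a = a"
      by (rule blinfun_eqI) (simp add: blinfun.add_left 1)
    show "a \<odot> cutoff (- W) + a \<odot> ?W = a"
      by (rule blinfun_eqI) (simp add: blinfun.add_left 1 flip: blinfun.add_right)
  qed
  let ?d = "S (\<Union>m. E m) - b"
  have "S (E n) - ?W \<odot> b \<odot> ?W = cutoff (- W) \<odot> S (E n) + ?W \<odot> (S (E n) \<odot> cutoff (- W))
      + (?W \<odot> ?d \<odot> ?W - (?W \<odot> S El \<odot> ?W + ?W \<odot> S Eg \<odot> ?W))"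
  proof -
    have "S (E n) = cutoff (- W) \<odot> S (E n) + ?W \<odot> (S (E n) \<odot> cutoff (- W) + S (E n) \<odot> ?W)"
      by (simp only: id)
    also have "\<dots> = cutoff (- W) \<odot> S (E n) + ?W \<odot> (S (E n) \<odot> cutoff (- W)) + ?W \<odot> S (E n) \<odot> ?W"
      by (simp add: compose_add_right compose_assoc)
    also have "?W \<odot> S (E n) \<odot> ?W = ?W \<odot> b \<odot> ?W + (?W \<odot> ?d \<odot> ?W - (?W \<odot> S El \<odot> ?W + ?W \<odot> S Eg \<odot> ?W))"
      by (simp add: sum compose_add_right compose_add_left compose_diff_right compose_diff_left)
    finally show ?thesis by (simp add: algebra_simps)
  qed
  also have "norm \<dots> \<le> ((h * N + h * N) + (h * N + h * N)) + (h + (h * N + h * N))"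
  proof -
    have 1: "norm (?W \<odot> (S (E n) \<odot> cutoff (- W))) \<le> h * N + h * N"
      by (rule order_trans[OF norm_compose_contr_left[OF norm_cutoff] c2])
    have 2: "norm (?W \<odot> ?d \<odot> ?W) \<le> h"
      by (meson norm_compose_contr_left norm_compose_contr_right norm_cutoff b(2) order_trans)
    have 3: "norm (?W \<odot> S El \<odot> ?W) \<le> h * N" "norm (?W \<odot> S Eg \<odot> ?W) \<le> h * N"
      by (meson norm_compose_contr_right norm_cutoff l g order_trans)+
    have "norm (?W \<odot> ?d \<odot> ?W - (?W \<odot> S El \<odot> ?W + ?W \<odot> S Eg \<odot> ?W)) \<le> h + (h * N + h * N)"
      by (rule order_trans[OF norm_triangle_ineq4 add_mono[OF 2 norm_triangle_mono[OF 3]]])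
    then show ?thesis by (intro norm_triangle_mono c1 1)
  qed
  also have "\<dots> = e/2" using h(2) by linarith
  finally have "approx Y dY s (e/2) (S (E n))"
    using prop_le_cutoff_conj[OF b(1)] unfolding approx_def by blast
  then show False using Ebad[of n] approx_mono[OF _ sn] by blast
qed

text \<open>The operator \<open>T e_x'x T*\<close> has a matrix entry of modulus at least \<open>c^2\<close> at \<open>(y, y')\<close>, so the operator
cannot be within \<open>c^2/2\<close> of one whose propagation is smaller than \<open>d(y, y')\<close>. Used for \<open>T = u\<close> and for
\<open>T = u*\<close>, this gives both halves of a coarse embedding.\<close>

lemma coarse_on_atoms:
  fixes X :: "'a set" and Y :: "'b set" and T :: "'a ell2 \<Rightarrow>\<^sub>L 'b ell2"
  assumes X: "Metric_space X dX" and ulf: "uniformly_locally_finite X dX"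
    and T: "clin T" "norm T \<le> 1"
    and TR: "\<And>a. a \<in> uniform_Roe X dX \<Longrightarrow> T \<odot> a \<odot> adj T \<in> uniform_Roe Y dY"
    and c: "c > 0"
  shows "\<exists>s. \<forall>x\<in>X. \<forall>x'\<in>X. \<forall>y\<in>Y. \<forall>y'\<in>Y. dX x x' \<le> r \<and> c \<le> cmod (T (ell2_delta x) $$ y)
     \<and> c \<le> cmod (T (ell2_delta x') $$ y') \<longrightarrow> dY y y' \<le> s"
proof -
  have "c^2/2 > 0" using c by simp
  from equi_approx[OF X ulf T TR this, where r=r]
  obtain s where s: "\<And>E. finite E \<Longrightarrow> E \<subseteq> entourage X dX r \<Longrightarrow> approx Y dY s (c^2/2) (T \<odot> rel_op E \<odot> adj T)"
    by blast
  have "dY y y' \<le> s" if xy: "x \<in> X" "x' \<in> X" "y \<in> Y" "y' \<in> Y" "dX x x' \<le> r"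
    and cx: "c \<le> cmod (T (ell2_delta x) $$ y)" "c \<le> cmod (T (ell2_delta x') $$ y')"
    for x x' y y'
  proof (rule ccontr)
    assume far: "\<not> dY y y' \<le> s"
    let ?a = "T \<odot> rel_op {(x', x)} \<odot> adj T"
    have "dX x' x \<le> r" using xy Metric_space.commute[OF X] by metis
    then obtain b where b: "prop_le Y dY s b" "norm (?a - b) \<le> c^2/2"
      using s[of "{(x', x)}"] xy by (auto simp: approx_def entourage_def)
    have "(?a (ell2_delta y)) $$ y' = cnj (T (ell2_delta x) $$ y) * T (ell2_delta x') $$ y'"
      using T(1) by (simp add: rel_op_single adj_apply clinD)
    moreover have "b (ell2_delta y) $$ y' = 0"
      using b(1) far xy by (auto simp: prop_le_def)
    ultimately have "cmod (T (ell2_delta x) $$ y) * cmod (T (ell2_delta x') $$ y')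
        = cmod ((?a - b) (ell2_delta y) $$ y')"
      by (simp add: blinfun.diff_left norm_mult)
    also have "\<dots> \<le> norm ((?a - b) (ell2_delta y))" by (rule cmod_le_norm)
    also have "\<dots> \<le> norm (?a - b) * norm (ell2_delta y)" by (rule norm_blinfun)
    also have "\<dots> \<le> c^2/2" using b(2) by simp
    finally have "cmod (T (ell2_delta x) $$ y) * cmod (T (ell2_delta x') $$ y') \<le> c^2/2" .
    moreover have "c * c \<le> cmod (T (ell2_delta x) $$ y) * cmod (T (ell2_delta x') $$ y')"
      using cx c by (intro mult_mono) auto
    moreover have "0 < c * c" using c by simp
    ultimately show False unfolding power2_eq_square by linarith
  qed
  then show ?thesis by blast
qed

section \<open>Large coordinates from compact ghost projections\<close>

lemma uniform_Roe_subspace: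
  assumes "Z \<subseteq> Y" and a: "a \<in> uniform_Roe Y d" and az: "cutoff Z \<odot> a \<odot> cutoff Z = a"
  shows "a \<in> uniform_Roe Z d"
  unfolding uniform_Roe_iff
proof (intro allI impI)
  fix e :: real assume "e > 0"
  then obtain r b where b: "prop_le Y d r b" "norm (a - b) \<le> e"
    using a unfolding uniform_Roe_iff by blast
  let ?c = "cutoff Z \<odot> b \<odot> cutoff Z"
  have "clin b" using b unfolding prop_le_def bounded_ops_iff by blast
  moreover have "cutoff Z \<odot> ?c = ?c" "?c \<odot> cutoff Z = ?c"
    by (simp only: compose_assoc[symmetric] cutoff_compose Int_absorb,
        simp only: compose_assoc cutoff_compose Int_absorb)
  moreover have "prop_le Y d r ?c" by (rule prop_le_cutoff_conj[OF b(1)])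
  ultimately have "prop_le Z d r ?c"
    using assms(1) unfolding prop_le_def bounded_ops_iff by (meson clin_compose clin_cutoff subsetD)
  moreover have "norm (a - ?c) \<le> e"
  proof -
    have "a - ?c = cutoff Z \<odot> (a - b) \<odot> cutoff Z"
      by (simp add: compose_diff_left compose_diff_right az)
    also have "norm \<dots> \<le> norm (a - b)"
      by (meson norm_compose_contr_left norm_compose_contr_right norm_cutoff order_trans)
    finally show ?thesis using b(2) by simp
  qed
  ultimately show "\<exists>r b. prop_le Z d r b \<and> norm (a - b) \<le> e" by blast
qed

lemma norm_cutoff_le_sum:
  assumes "finite V"
  shows "norm (cutoff V f) \<le> (\<Sum>y\<in>V. cmod (f $$ y))"
  unfolding cutoff_finite_eq_sum[OF assms]
  by (rule order_trans[OF norm_sum]) (simp add: norm_ell2_scaleC)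

lemma cinner_disjoint_cutoffs:
  assumes "A \<inter> B = {}"
  shows "cinner (cutoff A f) (cutoff B g) = 0"
proof -
  have "cinner (cutoff A f) (cutoff B g) = cinner f (cutoff A (cutoff B g))"
    using cinner_adj_right[OF clin_cutoff, of f A "cutoff B g"] by simp
  moreover have "cutoff A (cutoff B g) = 0" by (rule ell2_eqI) (use assms in auto)
  ultimately show ?thesis by simp
qed

text \<open>Distinct orthonormal vectors have distance \<open>sqrt 2\<close>, so they have no convergent subsequence.\<close>

lemma compact_op_orthonormal_fixed:
  fixes \<zeta> :: "nat \<Rightarrow> 'a ell2" and q :: "'a op"
  assumes orth: "\<And>m n. cinner (\<zeta> m) (\<zeta> n) = (if m = n then 1 else 0)"
    and fixed: "\<And>n. q (\<zeta> n) = \<zeta> n"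
  shows "\<not> compact_op q"
proof
  assume "compact_op q"
  then have sc: "seq_compact (closure (q ` cball 0 1))"
    unfolding compact_op_def by (simp add: compact_eq_seq_compact_metric)
  have nz: "norm (\<zeta> n) = 1" for n by (rule norm_eq_1I) (simp add: orth)
  have all: "\<forall>n. \<zeta> n \<in> closure (q ` cball 0 1)"
  proof
    fix n have "\<zeta> n \<in> q ` cball 0 1" using fixed[of n] nz[of n] by (intro image_eqI[of _ _ "\<zeta> n"]) auto
    then show "\<zeta> n \<in> closure (q ` cball 0 1)" by (rule subsetD[OF closure_subset])
  qed
  obtain l r where r: "strict_mono r" "(\<zeta> \<circ> r) \<longlonglongrightarrow> l"
    using seq_compactE[OF sc all] by metis
  then have "Cauchy (\<zeta> \<circ> r)" by (simp add: LIMSEQ_imp_Cauchy)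
  then obtain M where M: "\<And>m n. m \<ge> M \<Longrightarrow> n \<ge> M \<Longrightarrow> dist ((\<zeta> \<circ> r) m) ((\<zeta> \<circ> r) n) < 1"
    unfolding Cauchy_def by (metis zero_less_one)
  let ?a = "\<zeta> (r M)" and ?b = "\<zeta> (r (Suc M))"
  have ne: "r M \<noteq> r (Suc M)" using r(1) by (metis lessI strict_mono_less less_irrefl)
  have "of_real ((norm (?a - ?b))^2) = (2 :: complex)"
    using ne unfolding cinner_self[symmetric] by (simp add: cinner_diff_left cinner_diff_right orth)
  then have "complex_of_real ((norm (?a - ?b))^2) = of_real 2" by simp
  then have "(norm (?a - ?b))^2 = 2" unfolding of_real_eq_iff .
  moreover have "norm (?a - ?b) < 1" using M[of M "Suc M"] by (simp add: dist_norm)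
  then have "(norm (?a - ?b))^2 \<le> 1" by (simp add: power_le_one)
  ultimately show False by simp
qed

text \<open>The square of the norm is at most the sum of the squares of the norms of the columns, which here is
bounded by a geometric series.\<close>

lemma norm_tail_geometric:
  fixes v :: "nat \<Rightarrow> 'b ell2"
  assumes t: "clin t" "\<And>n. t (ell2_delta n) = v n" and small: "\<And>n. norm (v n) \<le> (1/2)^(n+1)"
  shows "norm (t \<odot> cutoff {k..}) \<le> sqrt ((1/2)^k)"
proof -
  have "norm (cutoff {k..} \<odot> adj t) \<le> sqrt ((1/2)^k)"
  proof (rule norm_blinfun_bound)
    fix g
    show "norm ((cutoff {k..} \<odot> adj t) g) \<le> sqrt ((1/2)^k) * norm g"
    proof (rule norm_leI)
      fix F :: "nat set" assume F: "finite F"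
      have "(\<Sum>n\<in>F. (cmod ((cutoff {k..} \<odot> adj t) g $$ n))^2)
          \<le> (\<Sum>n\<in>F. ((1/2)^k * (norm g)^2) * (1/2)^(n+1))"
      proof (rule sum_mono)
        fix n
        show "(cmod ((cutoff {k..} \<odot> adj t) g $$ n))^2 \<le> ((1/2)^k * (norm g)^2) * (1/2)^(n+1)"
        proof (cases "n \<ge> k")
          case True
          have "cmod (cinner g (v n)) \<le> norm g * (1/2)^(n+1)"
            by (rule order_trans[OF cinner_Cauchy_Schwarz mult_left_mono[OF small]]) simp
          then have "(cmod (cinner g (v n)))^2 \<le> (norm g * (1/2)^(n+1))^2" by (intro power_mono) auto
          also have "\<dots> = (norm g)^2 * ((1/2)^(n+1) * (1/2)^(n+1))"
            by (simp add: power_mult_distrib power2_eq_square)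
          also have "\<dots> \<le> (norm g)^2 * ((1/2)^k * (1/2)^(n+1))"
            using True by (intro mult_left_mono mult_right_mono power_decreasing) auto
          finally show ?thesis using True t by (simp add: adj_apply mult_ac)
        qed auto
      qed
      also have "\<dots> = ((1/2)^k * (norm g)^2) * (\<Sum>n\<in>F. (1/2)^(n+1))" by (simp only: sum_distrib_left)
      also have "\<dots> \<le> ((1/2)^k * (norm g)^2) * 1"
      proof (intro mult_left_mono)
        have "(\<Sum>n\<in>F. (1/2::real)^(n+1)) \<le> (\<Sum>n. (1/2)^(n+1))"
          using power_half_series by (intro sum_le_suminf) (auto simp: sums_iff F)
        also have "\<dots> = 1" using power_half_series by (simp add: sums_iff)
        finally show "(\<Sum>n\<in>F. (1/2::real)^(n+1)) \<le> 1" .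
      qed auto
      also have "\<dots> = (sqrt ((1/2)^k) * norm g)^2" by (simp add: power_mult_distrib)
      finally show "(\<Sum>n\<in>F. (cmod ((cutoff {k..} \<odot> adj t) g $$ n))^2) \<le> (sqrt ((1/2)^k) * norm g)^2" .
    qed auto
  qed auto
  moreover have "adj (t \<odot> cutoff {k..}) = cutoff {k..} \<odot> adj t" using t by (simp add: adj_compose)
  ultimately show ?thesis using t by (metis clin_compose clin_cutoff norm_adj)
qed

text \<open>Vectors with uniformly small coordinates have little mass on any finite set. So one can always pick
the next vector to live, up to a small error, on a finite set outside the neighbourhood of radius
\<open>n\<close> of everything chosen before.\<close>

lemma spread_out_vectors_selection:
  fixes \<xi> :: "'a \<Rightarrow> 'b ell2"
  assumes Y: "Metric_space Y dY" and ulf: "uniformly_locally_finite Y dY"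
    and supp: "\<forall>x y. y \<notin> Y \<longrightarrow> \<xi> x $$ y = 0"
    and flat_ex: "\<forall>c>0. \<exists>x\<in>X. \<forall>y. cmod (\<xi> x $$ y) < c"
  shows "\<exists>x Z. (\<forall>n. x n \<in> X \<and> finite (Z n) \<and> Z n \<subseteq> Y \<and>
      norm (\<xi> (x n) - cutoff (Z n) (\<xi> (x n))) \<le> (1/2)^(n+2) \<and> (\<forall>y. cmod (\<xi> (x n) $$ y) \<le> (1/2)^(n+2))) \<and>
    (\<forall>m n. m < n \<longrightarrow> (\<forall>z\<in>Z m. \<forall>y\<in>Z n. dY z y > real n))"
proof -
  note \<xi>Y = supp[rule_format] and small = flat_ex[rule_format]
  define \<eta> where "\<eta> n = (1/2::real)^(n+2)" for n
  have \<eta>: "\<eta> n > 0" "\<eta> n \<le> 1/4" for n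
    using power_decreasing[of 2 "n+2" "1/2::real"] by (auto simp: \<eta>_def power2_eq_square)
  define nbhd where "nbhd r U = {y\<in>Y. \<exists>z\<in>U. dY z y \<le> r}" for r U
  have nbhd: "finite (nbhd r U)" if U: "finite U" "U \<subseteq> Y" for r U
  proof -
    obtain N where N: "\<And>x. x \<in> Y \<Longrightarrow> finite {y\<in>Y. dY x y \<le> r}" using ulf_ball_bound[OF Y ulf] by blast
    have "nbhd r U = (\<Union>z\<in>U. {y\<in>Y. dY z y \<le> r})" by (auto simp: nbhd_def)
    then show ?thesis using N U by auto
  qed
  have step: "\<exists>x Z. x \<in> X \<and> finite Z \<and> Z \<subseteq> Y \<and> Z \<inter> V = {} \<and> norm (\<xi> x - cutoff Z (\<xi> x)) \<le> \<eta> n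
      \<and> (\<forall>y. cmod (\<xi> x $$ y) \<le> \<eta> n)" if V: "finite V" for V n
  proof -
    let ?c = "\<eta> n / 2 / (real (card V) + 1)"
    have "?c > 0" using \<eta>(1)[of n] by simp
    then obtain x where x: "x \<in> X" "\<forall>y. cmod (\<xi> x $$ y) < ?c" using small by blast
    have "norm (cutoff V (\<xi> x)) \<le> (\<Sum>y\<in>V. ?c)"
      using x(2) by (intro order_trans[OF norm_cutoff_le_sum[OF V]] sum_mono less_imp_le) auto
    also have "\<dots> = real (card V) * ?c" by simp
    also have "\<dots> \<le> \<eta> n / 2" using \<eta>(1)[of n] by (intro mult_divide_plus_one_le) auto
    finally have cV: "norm (cutoff V (\<xi> x)) \<le> \<eta> n / 2" .
    obtain W where W: "finite W" "norm (\<xi> x - cutoff W (\<xi> x)) < \<eta> n / 2"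
      using cutoff_approx[of "\<eta> n / 2" "\<xi> x"] \<eta>(1)[of n] by (metis half_gt_zero order_refl)
    define Z where "Z = (W \<inter> Y) - V"
    have "\<xi> x - cutoff Z (\<xi> x) = (\<xi> x - cutoff W (\<xi> x)) + cutoff (W \<inter> V) (\<xi> x)"
      by (rule ell2_eqI) (use \<xi>Y[of _ x] in \<open>auto simp: Z_def\<close>)
    then have "norm (\<xi> x - cutoff Z (\<xi> x)) \<le> norm (\<xi> x - cutoff W (\<xi> x)) + norm (cutoff (W \<inter> V) (\<xi> x))"
      by (metis norm_triangle_ineq)
    also have "norm (cutoff (W \<inter> V) (\<xi> x)) \<le> norm (cutoff V (\<xi> x))" by (rule norm_cutoff_mono) auto
    finally have "norm (\<xi> x - cutoff Z (\<xi> x)) \<le> \<eta> n" using W(2) cV by linarith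
    moreover have "?c \<le> \<eta> n"
    proof -
      have "?c \<le> \<eta> n / 2 / 1" using \<eta>(1)[of n] by (intro divide_left_mono) auto
      then show ?thesis using \<eta>(1)[of n] by linarith
    qed
    then have "\<forall>y. cmod (\<xi> x $$ y) \<le> \<eta> n" using x(2) by (meson less_imp_le order_trans)
    ultimately show ?thesis using x(1) W(1) by (intro exI[of _ x] exI[of _ Z]) (auto simp: Z_def)
  qed
  \<comment> \<open>\<open>U\<close> collects all the sets \<open>Z\<close> chosen so far\<close>
  define Q where "Q n = (\<lambda>(x, Z, U). x \<in> X \<and> finite Z \<and> Z \<subseteq> Y \<and> finite U \<and> U \<subseteq> Y \<and> Z \<subseteq> U \<and>
      norm (\<xi> x - cutoff Z (\<xi> x)) \<le> \<eta> n \<and> (\<forall>y. cmod (\<xi> x $$ y) \<le> \<eta> n))" for n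
  have "\<exists>f. \<forall>n. Q n (f n) \<and> (snd (snd (f n)) \<subseteq> snd (snd (f (Suc n))) \<and>
      fst (snd (f (Suc n))) \<inter> nbhd (Suc n) (snd (snd (f n))) = {})"
  proof (rule dependent_nat_choice)
    show "\<exists>s. Q 0 s" using step[of "{}" 0] unfolding Q_def by force
    fix s n assume "Q n s"
    then obtain x Z U where s: "s = (x, Z, U)" "finite U" "U \<subseteq> Y" unfolding Q_def by auto
    obtain x' Z' where "x' \<in> X" "finite Z'" "Z' \<subseteq> Y" "Z' \<inter> nbhd (Suc n) U = {}"
      "norm (\<xi> x' - cutoff Z' (\<xi> x')) \<le> \<eta> (Suc n)" "\<forall>y. cmod (\<xi> x' $$ y) \<le> \<eta> (Suc n)"
      using step[OF nbhd[OF s(2,3)], of "Suc n" "Suc n"] by blast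
    then show "\<exists>y. Q (Suc n) y \<and> snd (snd s) \<subseteq> snd (snd y) \<and> fst (snd y) \<inter> nbhd (Suc n) (snd (snd s)) = {}"
      using s by (intro exI[of _ "(x', Z', U \<union> Z')"]) (auto simp: Q_def)
  qed
  then obtain s where s: "\<And>n. Q n (s n)" "\<And>n. snd (snd (s n)) \<subseteq> snd (snd (s (Suc n)))"
    "\<And>n. fst (snd (s (Suc n))) \<inter> nbhd (Suc n) (snd (snd (s n))) = {}" by blast
  define x Z U where "x n = fst (s n)" and "Z n = fst (snd (s n))" and "U n = snd (snd (s n))" for n
  have x: "x n \<in> X" and Z: "finite (Z n)" "Z n \<subseteq> Y" "Z n \<subseteq> U n"
    and close: "norm (\<xi> (x n) - cutoff (Z n) (\<xi> (x n))) \<le> \<eta> n"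
    and flat: "cmod (\<xi> (x n) $$ y) \<le> \<eta> n" for n y
    using s(1)[of n] by (auto simp: Q_def x_def Z_def U_def split_beta)
  have Umono: "U m \<subseteq> U n" if "m \<le> n" for m n
    using that by (rule lift_Suc_mono_le[rotated]) (use s(2) in \<open>simp add: U_def\<close>)
  have far: "dY z y > n" if mn: "m < n" and "z \<in> Z m" "y \<in> Z n" for m n z y
  proof -
    obtain k where k: "n = Suc k" using mn by (cases n) auto
    have "z \<in> U k" using that Umono[of m k] Z(3)[of m] by (auto simp: k)
    moreover have "y \<in> Y" "y \<notin> nbhd n (U k)"
      using s(3)[of k] that Z(2)[of n] unfolding k by (auto simp: Z_def U_def)
    ultimately show ?thesis by (auto simp: nbhd_def)
  qed
  show ?thesis
    by (intro exI[of _ x] exI[of _ Z] conjI allI impI ballI)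
      (use x Z close flat far in \<open>auto simp: \<eta>_def\<close>)
qed

lemma far_apart_disjoint:
  assumes Y: "Metric_space Y dY" and Z: "\<And>n. Z n \<subseteq> Y"
    and apart: "\<forall>m n. m < n \<longrightarrow> (\<forall>z\<in>Z m. \<forall>y\<in>Z n. dY z y > real n)"
    and "m \<noteq> n"
  shows "Z m \<inter> Z n = {}"
proof -
  have far: "dY z y > real n" if "m < n" "z \<in> Z m" "y \<in> Z n" for m n z y
    using apart that by blast
  have "Z m \<inter> Z n = {}" if mn: "m < n" for m n
  proof (rule ccontr)
    assume "Z m \<inter> Z n \<noteq> {}"
    then obtain y where y: "y \<in> Z m" "y \<in> Z n" by blast
    then have "dY y y > n" "y \<in> Y" using far[OF mn] Z by auto
    then show False using Metric_space.zero[OF Y, of y y] by simp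
  qed
  then show ?thesis using \<open>m \<noteq> n\<close> by (metis Int_commute linorder_neqE_nat)
qed

text \<open>The larger one of two indices bounds the distance from below, and it is at least half of their
sum.\<close>

lemma sparse_UnionI:
  assumes Y: "Metric_space Y dY" and Z: "\<And>n. finite (Z n)" "\<And>n. Z n \<subseteq> Y" "\<And>n. Z n \<noteq> {}"
    and apart: "\<forall>m n. m < n \<longrightarrow> (\<forall>z\<in>Z m. \<forall>y\<in>Z n. dY z y > real n)"
  shows "sparse_space (\<Union>n. Z n) dY"
proof -
  have far: "dY z y > real n" if "m < n" "z \<in> Z m" "y \<in> Z n" for m n z y
    using apart that by blast
  show ?thesis
    unfolding sparse_space_def
  proof (intro exI[of _ Z] conjI allI)
    show "(\<Union>n. Z n) = (\<Union>n. Z n)" by (rule refl)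
    show "disjoint_family Z"
      unfolding disjoint_family_on_def
      by (intro ballI impI far_apart_disjoint[OF Y Z(2) apart])
    show "finite (Z n)" "Z n \<noteq> {}" for n by (rule Z)+
    fix K :: real
    have "set_distance dY (Z n) (Z m) \<ge> ereal K" if nm: "n \<noteq> m" "n + m \<ge> 2 * nat \<lceil>K\<rceil> + 1" for n m
      unfolding set_distance_def
    proof (rule INF_greatest)
      fix p assume "p \<in> Z n \<times> Z m"
      then obtain y z where p: "p = (y, z)" "y \<in> Z n" "z \<in> Z m" by blast
      have "dY y z \<ge> K"
      proof (cases "n < m")
        case True
        have "real m \<ge> K" using nm True by linarith
        then show ?thesis using far[OF True p(2,3)] by linarith
      next
        case False
        then have "m < n" using nm by simp
        moreover have "real n \<ge> K" using nm False by linarith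
        ultimately show ?thesis using far[OF _ p(3,2)] Metric_space.commute[OF Y, of y z] by fastforce
      qed
      then show "(case p of (x, y) \<Rightarrow> ereal (dY x y)) \<ge> ereal K" by (simp add: p)
    qed
    then show "\<exists>N. \<forall>n m. n \<noteq> m \<and> N \<le> n + m \<longrightarrow> ereal K \<le> set_distance dY (Z n) (Z m)" by blast
  qed
qed

text \<open>Suppose that vectors \<open>\<xi>_x\<close> with arbitrarily small coordinates exist, and select \<open>\<xi>_{x_n}\<close> almost
supported on finite sets \<open>Z_n\<close> moving apart. Normalizing the truncations gives orthonormal vectors
\<open>\<zeta>_n\<close>; let \<open>q\<close> be the projection onto their span. It belongs to \<open>C*_u(Y)\<close> because, up to finitely
many rank one operators and a small error, it agrees with the image of a diagonal projection of
\<open>C*_u(X)\<close>. It lives on the sparse space \<open>\<Union> Z_n\<close>, where it is a ghost since the coordinates of \<open>\<zeta>_n\<close>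
tend to zero uniformly, and it is not compact.\<close>

lemma uniformly_large_coordinates:
  fixes X :: "'a set" and Y :: "'b set" and u :: "'a ell2 \<Rightarrow>\<^sub>L 'b ell2"
  assumes X: "Metric_space X dX" and Y: "Metric_space Y dY" and ulf: "uniformly_locally_finite Y dY"
    and u: "clin u" "adj u \<odot> u = cutoff X" "cutoff Y \<odot> u = u" and contr: "norm u \<le> 1"
    and uR: "\<And>a. a \<in> uniform_Roe X dX \<Longrightarrow> u \<odot> a \<odot> adj u \<in> uniform_Roe Y dY"
    and ghosts: "\<And>Z. Z \<subseteq> Y \<Longrightarrow> sparse_space Z dY \<Longrightarrow> only_compact_ghost_projections Z dY"
  shows "\<exists>c>0. \<forall>x\<in>X. \<exists>y\<in>Y. c \<le> cmod (u (ell2_delta x) $$ y)"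
proof (rule ccontr)
  assume neg: "\<not> ?thesis"
  define \<xi> where "\<xi> x = u (ell2_delta x)" for x
  have \<xi>Y: "\<xi> x $$ y = 0" if "y \<notin> Y" for x y
  proof -
    have "\<xi> x = cutoff Y (\<xi> x)" unfolding \<xi>_def using u(3) by (metis blinfun_apply_blinfun_compose)
    then have "\<xi> x $$ y = cutoff Y (\<xi> x) $$ y" by simp
    then show ?thesis using that by simp
  qed
  have small: "\<exists>x\<in>X. \<forall>y. cmod (\<xi> x $$ y) < c" if "c > 0" for c
  proof -
    obtain x where "x \<in> X" "\<forall>y\<in>Y. cmod (u (ell2_delta x) $$ y) < c" using neg \<open>c > 0\<close> by force
    then show ?thesis using \<xi>Y[of _ x] \<open>c > 0\<close> by (intro bexI[of _ x]) (metis \<xi>_def norm_zero)+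
  qed
  have orth: "cinner (\<xi> x) (\<xi> x') = (if x = x' then 1 else 0)" if "x \<in> X" "x' \<in> X" for x x'
  proof -
    have "cinner (\<xi> x) (\<xi> x') = cinner (ell2_delta x) ((adj u \<odot> u) (ell2_delta x'))"
      by (simp add: \<xi>_def cinner_adj_right[OF u(1)] del: cinner_delta_left)
    then show ?thesis unfolding u(2) using that by auto
  qed
  have n\<xi>: "norm (\<xi> x) = 1" if "x \<in> X" for x
    by (rule norm_eq_1I) (simp add: orth[OF that that])
  define \<eta> where "\<eta> n = (1/2::real)^(n+2)" for n
  have \<eta>: "\<eta> n > 0" "\<eta> n \<le> 1/4" for n
    using power_decreasing[of 2 "n+2" "1/2::real"] by (auto simp: \<eta>_def power2_eq_square)
  have "\<forall>x y. y \<notin> Y \<longrightarrow> \<xi> x $$ y = 0" "\<forall>c>0. \<exists>x\<in>X. \<forall>y. cmod (\<xi> x $$ y) < c"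
    using \<xi>Y small by blast+
  from spread_out_vectors_selection[OF Y ulf this]
  obtain x Z where "\<forall>n. x n \<in> X \<and> finite (Z n) \<and> Z n \<subseteq> Y \<and>
      norm (\<xi> (x n) - cutoff (Z n) (\<xi> (x n))) \<le> (1/2)^(n+2) \<and> (\<forall>y. cmod (\<xi> (x n) $$ y) \<le> (1/2)^(n+2))"
    and apart: "\<forall>m n. m < n \<longrightarrow> (\<forall>z\<in>Z m. \<forall>y\<in>Z n. dY z y > real n)"
    by (elim exE conjE) (rule that)
  then have x: "x n \<in> X" and Z: "finite (Z n)" "Z n \<subseteq> Y"
    and close: "norm (\<xi> (x n) - cutoff (Z n) (\<xi> (x n))) \<le> \<eta> n"
    and flat: "cmod (\<xi> (x n) $$ y) \<le> \<eta> n" for n y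
    unfolding \<eta>_def by blast+
  have disj: "Z m \<inter> Z n = {}" if "m \<noteq> n" for m n
    by (rule far_apart_disjoint[OF Y Z(2) apart that])
  define w where "w n = cutoff (Z n) (\<xi> (x n))" for n
  have wclose: "norm (\<xi> (x n) - w n) \<le> \<eta> n" for n using close by (simp add: w_def)
  have w1: "\<bar>1 - norm (w n)\<bar> \<le> \<eta> n" for n
    using norm_triangle_ineq3[of "\<xi> (x n)" "w n"] wclose[of n] n\<xi>[OF x] by simp
  have w_half: "norm (w n) \<ge> 1/2" for n using w1[of n] \<eta>(2)[of n] by linarith
  define \<zeta> where "\<zeta> n = (1 / norm (w n)) *\<^sub>R w n" for n
  have \<zeta>w: "norm (\<xi> (x n) - \<zeta> n) \<le> (1/2)^(n+1)" for n
  proof -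
    have "w n - \<zeta> n = (1 - 1 / norm (w n)) *\<^sub>R w n" by (simp add: \<zeta>_def scaleR_diff_left)
    then have "norm (w n - \<zeta> n) = \<bar>(1 - 1 / norm (w n)) * norm (w n)\<bar>" by (simp add: abs_mult)
    also have "(1 - 1 / norm (w n)) * norm (w n) = norm (w n) - 1"
      using w_half[of n] by (auto simp: left_diff_distrib)
    finally have "norm (w n - \<zeta> n) \<le> \<eta> n" using w1[of n] by simp
    then have "norm (\<xi> (x n) - \<zeta> n) \<le> \<eta> n + \<eta> n"
      using norm_triangle_mono[OF wclose[of n], of "w n - \<zeta> n" "\<eta> n"] by simp
    then show ?thesis by (simp add: \<eta>_def)
  qed
  have \<zeta>cut: "\<zeta> n = cutoff (Z n) (\<zeta> n)" for n
    by (rule ell2_eqI) (simp add: \<zeta>_def w_def)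
  have n\<zeta>: "norm (\<zeta> n) = 1" for n using w_half[of n] by (auto simp: \<zeta>_def)
  have orth\<zeta>: "cinner (\<zeta> m) (\<zeta> n) = (if m = n then 1 else 0)" for m n
  proof (cases "m = n")
    case True
    then show ?thesis by (simp add: cinner_self n\<zeta>)
  next
    case False
    then show ?thesis using cinner_disjoint_cutoffs[OF disj[OF False], of "\<zeta> m" "\<zeta> n"] \<zeta>cut by metis
  qed
  have inj: "inj x"
  proof (rule injI, rule ccontr)
    fix m n assume mn: "x m = x n" "m \<noteq> n"
    have "w m = cutoff (Z m) (\<xi> (x n) - w n)"
      by (rule ell2_eqI) (use disj[OF mn(2)] mn(1) in \<open>auto simp: w_def\<close>)
    then have "norm (w m) \<le> \<eta> n" using norm_cutoff_le[of "Z m"] wclose[of n] by (metis order_trans)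
    then show False using w_half[of m] \<eta>(2)[of n] by linarith
  qed
  obtain u' where u': "clin u'" "\<And>n. u' (ell2_delta n) = \<zeta> n" "adj u' \<odot> u' = cutoff UNIV" "norm u' \<le> 1"
    using orthonormal_isometry[of UNIV \<zeta>] orth\<zeta> by auto
  \<comment> \<open>\<open>u j\<close> maps \<open>\<delta>_n\<close> to \<open>\<xi>_{x_n}\<close>, and \<open>j j*\<close> is the projection onto \<open>{x_n}\<close>\<close>
  obtain j :: "nat ell2 \<Rightarrow>\<^sub>L 'a ell2" where j: "clin j" "\<And>n. j (ell2_delta n) = ell2_delta (x n)" "norm j \<le> 1"
  proof (rule orthonormal_isometry[of UNIV "\<lambda>n. ell2_delta (x n)"])
    show "cinner (ell2_delta (x m)) (ell2_delta (x n)) = (if m = n then 1 else 0)" for m n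
      using inj by (simp add: inj_eq)
  qed auto
  define u'' where "u'' = u \<odot> j"
  have u'': "clin u''" "\<And>n. u'' (ell2_delta n) = \<xi> (x n)"
    using u j by (auto simp: u''_def \<xi>_def)
  have nu'': "norm u'' \<le> 1"
    unfolding u''_def by (rule order_trans[OF norm_compose_contr_left[OF contr] j(3)])
  define q where "q = u' \<odot> adj u'"
  \<comment> \<open>all but finitely many of the \<open>\<zeta>_n\<close> are as close to \<open>\<xi>_{x_n}\<close> as desired\<close>
  have split: "q = (\<Sum>n<k. rank1 (\<zeta> n) (\<zeta> n)) + u' \<odot> cutoff {k..} \<odot> adj u'" for k
  proof (rule blinfun_eqI)
    fix f
    have "adj u' f = cutoff {..<k} (adj u' f) + cutoff {k..} (adj u' f)" by (rule ell2_eqI) auto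
    then have "q f = u' (cutoff {..<k} (adj u' f)) + u' (cutoff {k..} (adj u' f))"
      by (simp add: q_def flip: blinfun.add_right)
    also have "u' (cutoff {..<k} (adj u' f)) = (\<Sum>n<k. rank1 (\<zeta> n) (\<zeta> n)) f"
      using u' by (simp add: cutoff_finite_eq_sum blinfun.sum_right blinfun.sum_left clinD adj_apply)
    finally show "q f = ((\<Sum>n<k. rank1 (\<zeta> n) (\<zeta> n)) + u' \<odot> cutoff {k..} \<odot> adj u') f"
      by (simp add: blinfun.add_left)
  qed
  have jcut: "j \<odot> cutoff S \<odot> adj j = cutoff (x ` S)" for S
  proof (rule blinfun_eq_on_delta)
    fix a
    show "(j \<odot> cutoff S \<odot> adj j) (ell2_delta a) = cutoff (x ` S) (ell2_delta a)"
    proof (cases "a \<in> range x")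
      case True
      then obtain m where m: "a = x m" by blast
      have "adj j (ell2_delta a) = ell2_delta m"
        using j by (intro ell2_eqI) (auto simp: adj_apply m inj_eq[OF inj])
      moreover have "cutoff S (ell2_delta m) = (if m \<in> S then ell2_delta m else 0)" by (rule ell2_eqI) auto
      moreover have "cutoff (x ` S) (ell2_delta a) = (if m \<in> S then ell2_delta a else 0)"
        by (rule ell2_eqI) (auto simp: m inj_eq[OF inj])
      ultimately show ?thesis using j m by simp
    next
      case False
      have "adj j (ell2_delta a) = 0" using j False by (intro ell2_eqI) (auto simp: adj_apply)
      moreover have "cutoff (x ` S) (ell2_delta a) = 0" using False by (intro ell2_eqI) auto
      ultimately show ?thesis by simp
    qed
  qed (use j in auto)
  have ZY: "(\<Union>n. Z n) \<subseteq> Y" using Z by blast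
  have cut\<zeta>: "cutoff (\<Union>n. Z n) (\<zeta> n) = \<zeta> n" for n
  proof -
    have "Z n \<subseteq> (\<Union>n. Z n)" by blast
    then have "cutoff (\<Union>n. Z n) (cutoff (Z n) (\<zeta> n)) = cutoff (Z n) (\<zeta> n)" by (simp only: cutoff_cutoff Int_absorb1)
    then show ?thesis using \<zeta>cut by metis
  qed
  have "cutoff Y (\<zeta> n) = \<zeta> n" for n using cut\<zeta> ZY by (metis cutoff_cutoff inf.absorb2)
  then have rankY: "(\<Sum>n<k. rank1 (\<zeta> n) (\<zeta> n)) \<in> uniform_Roe Y dY" for k
    by (intro uniform_Roe_sum uniform_Roe_rank1[OF Y])
  have tailY: "u'' \<odot> cutoff {k..} \<odot> adj u'' \<in> uniform_Roe Y dY" for k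
  proof -
    have "u'' \<odot> cutoff {k..} \<odot> adj u'' = u \<odot> (j \<odot> cutoff {k..} \<odot> adj j) \<odot> adj u"
      unfolding u''_def adj_compose[OF u(1) j(1)] by (simp only: compose_assoc)
    also have "\<dots> = u \<odot> cutoff (x ` {k..}) \<odot> adj u" by (simp only: jcut)
    finally show ?thesis using uR uniform_Roe_cutoff[OF X] x by (metis image_subsetI)
  qed
  have qY: "q \<in> uniform_Roe Y dY"
    unfolding uniform_Roe_iff
  proof (intro allI impI)
    fix e :: real assume e: "e > 0"
    obtain k where k: "(1/2::real)^k < (e/4)^2"
      using real_arch_pow_inv[of "(e/4)^2" "1/2"] e by auto
    let ?P = "cutoff {k..} :: nat op"
    let ?t = "u' - u''"
    let ?D = "?t \<odot> ?P"
    have "norm ?D \<le> sqrt ((1/2)^k)"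
    proof (rule norm_tail_geometric)
      show "clin ?t" using u' u'' by auto
      show "?t (ell2_delta n) = \<zeta> n - \<xi> (x n)" for n using u' u'' by (simp add: blinfun.diff_left)
      show "norm (\<zeta> n - \<xi> (x n)) \<le> (1/2)^(n+1)" for n using \<zeta>w[of n] by (simp add: norm_minus_commute)
    qed
    also have "\<dots> \<le> e/4" using k e by (metis divide_pos_pos less_imp_le real_sqrt_le_iff real_sqrt_unique zero_less_numeral)
    finally have D: "norm ?D \<le> e/4" .
    have PP: "?P \<odot> ?P = ?P" by (simp add: cutoff_compose)
    \<comment> \<open>telescoping the difference of the two tail projections through \<open>u'' P u'*\<close>\<close>
    have "?D \<odot> adj u' + u'' \<odot> adj ?D = u' \<odot> ?P \<odot> adj u' - u'' \<odot> ?P \<odot> adj u''"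
      using u' u'' by (simp add: adj_compose adj_diff compose_diff_left compose_diff_right compose_assoc)
    moreover have "norm (?D \<odot> adj u' + u'' \<odot> adj ?D) \<le> norm ?D + norm (adj ?D)"
      using u' u'' nu'' by (intro norm_triangle_mono norm_compose_contr_left norm_compose_contr_right) auto
    moreover have "norm (adj ?D) = norm ?D" using u' u'' by (intro norm_adj) auto
    ultimately have diff: "norm (u' \<odot> ?P \<odot> adj u' - u'' \<odot> ?P \<odot> adj u'') \<le> e/2" using D by simp
    let ?a = "(\<Sum>n<k. rank1 (\<zeta> n) (\<zeta> n)) + u'' \<odot> ?P \<odot> adj u''"
    have "?a \<in> uniform_Roe Y dY" by (intro uniform_Roe_add rankY tailY)
    then obtain r b where b: "prop_le Y dY r b" "norm (?a - b) \<le> e/2"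
      using e unfolding uniform_Roe_iff by (meson half_gt_zero)
    have eq: "q - b = (u' \<odot> ?P \<odot> adj u' - u'' \<odot> ?P \<odot> adj u'') + (?a - b)" by (simp add: split[of k])
    have "norm (q - b) \<le> e"
      unfolding eq by (rule order_trans[OF norm_triangle_mono[OF diff b(2)]]) simp
    then show "\<exists>r b. prop_le Y dY r b \<and> norm (q - b) \<le> e" using b(1) by auto
  qed
  define ZZ where "ZZ = (\<Union>n. Z n)"
  have Zu': "cutoff ZZ \<odot> u' = u'"
    by (rule blinfun_eq_on_delta) (use u' cut\<zeta> in \<open>auto simp: ZZ_def\<close>)
  then have u'Z: "adj u' \<odot> cutoff ZZ = adj u'"
    using u' by (metis adj_compose adj_cutoff clin_cutoff)
  have qZ: "q \<in> uniform_Roe ZZ dY"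
  proof (rule uniform_Roe_subspace[OF _ qY])
    show "ZZ \<subseteq> Y" using ZY by (simp add: ZZ_def)
    show "cutoff ZZ \<odot> q \<odot> cutoff ZZ = q"
      unfolding q_def compose_assoc u'Z by (simp only: compose_assoc[symmetric] Zu')
  qed
  have proj: "projection_op q"
  proof -
    have id: "cutoff UNIV \<odot> a = a" for a :: "'c ell2 \<Rightarrow>\<^sub>L nat ell2" by (intro blinfun_eqI ell2_eqI) simp
    have "q \<odot> q = u' \<odot> ((adj u' \<odot> u') \<odot> adj u')" unfolding q_def by (simp only: compose_assoc)
    then have "q \<odot> q = q" unfolding u'(3) id by (simp add: q_def)
    moreover have "op_adjoint q = q" using u' by (simp add: q_def op_adjoint_eq_adj adj_compose)
    ultimately show ?thesis by (simp add: projection_op_def)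
  qed
  have ghost: "ghost ZZ q"
    unfolding ghost_def
  proof (intro allI impI)
    fix e :: real assume e: "e > 0"
    obtain k where k: "(1/2::real)^k < e" using real_arch_pow_inv[OF e, of "1/2"] by auto
    have "cmod (matrix_coeff q y z) < e" if y: "y \<in> ZZ - (\<Union>n<k. Z n)" for y z
    proof -
      obtain m where m: "y \<in> Z m" "m \<ge> k" using y unfolding ZZ_def by (metis DiffE UN_E UN_I lessThan_iff not_le)
      have z0: "\<zeta> n $$ y = 0" if "n \<noteq> m" for n
      proof -
        have "y \<notin> Z n" using disj[OF that] m by blast
        then show ?thesis using arg_cong[OF \<zeta>cut[of n], of "\<lambda>f. f $$ y"] by simp
      qed
      have "adj u' (ell2_delta y) = ell2_scaleC (cnj (\<zeta> m $$ y)) (ell2_delta m)"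
        using u' z0 by (intro ell2_eqI) (auto simp: adj_apply)
      then have "q (ell2_delta y) = ell2_scaleC (cnj (\<zeta> m $$ y)) (\<zeta> m)"
        using u' by (simp add: q_def clinD)
      then have "cmod (matrix_coeff q y z) = cmod (\<zeta> m $$ y) * cmod (\<zeta> m $$ z)"
        by (simp add: norm_mult)
      also have "\<dots> \<le> cmod (\<zeta> m $$ y) * 1"
        using cmod_le_norm[of "\<zeta> m" z] by (intro mult_left_mono) (auto simp: n\<zeta>)
      also have "cmod (\<zeta> m $$ y) = cmod (\<xi> (x m) $$ y) / norm (w m)"
        using m(1) by (simp add: \<zeta>_def w_def)
      also have "\<dots> * 1 \<le> \<eta> m / (1/2)"
        using w_half[of m] flat[of m y] less_imp_le[OF \<eta>(1)[of m]]
        by (simp only: mult_1_right) (intro frac_le, auto)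
      also have "\<dots> \<le> (1/2)^k" using power_decreasing[of k "m+1" "1/2::real"] m(2) by (simp add: \<eta>_def)
      finally show ?thesis using k by linarith
    qed
    then show "\<exists>A. finite A \<and> A \<subseteq> ZZ \<and> (\<forall>x\<in>ZZ - A. \<forall>y\<in>ZZ - A. cmod (matrix_coeff q x y) < e)"
      using Z(1) by (intro exI[of _ "\<Union>n<k. Z n"]) (auto simp: ZZ_def)
  qed
  have "Z n \<noteq> {}" for n
  proof
    assume "Z n = {}"
    then have "w n = 0" unfolding w_def by (intro ell2_eqI) auto
    then show False using w_half[of n] by simp
  qed
  then have sparse: "sparse_space ZZ dY"
    unfolding ZZ_def using sparse_UnionI[OF Y Z _ apart] by blast
  have "compact_op q"
    using ghosts[OF _ sparse] ZY qZ proj ghost unfolding only_compact_ghost_projections_def ZZ_def by blast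
  moreover have "q (\<zeta> n) = \<zeta> n" for n
  proof -
    have "q (\<zeta> n) = u' ((adj u' \<odot> u') (ell2_delta n))" unfolding q_def u'(2)[symmetric] by simp
    also have "(adj u' \<odot> u') (ell2_delta n) = ell2_delta n" unfolding u'(3) by (rule ell2_eqI) simp
    finally show ?thesis using u' by simp
  qed
  ultimately show False using compact_op_orthonormal_fixed[OF orth\<zeta>] by blast
qed

section \<open>Large columns contain large coordinates\<close>

text \<open>The average over all signs of the squared norm of a signed sum is the sum of the squared norms; a
greedy choice does as well as the average.\<close>

lemma balanced_signs:
  fixes v :: "'a \<Rightarrow> 'b::real_inner"
  assumes "finite F"
  shows "\<exists>A\<subseteq>F. (norm ((\<Sum>x\<in>A. v x) - (\<Sum>x\<in>F - A. v x)))^2 \<le> (\<Sum>x\<in>F. (norm (v x))^2)"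
  using assms
proof (induction F rule: finite_induct)
  case (insert x F)
  then obtain A where A: "A \<subseteq> F"
    "(norm ((\<Sum>x\<in>A. v x) - (\<Sum>x\<in>F - A. v x)))^2 \<le> (\<Sum>x\<in>F. (norm (v x))^2)" by blast
  let ?S = "(\<Sum>x\<in>A. v x) - (\<Sum>x\<in>F - A. v x)"
  have xA: "x \<notin> A" "finite A" using insert A by (auto intro: finite_subset)
  have sum: "(\<Sum>x\<in>insert x F. (norm (v x))^2) = (norm (v x))^2 + (\<Sum>x\<in>F. (norm (v x))^2)"
    using insert by simp
  show ?case
  proof (cases "?S \<bullet> v x \<le> 0")
    case True
    have "insert x F - insert x A = F - A" using insert by auto
    then have "(\<Sum>x\<in>insert x A. v x) - (\<Sum>x\<in>insert x F - insert x A. v x) = ?S + v x"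
      using xA by simp
    moreover have "(norm (?S + v x))^2 \<le> (norm ?S)^2 + (norm (v x))^2"
      using True unfolding power2_norm_eq_inner by (simp add: inner_add_left inner_add_right inner_commute)
    ultimately show ?thesis
      using A sum by (intro exI[of _ "insert x A"]) auto
  next
    case False
    have "insert x F - A = insert x (F - A)" using xA by auto
    then have eq: "(\<Sum>x\<in>A. v x) - (\<Sum>x\<in>insert x F - A. v x) = ?S - v x"
      using xA insert by simp
    have le: "(norm (?S - v x))^2 \<le> (norm ?S)^2 + (norm (v x))^2"
    proof -
      have "(norm (?S - v x))^2 = (norm ?S)^2 + (norm (v x))^2 - 2 * (?S \<bullet> v x)"
        unfolding power2_norm_eq_inner by (simp add: inner_diff_left inner_diff_right inner_commute)
      then show ?thesis using False by linarith
    qed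
    show ?thesis
    proof (intro exI[of _ A] conjI)
      show "(norm ((\<Sum>x\<in>A. v x) - (\<Sum>x\<in>insert x F - A. v x)))^2 \<le> (\<Sum>x\<in>insert x F. (norm (v x))^2)"
        unfolding eq sum using le A(2) by linarith
    qed (use A in auto)
  qed
qed auto

lemma isometric_on:
  assumes u: "clin u" "adj u \<odot> u = cutoff X" and f: "cutoff X f = f"
  shows "norm (u f) = norm f"
proof -
  have "cinner (u f) (u f) = cinner f ((adj u \<odot> u) f)" using cinner_adj_right[OF u(1), of f "u f"] by simp
  also have "\<dots> = cinner f f" unfolding u(2) f ..
  finally have "(norm (u f))^2 = (norm f)^2" unfolding cinner_self of_real_eq_iff .
  then show ?thesis by (rule power2_eq_imp_eq) auto
qed

text \<open>Put \<open>g = u* \<delta>_y\<close>, so that \<open>g(x)\<close> is the conjugate of \<open>\<xi>_x(y)\<close>. Changing the signs of the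
coordinates of \<open>g\<close> on \<open>F\<close> does not change the norm of the image \<open>u \<chi>_F g\<close>. By uniform
approximation the image stays concentrated on a ball around \<open>y\<close> whose size depends only on \<open>c\<close>.
Within this ball, signs can be balanced such that the squared norm is at most
\<open>\<Sum> |g(x)|^2 |\<chi> \<xi>_x|^2\<close>, where \<open>\<chi>\<close> restricts to the ball; this is at most the largest \<open>|g(x)|^2\<close>
times the number of points of the ball. Hence some \<open>|g(x)|\<close> is bounded below.\<close>

lemma large_column_large_coordinate:
  fixes X :: "'a set" and Y :: "'b set" and u :: "'a ell2 \<Rightarrow>\<^sub>L 'b ell2"
  assumes X: "Metric_space X dX" and ulfX: "uniformly_locally_finite X dX"
    and Y: "Metric_space Y dY" and ulfY: "uniformly_locally_finite Y dY"
    and u: "clin u" "norm u \<le> 1" "adj u \<odot> u = cutoff X"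
    and uR: "\<And>a. a \<in> uniform_Roe X dX \<Longrightarrow> u \<odot> a \<odot> adj u \<in> uniform_Roe Y dY"
    and c: "c > 0"
  shows "\<exists>\<delta>>0. \<forall>F y. finite F \<and> F \<subseteq> X \<and> y \<in> Y \<and> c \<le> norm ((u \<odot> cutoff F \<odot> adj u) (ell2_delta y)) \<longrightarrow>
     (\<exists>x\<in>F. \<delta> \<le> cmod (u (ell2_delta x) $$ y))"
proof -
  define \<xi> where "\<xi> x = u (ell2_delta x)" for x
  have "c/8 > 0" using c by simp
  from equi_approx[OF X ulfX u(1,2) uR this, where r=0]
  obtain s where s: "\<And>E. finite E \<Longrightarrow> E \<subseteq> entourage X dX 0 \<Longrightarrow> approx Y dY s (c/8) (u \<odot> rel_op E \<odot> adj u)"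
    by blast
  have sA: "approx Y dY s (c/8) (u \<odot> cutoff A \<odot> adj u)" if "finite A" "A \<subseteq> X" for A
  proof -
    have "finite (Id_on A)" using that by (simp add: Id_on_def)
    moreover have "Id_on A \<subseteq> entourage X dX 0"
      using that Metric_space.mdist_zero[OF X] by (auto simp: entourage_def)
    ultimately show ?thesis using s by (metis rel_op_Id_on)
  qed
  obtain N where N: "\<And>y. y \<in> Y \<Longrightarrow> finite {z\<in>Y. dY y z \<le> s}" "\<And>y. y \<in> Y \<Longrightarrow> card {z\<in>Y. dY y z \<le> s} \<le> N"
    using ulf_ball_bound[OF Y ulfY] by blast
  define \<delta> where "\<delta> = c / 2 / (real N + 1)"
  have \<delta>: "\<delta> > 0" using c by (simp add: \<delta>_def)
  have \<delta>N: "\<delta> * (real N + 1) = c/2"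
  proof -
    have "real N + 1 > 0" by simp
    then show ?thesis by (metis \<delta>_def nonzero_eq_divide_eq less_irrefl)
  qed
  have "\<exists>x\<in>F. \<delta> \<le> cmod (\<xi> x $$ y)"
    if F: "finite F" "F \<subseteq> X" and y: "y \<in> Y" and big: "c \<le> norm ((u \<odot> cutoff F \<odot> adj u) (ell2_delta y))" for F y
  proof (rule ccontr)
    assume "\<not> ?thesis"
    then have small: "cmod (\<xi> x $$ y) < \<delta>" if "x \<in> F" for x using that by (meson not_le)
    define Bl where "Bl = {z\<in>Y. dY y z \<le> s}"
    have Bl: "finite Bl" "card Bl \<le> N" using N[OF y] by (auto simp: Bl_def)
    define g where "g = adj u (ell2_delta y)"
    have gx: "g $$ x = cnj (\<xi> x $$ y)" for x
      using u(1) by (simp add: g_def adj_apply \<xi>_def)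
    define v where "v x = cutoff Bl (ell2_scaleC (g $$ x) (\<xi> x))" for x
    obtain A where A: "A \<subseteq> F"
      "(norm ((\<Sum>x\<in>A. v x) - (\<Sum>x\<in>F - A. v x)))^2 \<le> (\<Sum>x\<in>F. (norm (v x))^2)"
      using balanced_signs[OF F(1)] by blast
    have fin: "finite A" "finite (F - A)" "A \<subseteq> X" "F - A \<subseteq> X" using A(1) F by (auto intro: finite_subset)
    \<comment> \<open>the image of the diagonal operator with the balanced signs\<close>
    define D where "D = u \<odot> cutoff A \<odot> adj u - u \<odot> cutoff (F - A) \<odot> adj u"
    have vsum: "cutoff Bl ((u \<odot> cutoff K \<odot> adj u) (ell2_delta y)) = (\<Sum>x\<in>K. v x)" if "finite K" for K
      using that u(1)
      by (simp add: cutoff_finite_eq_sum[OF that] blinfun.sum_right clinD v_def \<xi>_def flip: g_def)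
    have "cutoff Bl (D (ell2_delta y)) = (\<Sum>x\<in>A. v x) - (\<Sum>x\<in>F - A. v x)"
      using vsum[OF fin(1)] vsum[OF fin(2)] by (simp add: D_def blinfun.diff_left blinfun.diff_right)
    then have "(norm (cutoff Bl (D (ell2_delta y))))^2 \<le> (\<Sum>x\<in>F. (norm (v x))^2)" using A(2) by simp
    also have "\<dots> \<le> (\<Sum>x\<in>F. \<delta>^2 * (\<Sum>z\<in>Bl. (cmod (\<xi> x $$ z))^2))"
    proof (rule sum_mono)
      fix x assume x: "x \<in> F"
      have "v x = ell2_scaleC (g $$ x) (cutoff Bl (\<xi> x))" by (simp add: v_def clinD)
      then have "(norm (v x))^2 = (cmod (\<xi> x $$ y))^2 * (\<Sum>z\<in>Bl. (cmod (\<xi> x $$ z))^2)"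
        by (simp add: norm_ell2_scaleC power_mult_distrib gx norm_sq_finite_cutoff[OF Bl(1)])
      also have "\<dots> \<le> \<delta>^2 * (\<Sum>z\<in>Bl. (cmod (\<xi> x $$ z))^2)"
        using small[OF x] by (intro mult_right_mono power_mono sum_nonneg) auto
      finally show "(norm (v x))^2 \<le> \<delta>^2 * (\<Sum>z\<in>Bl. (cmod (\<xi> x $$ z))^2)" .
    qed
    also have "\<dots> = \<delta>^2 * (\<Sum>z\<in>Bl. \<Sum>x\<in>F. (cmod (\<xi> x $$ z))^2)"
      by (subst sum.swap) (simp add: sum_distrib_left)
    also have "\<dots> \<le> \<delta>^2 * (\<Sum>z\<in>Bl. 1)"
    proof (intro mult_left_mono sum_mono)
      fix z
      have "(\<Sum>x\<in>F. (cmod (\<xi> x $$ z))^2) = (\<Sum>x\<in>F. (cmod (adj u (ell2_delta z) $$ x))^2)"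
        using u(1) by (simp add: adj_apply \<xi>_def)
      also have "\<dots> \<le> (norm (adj u (ell2_delta z)))^2" by (rule sum_sq_le_norm)
      also have "\<dots> \<le> 1^2"
        using norm_blinfun[of "adj u" "ell2_delta z"] u(1,2) by (intro power_mono) auto
      finally show "(\<Sum>x\<in>F. (cmod (\<xi> x $$ z))^2) \<le> 1" by simp
    qed auto
    also have "\<dots> \<le> \<delta>^2 * (real N + 1)^2"
    proof (intro mult_left_mono)
      have "real (card Bl) \<le> real N + 1" using Bl(2) by simp
      also have "\<dots> \<le> (real N + 1)^2" by (simp add: power2_eq_square)
      finally show "(\<Sum>z\<in>Bl. 1) \<le> (real N + 1)^2" by simp
    qed auto
    also have "\<dots> = (c/2)^2" unfolding power_mult_distrib[symmetric] \<delta>N ..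
    finally have in_ball: "norm (cutoff Bl (D (ell2_delta y))) \<le> c/2"
      by (rule power2_le_imp_le) (use c in simp)
    obtain b1 where b1: "prop_le Y dY s b1" "norm (u \<odot> cutoff A \<odot> adj u - b1) \<le> c/8"
      using sA[OF fin(1,3)] by (auto simp: approx_def)
    obtain b2 where b2: "prop_le Y dY s b2" "norm (u \<odot> cutoff (F - A) \<odot> adj u - b2) \<le> c/8"
      using sA[OF fin(2,4)] by (auto simp: approx_def)
    have b0: "cutoff (- Bl) (b (ell2_delta y)) = 0" if b: "prop_le Y dY s b" for b
    proof (rule ell2_eqI)
      fix z show "cutoff (- Bl) (b (ell2_delta y)) $$ z = 0 $$ z"
        using b y bounded_ops_apply_outside[of b Y z "ell2_delta y"]
        by (cases "z \<in> Y") (auto simp: prop_le_def Bl_def)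
    qed
    have "cutoff (- Bl) (D (ell2_delta y)) = cutoff (- Bl)
        (((u \<odot> cutoff A \<odot> adj u - b1) - (u \<odot> cutoff (F - A) \<odot> adj u - b2)) (ell2_delta y))"
      using b0[OF b1(1)] b0[OF b2(1)] by (simp add: D_def blinfun.diff_left blinfun.diff_right)
    also have "norm \<dots> \<le> norm (((u \<odot> cutoff A \<odot> adj u - b1) - (u \<odot> cutoff (F - A) \<odot> adj u - b2)) (ell2_delta y))"
      by (rule norm_cutoff_le)
    also have "\<dots> \<le> norm ((u \<odot> cutoff A \<odot> adj u - b1) - (u \<odot> cutoff (F - A) \<odot> adj u - b2)) * norm (ell2_delta y)"
      by (rule norm_blinfun)
    also have "\<dots> \<le> c/8 + c/8"
      using order_trans[OF norm_triangle_ineq4 add_mono[OF b1(2) b2(2)]] by simp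
    finally have out_ball: "norm (cutoff (- Bl) (D (ell2_delta y))) \<le> c/8 + c/8" .
    have "D (ell2_delta y) = cutoff Bl (D (ell2_delta y)) + cutoff (- Bl) (D (ell2_delta y))"
      by (rule ell2_eqI) auto
    then have Dle: "norm (D (ell2_delta y)) \<le> c/2 + (c/8 + c/8)"
      using norm_triangle_mono[OF in_ball out_ball] by simp
    have "norm ((u \<odot> cutoff F \<odot> adj u) (ell2_delta y)) \<le> norm u * norm (cutoff F g)"
      using norm_blinfun[of u "cutoff F g"] by (simp add: g_def)
    also have "\<dots> \<le> 1 * norm (cutoff F g)" using u(2) by (intro mult_right_mono) auto
    also have "norm (cutoff F g) = norm (cutoff A g - cutoff (F - A) g)"
    proof -
      have "(norm (cutoff F g))^2 = (norm (cutoff A g - cutoff (F - A) g))^2"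
        by (subst (1 2) norm_sq_supported[OF F(1)]) (use A(1) in \<open>auto intro!: sum.cong\<close>)
      then show ?thesis by (rule power2_eq_imp_eq) auto
    qed
    also have "\<dots> = norm (u (cutoff A g - cutoff (F - A) g))"
      by (rule isometric_on[OF u(1,3), symmetric]) (rule ell2_eqI, use fin in auto)
    also have "u (cutoff A g - cutoff (F - A) g) = D (ell2_delta y)"
      by (simp add: D_def g_def blinfun.diff_left blinfun.diff_right)
    finally have "norm ((u \<odot> cutoff F \<odot> adj u) (ell2_delta y)) \<le> norm (D (ell2_delta y))" by simp
    then show False using big Dle c by linarith
  qed
  then show ?thesis using \<delta> by (intro exI[of _ \<delta>]) (auto simp: \<xi>_def)
qed

section \<open>Localization from property A\<close>

text \<open>Gaussian elimination, by induction on the number of equations.\<close>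

lemma nontrivial_kernel:
  fixes M :: "'a \<Rightarrow> 'b \<Rightarrow> complex"
  assumes "finite K" "finite F" "card K < card F"
  shows "\<exists>a. (\<exists>x\<in>F. a x \<noteq> 0) \<and> (\<forall>y\<in>K. (\<Sum>x\<in>F. a x * M x y) = 0)"
  using assms
proof (induction K arbitrary: F M rule: finite_induct)
  case empty
  then have "F \<noteq> {}" by auto
  then show ?case by (intro exI[of _ "\<lambda>_. 1"]) auto
next
  case (insert y K)
  show ?case
  proof (cases "\<forall>x\<in>F. M x y = 0")
    case True
    obtain a where "\<exists>x\<in>F. a x \<noteq> 0" "\<forall>y\<in>K. (\<Sum>x\<in>F. a x * M x y) = 0"
      using insert.IH[of F M] insert.prems insert.hyps by auto
    then show ?thesis using True by (intro exI[of _ a]) auto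
  next
    case False
    then obtain x0 where x0: "x0 \<in> F" "M x0 y \<noteq> 0" by blast
    define F' where "F' = F - {x0}"
    have F': "finite F'" "F = insert x0 F'" "x0 \<notin> F'" using insert x0 by (auto simp: F'_def)
    have "card K < card F'" using insert F' by simp
    from insert.IH[OF F'(1) this, of "\<lambda>x z. M x z - M x y / M x0 y * M x0 z"]
    obtain a where a: "\<exists>x\<in>F'. a x \<noteq> 0"
      "\<forall>z\<in>K. (\<Sum>x\<in>F'. a x * (M x z - M x y / M x0 y * M x0 z)) = 0" by blast
    define t where "t = - (\<Sum>x\<in>F'. a x * M x y) / M x0 y"
    define a' where "a' = a(x0 := t)"
    have a'F: "(\<Sum>x\<in>F. a' x * M x z) = t * M x0 z + (\<Sum>x\<in>F'. a x * M x z)" for z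
    proof -
      have "(\<Sum>x\<in>F'. a' x * M x z) = (\<Sum>x\<in>F'. a x * M x z)"
        using F'(3) by (intro sum.cong) (auto simp: a'_def)
      then show ?thesis using F' by (simp add: a'_def)
    qed
    have "(\<Sum>x\<in>F. a' x * M x y) = 0" unfolding a'F using x0 by (simp add: t_def)
    moreover have "(\<Sum>x\<in>F. a' x * M x z) = 0" if "z \<in> K" for z
    proof -
      have "t * M x0 z = - (\<Sum>x\<in>F'. a x * (M x y / M x0 y * M x0 z))"
        by (simp add: t_def sum_distrib_right sum_divide_distrib mult.assoc)
      then have "(\<Sum>x\<in>F. a' x * M x z) = (\<Sum>x\<in>F'. a x * (M x z - M x y / M x0 y * M x0 z))"
        unfolding a'F by (simp add: right_diff_distrib sum_subtractf)
      then show ?thesis using a(2) that by simp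
    qed
    moreover have "\<exists>x\<in>F. a' x \<noteq> 0" using a(1) F' by (auto simp: a'_def)
    ultimately show ?thesis by blast
  qed
qed

text \<open>Let \<open>\<theta>_i(x)\<close> be the \<open>i\<close>-th coordinate of the normalized indicator function of the set \<open>A_x\<close> in
\<open>\<ell>_2(Y \<times> nat)\<close>. These are unit vectors, and two of them are close if \<open>A_x\<close> and \<open>A_y\<close> are: with
\<open>m = |A_x \<inter> A_y|\<close> both sets have at most \<open>(1 + e) m\<close> elements, so the inner product is at least
\<open>1/(1 + e)\<close>.\<close>

lemma property_A_partition:
  assumes A: "property_A Y d" and e: "e > 0"
  obtains R and I :: "'a \<Rightarrow> ('a \<times> nat) set" and \<theta> :: "('a \<times> nat) \<Rightarrow> 'a \<Rightarrow> real" where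
    "\<And>x. x \<in> Y \<Longrightarrow> finite (I x)"
    "\<And>x i. x \<in> Y \<Longrightarrow> i \<notin> I x \<Longrightarrow> \<theta> i x = 0"
    "\<And>x J. x \<in> Y \<Longrightarrow> finite J \<Longrightarrow> I x \<subseteq> J \<Longrightarrow> (\<Sum>i\<in>J. (\<theta> i x)^2) = 1"
    "\<And>x y J. x \<in> Y \<Longrightarrow> y \<in> Y \<Longrightarrow> d x y \<le> t \<Longrightarrow> finite J \<Longrightarrow> I x \<subseteq> J \<Longrightarrow> I y \<subseteq> J \<Longrightarrow>
       (\<Sum>i\<in>J. (\<theta> i x - \<theta> i y)^2) \<le> 2 * e"
    "\<And>x i. x \<in> Y \<Longrightarrow> i \<in> I x \<Longrightarrow> fst i \<in> Y \<and> d (fst i) x \<le> R"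
proof -
  have t1: "max t 1 > 0" by simp
  from A[unfolded property_A_def, THEN spec, THEN mp, OF t1, THEN spec, THEN mp, OF e] show thesis
  proof (elim exE conjE)
    fix R and A :: "'a \<Rightarrow> ('a \<times> nat) set"
    assume RA: "R > 0"
      "\<forall>x\<in>Y. finite (A x) \<and> A x \<subseteq> Y \<times> UNIV \<and> (x, 1) \<in> A x"
      "\<forall>x\<in>Y. \<forall>y\<in>Y. d x y \<le> max t 1 \<longrightarrow> A x \<inter> A y \<noteq> {} \<and>
          real (card (sym_diff (A x) (A y))) / real (card (A x \<inter> A y)) < e"
      "\<forall>x\<in>Y. \<forall>y z m n. (y, m) \<in> A x \<and> (z, n) \<in> A x \<longrightarrow> d y z \<le> R"
    have fin: "finite (A x)" and self: "(x, 1) \<in> A x" if "x \<in> Y" for x using RA(2) that by auto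
    define \<theta> where "\<theta> i x = (if i \<in> A x then 1 / sqrt (real (card (A x))) else 0)" for i x
    have cpos: "card (A x) > 0" if "x \<in> Y" for x using fin[OF that] self[OF that] card_gt_0_iff by blast
    have one: "(\<Sum>i\<in>J. (\<theta> i x)^2) = 1" if "x \<in> Y" "finite J" "A x \<subseteq> J" for x J
    proof -
      have "(\<Sum>i\<in>J. (\<theta> i x)^2) = (\<Sum>i\<in>A x. (\<theta> i x)^2)"
        by (rule sum.mono_neutral_right) (use that in \<open>auto simp: \<theta>_def\<close>)
      also have "\<dots> = (\<Sum>i\<in>A x. 1 / real (card (A x)))"
        by (rule sum.cong) (auto simp: \<theta>_def power_divide)
      also have "\<dots> = 1" using cpos[OF that(1)] by simp
      finally show ?thesis .
    qed
    show thesis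
    proof (rule that[of A \<theta> R])
      show "finite (A x)" if "x \<in> Y" for x by (rule fin[OF that])
      show "\<theta> i x = 0" if "i \<notin> A x" for x i using that by (simp add: \<theta>_def)
      show "(\<Sum>i\<in>J. (\<theta> i x)^2) = 1" if "x \<in> Y" "finite J" "A x \<subseteq> J" for x J by (rule one[OF that])
      show "fst i \<in> Y \<and> d (fst i) x \<le> R" if "x \<in> Y" "i \<in> A x" for x i
      proof -
        obtain a n where i: "i = (a, n)" by fastforce
        then have "(a, n) \<in> A x" using that by simp
        then show ?thesis using RA(2,4) that(1) self[OF that(1)] unfolding i fst_conv by blast
      qed
      fix x y J assume xy: "x \<in> Y" "y \<in> Y" "d x y \<le> t" and J: "finite J" "A x \<subseteq> J" "A y \<subseteq> J"
      define m where "m = real (card (A x \<inter> A y))"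
      define k l where "k = real (card (A x))" and "l = real (card (A y))"
      have "A x \<inter> A y \<noteq> {}" and q: "real (card (sym_diff (A x) (A y))) / m < e"
        using RA(3) xy by (auto simp: m_def)
      then have m: "m > 0" using fin[OF xy(1)] by (simp add: m_def card_gt_0_iff)
      have D: "real (card (sym_diff (A x) (A y))) \<le> e * m" using q m by (simp add: divide_simps split: if_splits)
      have le: "real (card B) \<le> m * (1 + e)"
        if "B \<subseteq> (A x \<inter> A y) \<union> sym_diff (A x) (A y)" for B
      proof -
        have "card B \<le> card ((A x \<inter> A y) \<union> sym_diff (A x) (A y))"
          using that fin xy by (intro card_mono) auto
        also have "\<dots> \<le> card (A x \<inter> A y) + card (sym_diff (A x) (A y))" by (rule card_Un_le)
        finally show ?thesis using D by (simp add: m_def algebra_simps)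
      qed
      have kl: "k \<le> m * (1 + e)" "l \<le> m * (1 + e)" "k > 0" "l > 0"
        using le[of "A x"] le[of "A y"] cpos xy by (auto simp: k_def l_def)
      have "(sqrt k * sqrt l)^2 \<le> (m * (1 + e))^2"
        using kl m e mult_mono[OF kl(1,2)] by (simp add: power_mult_distrib) (simp add: power2_eq_square mult_ac)
      then have s: "sqrt k * sqrt l \<le> m * (1 + e)"
        by (rule power2_le_imp_le) (use m e in auto)
      have cross: "(\<Sum>i\<in>J. \<theta> i x * \<theta> i y) = m / (sqrt k * sqrt l)"
      proof -
        have "(\<Sum>i\<in>J. \<theta> i x * \<theta> i y) = (\<Sum>i\<in>A x \<inter> A y. \<theta> i x * \<theta> i y)"
          by (rule sum.mono_neutral_right) (use J in \<open>auto simp: \<theta>_def\<close>)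
        also have "\<dots> = (\<Sum>i\<in>A x \<inter> A y. 1 / (sqrt k * sqrt l))"
          by (rule sum.cong) (auto simp: \<theta>_def k_def l_def)
        finally show ?thesis by (simp add: m_def)
      qed
      have "1 - e \<le> m / (sqrt k * sqrt l)"
      proof -
        have "(1 - e) * (1 + e) \<le> 1" using zero_le_power2[of e] by (simp add: algebra_simps power2_eq_square)
        then have "1 - e \<le> 1 / (1 + e)" using e by (simp add: pos_le_divide_eq)
        also have "\<dots> = m / (m * (1 + e))" using m by simp
        also have "\<dots> \<le> m / (sqrt k * sqrt l)" using s m kl by (intro divide_left_mono) auto
        finally show ?thesis .
      qed
      moreover have "(\<Sum>i\<in>J. (\<theta> i x - \<theta> i y)^2) = (\<Sum>i\<in>J. (\<theta> i x)^2) + (\<Sum>i\<in>J. (\<theta> i y)^2) - 2 * (\<Sum>i\<in>J. \<theta> i x * \<theta> i y)"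
        by (simp add: power2_diff sum.distrib sum_subtractf sum_distrib_left mult.assoc)
      ultimately show "(\<Sum>i\<in>J. (\<theta> i x - \<theta> i y)^2) \<le> 2 * e"
        using one[OF xy(1) J(1,2)] one[OF xy(2) J(1,3)] cross by simp
    qed
  qed
qed

lemma norm_sum3_sq_le:
  fixes a b c :: "'a::real_inner"
  shows "(norm (a + b + c))^2 \<le> 3 * ((norm a)^2 + (norm b)^2 + (norm c)^2)"
proof -
  have "norm (a + b + c) \<le> norm a + norm b + norm c"
    by (meson norm_triangle_ineq norm_triangle_mono order_refl)
  then have "(norm (a + b + c))^2 \<le> (norm a + norm b + norm c)^2" by (intro power_mono) auto
  also have "\<dots> \<le> 3 * ((norm a)^2 + (norm b)^2 + (norm c)^2)"
    using sum_squares_bound[of "norm a" "norm b"] sum_squares_bound[of "norm a" "norm c"]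
      sum_squares_bound[of "norm b" "norm c"]
    by (simp add: power2_eq_square algebra_simps)
  finally show ?thesis .
qed

text \<open>Multiply \<open>v\<close> by the functions \<open>\<theta>_i\<close> of a partition as above. The squared norms of the pieces
\<open>w_i = \<theta>_i v\<close> add up to that of \<open>v\<close>, and so do, up to a small multiple, the squared norms of
\<open>w_i - q w_i\<close>: replacing \<open>q\<close> by \<open>b\<close>, the only difference between \<open>b (\<theta>_i v)\<close> and \<open>\<theta>_i (b v)\<close> is the
commutator of \<open>b\<close> with \<open>\<theta>_i\<close>, whose entries \<open>(\<theta>_i(x) - \<theta>_i(y)) b_yx\<close> vanish for \<open>d(y, x) > t\<close> and
are small in mean square otherwise. So at least one piece is nearly fixed by \<open>q\<close>. The vector \<open>v\<close> is
finitely supported in order that all sums involved are finite.\<close>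

lemma property_A_localization:
  fixes Y :: "'b set"
  assumes Y: "Metric_space Y d" and ulf: "uniformly_locally_finite Y d" and A: "property_A Y d"
  shows "\<exists>R. \<forall>q b v W. clin q \<and> norm q \<le> 1 \<and> prop_le Y d t b \<and> norm (q - b) \<le> 1/10 \<and>
      finite W \<and> W \<subseteq> Y \<and> cutoff W v = v \<and> v \<noteq> 0 \<and> norm (v - q v) \<le> norm v / 10 \<longrightarrow>
      (\<exists>z\<in>Y. \<exists>w. w \<noteq> 0 \<and> cutoff {x\<in>W. d z x \<le> R \<and> v $$ x \<noteq> 0} w = w \<and> norm (w - q w) \<le> norm w / 2)"
proof -
  obtain N where N: "\<And>x. x \<in> Y \<Longrightarrow> finite {y\<in>Y. d x y \<le> t}" "\<And>x. x \<in> Y \<Longrightarrow> card {y\<in>Y. d x y \<le> t} \<le> N"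
    using ulf_ball_bound[OF Y ulf] by blast
  \<comment> \<open>the commutator bound is \<open>8 N^2 e\<close>, and \<open>3 (1/100 + 1/25 + 1/30) = 1/4\<close> below\<close>
  define e where "e = 1 / 240 / ((real N)^2 + 1)"
  have e: "e > 0" unfolding e_def by (intro divide_pos_pos add_nonneg_pos) auto
  have eN: "8 * (real N)^2 * e \<le> 1/30"
  proof -
    have "(real N)^2 * e \<le> 1/240" unfolding e_def by (rule mult_divide_plus_one_le) auto
    then show ?thesis by simp
  qed
  show ?thesis
  proof (rule property_A_partition[OF A e, where t=t])
    fix I :: "'b \<Rightarrow> ('b \<times> nat) set" and \<theta> R
    assume I: "\<And>x. x \<in> Y \<Longrightarrow> finite (I x)"
      and \<theta>0: "\<And>x i. x \<in> Y \<Longrightarrow> i \<notin> I x \<Longrightarrow> \<theta> i x = 0"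
      and \<theta>1: "\<And>x J. x \<in> Y \<Longrightarrow> finite J \<Longrightarrow> I x \<subseteq> J \<Longrightarrow> (\<Sum>i\<in>J. (\<theta> i x)^2) = 1"
      and \<theta>d: "\<And>x y J. x \<in> Y \<Longrightarrow> y \<in> Y \<Longrightarrow> d x y \<le> t \<Longrightarrow> finite J \<Longrightarrow> I x \<subseteq> J \<Longrightarrow> I y \<subseteq> J \<Longrightarrow>
         (\<Sum>i\<in>J. (\<theta> i x - \<theta> i y)^2) \<le> 2 * e"
      and IR: "\<And>x i. x \<in> Y \<Longrightarrow> i \<in> I x \<Longrightarrow> fst i \<in> Y \<and> d (fst i) x \<le> R"
    show ?thesis
    proof (intro exI[of _ R] allI impI, elim conjE)
      fix q b :: "'b op" and v W
      assume q: "clin q" "norm q \<le> 1" and b: "prop_le Y d t b" and qb: "norm (q - b) \<le> 1/10"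
        and W: "finite W" "W \<subseteq> Y" and vW: "cutoff W v = v" and v: "v \<noteq> 0" and vq: "norm (v - q v) \<le> norm v / 10"
      have bc: "clin b" using b unfolding prop_le_def bounded_ops_iff by blast
      have b0: "b (ell2_delta y) $$ x = 0" if "y \<in> Y" "\<not> (x \<in> Y \<and> d y x \<le> t)" for x y
      proof (cases "x \<in> Y")
        case True
        then show ?thesis using that b by (auto simp: prop_le_def)
      next
        case False
        have "b \<in> bounded_ops Y" using b by (simp add: prop_le_def)
        then show ?thesis using False by (rule bounded_ops_apply_outside)
      qed
      define W' where "W' = W \<union> (\<Union>y\<in>W. {x\<in>Y. d y x \<le> t})"
      have W': "finite W'" "W' \<subseteq> Y" "W \<subseteq> W'" using W N by (auto simp: W'_def)
      define J where "J = (\<Union>x\<in>W'. I x)"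
      have J: "finite J" using W' I by (auto simp: J_def)
      have IJ: "I x \<subseteq> J" if "x \<in> W'" for x using that by (auto simp: J_def)
      define M where "M i f = (\<Sum>x\<in>W'. ell2_scaleC (of_real (\<theta> i x) * f $$ x) (ell2_delta x))"
        for i and f :: "'b ell2"
      have Mx: "M i f $$ x = (if x \<in> W' then of_real (\<theta> i x) * f $$ x else 0)" for i f x
        using W'(1) by (auto simp: M_def if_distrib cong: if_cong)
      have Mnorm: "(\<Sum>i\<in>J. (norm (M i f))^2) = (norm (cutoff W' f))^2" for f
      proof -
        have "(\<Sum>i\<in>J. (norm (M i f))^2) = (\<Sum>i\<in>J. \<Sum>x\<in>W'. (\<theta> i x)^2 * (cmod (f $$ x))^2)"
          by (rule sum.cong[OF refl], subst norm_sq_supported[OF W'(1)])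
             (auto simp: Mx norm_mult power_mult_distrib)
        also have "\<dots> = (\<Sum>x\<in>W'. (\<Sum>i\<in>J. (\<theta> i x)^2) * (cmod (f $$ x))^2)"
          by (subst sum.swap) (simp add: sum_distrib_right)
        also have "\<dots> = (\<Sum>x\<in>W'. (cmod (f $$ x))^2)"
          by (rule sum.cong[OF refl]) (use \<theta>1[OF _ J] IJ W' in auto)
        finally show ?thesis by (simp add: norm_sq_finite_cutoff[OF W'(1)])
      qed
      have vx: "v $$ x = 0" if "x \<notin> W" for x
        using arg_cong[OF vW, of "\<lambda>f. f $$ x"] that by simp
      have bx: "b f $$ x = (\<Sum>y\<in>W. f $$ y * b (ell2_delta y) $$ x)"
        if "cutoff W f = f" for f x
      proof -
        have "b f = b (cutoff W f)" using that by simp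
        then show ?thesis
          using W(1) bc by (simp add: cutoff_finite_eq_sum blinfun.sum_right clinD)
      qed
      define w where "w i = M i v" for i
      have wx: "w i $$ x = of_real (\<theta> i x) * v $$ x" for i x
        using vx[of x] W'(3) by (auto simp: w_def Mx)
      have wW: "cutoff W (w i) = w i" for i
        by (rule ell2_eqI) (use vx in \<open>auto simp: wx\<close>)
      define K where "K i = M i (b v) - b (w i)" for i
      have Kx: "K i $$ x = (if x \<in> W' then
          \<Sum>y\<in>{y\<in>W. d y x \<le> t}. of_real (\<theta> i x - \<theta> i y) * (v $$ y * b (ell2_delta y) $$ x) else 0)"
        for i x
      proof (cases "x \<in> W'")
        case True
        have "K i $$ x = (\<Sum>y\<in>W. of_real (\<theta> i x - \<theta> i y) * (v $$ y * b (ell2_delta y) $$ x))"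
          using True
          by (simp add: K_def Mx bx[OF vW] bx[OF wW] wx sum_distrib_left algebra_simps sum_subtractf)
        also have "\<dots> = (\<Sum>y\<in>{y\<in>W. d y x \<le> t}. of_real (\<theta> i x - \<theta> i y) * (v $$ y * b (ell2_delta y) $$ x))"
          by (rule sum.mono_neutral_right) (use W b0 in auto)
        finally show ?thesis using True by simp
      next
        case False
        have "b (ell2_delta y) $$ x = 0" if "y \<in> W" for y
          by (rule b0) (use that W False in \<open>auto simp: W'_def\<close>)
        then show ?thesis using False by (simp add: K_def Mx bx[OF wW])
      qed
      have nb: "norm b \<le> 2"
      proof -
        have "norm b \<le> norm q + norm (q - b)" by (metis norm_triangle_sub norm_minus_commute)
        then show ?thesis using q qb by simp
      qed
      have bcoef: "cmod (b (ell2_delta y) $$ x) \<le> 2" for x y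
        using cmod_le_norm[of "b (ell2_delta y)" x] norm_blinfun[of b "ell2_delta y"] nb by simp
      have card1: "card {y\<in>W. d y x \<le> t} \<le> N" if "x \<in> W'" for x
      proof -
        have "{y\<in>W. d y x \<le> t} \<subseteq> {y\<in>Y. d x y \<le> t}" using W Metric_space.commute[OF Y] by auto
        then show ?thesis using N that W' by (meson card_mono order_trans subsetD)
      qed
      have card2: "card {x\<in>W'. d y x \<le> t} \<le> N" if "y \<in> W" for y
      proof -
        have "{x\<in>W'. d y x \<le> t} \<subseteq> {x\<in>Y. d y x \<le> t}" using W' by auto
        then show ?thesis using N that W by (meson card_mono order_trans subsetD)
      qed
      have Knorm: "(\<Sum>i\<in>J. (norm (K i))^2) \<le> 1/30 * (norm v)^2"
      proof -
        have Kx2: "(cmod (K i $$ x))^2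
            \<le> (\<Sum>y\<in>{y\<in>W. d y x \<le> t}. 4 * real N * (\<theta> i x - \<theta> i y)^2 * (cmod (v $$ y))^2)"
          if x: "x \<in> W'" for i x
        proof -
          let ?S = "{y\<in>W. d y x \<le> t}"
          let ?a = "\<lambda>y. \<bar>\<theta> i x - \<theta> i y\<bar> * (cmod (v $$ y) * 2)"
          have "cmod (K i $$ x) \<le> (\<Sum>y\<in>?S. ?a y)"
            unfolding Kx using x
            by (auto intro!: sum_norm_le mult_left_mono bcoef simp: norm_mult simp del: of_real_diff)
          then have "(cmod (K i $$ x))^2 \<le> (\<Sum>y\<in>?S. ?a y)^2" by (intro power_mono) auto
          also have "\<dots> \<le> (\<Sum>y\<in>?S. (?a y)^2) * real (card ?S)" by (rule sum_squared_le_sum_of_squares)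
          also have "\<dots> \<le> (\<Sum>y\<in>?S. (?a y)^2) * real N"
            using card1[OF x] by (intro mult_left_mono sum_nonneg) auto
          also have "\<dots> = (\<Sum>y\<in>?S. 4 * real N * (\<theta> i x - \<theta> i y)^2 * (cmod (v $$ y))^2)"
            unfolding sum_distrib_right by (rule sum.cong) (auto simp: power_mult_distrib)
          finally show ?thesis .
        qed
        have "(\<Sum>i\<in>J. (norm (K i))^2) = (\<Sum>i\<in>J. \<Sum>x\<in>W'. (cmod (K i $$ x))^2)"
          by (rule sum.cong[OF refl], rule norm_sq_supported[OF W'(1)]) (simp add: Kx)
        also have "\<dots> \<le> (\<Sum>i\<in>J. \<Sum>x\<in>W'. \<Sum>y\<in>{y\<in>W. d y x \<le> t}. 4 * real N * (\<theta> i x - \<theta> i y)^2 * (cmod (v $$ y))^2)"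
          by (intro sum_mono Kx2)
        also have "\<dots> = (\<Sum>x\<in>W'. \<Sum>i\<in>J. \<Sum>y\<in>{y\<in>W. d y x \<le> t}. 4 * real N * (\<theta> i x - \<theta> i y)^2 * (cmod (v $$ y))^2)"
          by (rule sum.swap)
        also have "\<dots> = (\<Sum>x\<in>W'. \<Sum>y\<in>{y\<in>W. d y x \<le> t}. \<Sum>i\<in>J. 4 * real N * (\<theta> i x - \<theta> i y)^2 * (cmod (v $$ y))^2)"
          by (intro sum.cong refl sum.swap)
        also have "\<dots> = (\<Sum>x\<in>W'. \<Sum>y\<in>{y\<in>W. d y x \<le> t}. (4 * real N * (cmod (v $$ y))^2) * (\<Sum>i\<in>J. (\<theta> i x - \<theta> i y)^2))"
          unfolding sum_distrib_left by (intro sum.cong refl) (simp add: mult_ac)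
        also have "\<dots> \<le> (\<Sum>x\<in>W'. \<Sum>y\<in>{y\<in>W. d y x \<le> t}. (4 * real N * (cmod (v $$ y))^2) * (2 * e))"
        proof (intro sum_mono mult_left_mono)
          fix x y assume x: "x \<in> W'" and y: "y \<in> {y\<in>W. d y x \<le> t}"
          have "d x y \<le> t" using y x Metric_space.commute[OF Y] by auto
          then show "(\<Sum>i\<in>J. (\<theta> i x - \<theta> i y)^2) \<le> 2 * e"
            using x y W' by (intro \<theta>d J IJ) auto
        qed auto
        also have "\<dots> = (\<Sum>y\<in>W. \<Sum>x\<in>{x\<in>W'. d y x \<le> t}. (4 * real N * (cmod (v $$ y))^2) * (2 * e))"
          by (rule sum.swap_restrict[OF W'(1) W(1)])
        also have "\<dots> \<le> (\<Sum>y\<in>W. real N * ((4 * real N * (cmod (v $$ y))^2) * (2 * e)))"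
          using card2 e by (intro sum_mono) (simp add: mult_right_mono)
        also have "\<dots> = (8 * (real N)^2 * e) * (\<Sum>y\<in>W. (cmod (v $$ y))^2)"
          unfolding sum_distrib_left by (intro sum.cong refl) (simp add: power2_eq_square mult_ac)
        also have "\<dots> \<le> 1/30 * (\<Sum>y\<in>W. (cmod (v $$ y))^2)"
          by (intro mult_right_mono eN sum_nonneg) auto
        also have "(\<Sum>y\<in>W. (cmod (v $$ y))^2) = (norm v)^2"
          using norm_sq_finite_cutoff[OF W(1), of v] vW by simp
        finally show ?thesis .
      qed
      have cv: "cutoff W' v = v"
        using vW W'(3) by (metis cutoff_cutoff inf.absorb2)
      have wnorm: "(\<Sum>i\<in>J. (norm (w i))^2) = (norm v)^2"
        unfolding w_def Mnorm cv ..
      have vb: "norm (v - b v) \<le> norm v / 5"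
      proof -
        have "v - b v = (v - q v) + (q - b) v" by (simp add: blinfun.diff_left)
        also have "norm \<dots> \<le> norm v / 10 + norm (q - b) * norm v"
          by (intro norm_triangle_mono vq norm_blinfun)
        also have "\<dots> \<le> norm v / 10 + 1/10 * norm v" by (intro add_left_mono mult_right_mono qb) auto
        finally show ?thesis by simp
      qed
      have decomp: "w i - q (w i) = (b - q) (w i) + M i (v - b v) + K i" for i
      proof -
        have "w i = M i (v - b v) + M i (b v)"
          by (rule ell2_eqI) (auto simp: w_def Mx algebra_simps)
        then have "w i - b (w i) = M i (v - b v) + K i" by (simp add: K_def)
        then show ?thesis by (simp add: blinfun.diff_left algebra_simps)
      qed
      have "(\<Sum>i\<in>J. (norm (w i - q (w i)))^2)
          \<le> (\<Sum>i\<in>J. 3 * ((norm ((b - q) (w i)))^2 + (norm (M i (v - b v)))^2 + (norm (K i))^2))"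
        unfolding decomp by (intro sum_mono norm_sum3_sq_le)
      also have "\<dots> = 3 * ((\<Sum>i\<in>J. (norm ((b - q) (w i)))^2) + (\<Sum>i\<in>J. (norm (M i (v - b v)))^2) + (\<Sum>i\<in>J. (norm (K i))^2))"
        by (simp add: sum.distrib sum_distrib_left algebra_simps)
      also have "\<dots> \<le> 3 * (1/100 * (norm v)^2 + 1/25 * (norm v)^2 + 1/30 * (norm v)^2)"
      proof (intro mult_left_mono add_mono Knorm)
        have "(norm ((b - q) (w i)))^2 \<le> 1/100 * (norm (w i))^2" for i
        proof -
          have "norm ((b - q) (w i)) \<le> norm (b - q) * norm (w i)" by (rule norm_blinfun)
          also have "\<dots> \<le> 1/10 * norm (w i)" using qb by (intro mult_right_mono) (auto simp: norm_minus_commute)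
          finally have "(norm ((b - q) (w i)))^2 \<le> (1/10 * norm (w i))^2" by (intro power_mono) auto
          then show ?thesis by (simp add: power_mult_distrib power2_eq_square)
        qed
        then have "(\<Sum>i\<in>J. (norm ((b - q) (w i)))^2) \<le> (\<Sum>i\<in>J. 1/100 * (norm (w i))^2)" by (intro sum_mono)
        then show "(\<Sum>i\<in>J. (norm ((b - q) (w i)))^2) \<le> 1/100 * (norm v)^2"
          unfolding wnorm[symmetric] sum_distrib_left .
        have "norm (cutoff W' (v - b v)) \<le> norm v / 5" by (rule order_trans[OF norm_cutoff_le vb])
        then have "(norm (cutoff W' (v - b v)))^2 \<le> (norm v / 5)^2" by (intro power_mono) auto
        then show "(\<Sum>i\<in>J. (norm (M i (v - b v)))^2) \<le> 1/25 * (norm v)^2"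
          unfolding Mnorm by (simp add: power_divide)
      qed auto
      also have "\<dots> = 1/4 * (\<Sum>i\<in>J. (norm (w i))^2)" unfolding wnorm by simp
      finally have total: "(\<Sum>i\<in>J. (norm (w i - q (w i)))^2) \<le> (\<Sum>i\<in>J. 1/4 * (norm (w i))^2)"
        unfolding sum_distrib_left .
      have "\<exists>i\<in>J. w i \<noteq> 0 \<and> (norm (w i - q (w i)))^2 \<le> 1/4 * (norm (w i))^2"
      proof (rule ccontr)
        assume "\<not> ?thesis"
        then have gt: "w i \<noteq> 0 \<Longrightarrow> 1/4 * (norm (w i))^2 < (norm (w i - q (w i)))^2" if "i \<in> J" for i
          using that by (auto simp: not_le)
        have "\<exists>i\<in>J. w i \<noteq> 0"
        proof (rule ccontr)
          assume "\<not> ?thesis"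
          then have "(\<Sum>i\<in>J. (norm (w i))^2) = 0" by (intro sum.neutral) auto
          then show False using wnorm v by simp
        qed
        then have "(\<Sum>i\<in>J. 1/4 * (norm (w i))^2) < (\<Sum>i\<in>J. (norm (w i - q (w i)))^2)"
          using gt by (intro sum_strict_mono_ex1[OF J]) (force, blast)
        then show False using total by simp
      qed
      then obtain i where i: "i \<in> J" "w i \<noteq> 0" "(norm (w i - q (w i)))^2 \<le> 1/4 * (norm (w i))^2" by blast
      have "(norm (w i - q (w i)))^2 \<le> (norm (w i) / 2)^2" using i(3) by (simp add: power_divide)
      then have "norm (w i - q (w i)) \<le> norm (w i) / 2" by (rule power2_le_imp_le) simp
      moreover have "cutoff {x\<in>W. d (fst i) x \<le> R \<and> v $$ x \<noteq> 0} (w i) = w i"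
      proof (rule ell2_eqI)
        fix x
        have "x \<in> {x\<in>W. d (fst i) x \<le> R \<and> v $$ x \<noteq> 0}" if "w i $$ x \<noteq> 0"
        proof -
          have "\<theta> i x \<noteq> 0" "v $$ x \<noteq> 0" using that by (auto simp: wx)
          then show ?thesis using vx[of x] W(2) \<theta>0[of x i] IR[of x i] by blast
        qed
        then show "(cutoff {x\<in>W. d (fst i) x \<le> R \<and> v $$ x \<noteq> 0} (w i)) $$ x = w i $$ x"
          by auto
      qed
      moreover have "fst i \<in> Y" using i(1) W'(2) IR[of _ i] unfolding J_def by blast
      ultimately show "\<exists>z\<in>Y. \<exists>w. w \<noteq> 0 \<and> cutoff {x\<in>W. d z x \<le> R \<and> v $$ x \<noteq> 0} w = w \<and> norm (w - q w) \<le> norm w / 2"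
        using i(2) by blast
    qed
  qed
qed

text \<open>If \<open>K\<close> had fewer elements than \<open>F\<close>, a nontrivial combination \<open>v_0\<close> of the vectors \<open>\<xi>_x\<close>, \<open>x \<in> F\<close>,
would vanish on \<open>K\<close>. It is fixed by \<open>q = u \<chi>_F u*\<close>, and so, nearly, is a piece \<open>w\<close> of it which
is supported on a set \<open>S\<close> of bounded cardinality disjoint from \<open>K\<close>. Some coordinate of \<open>q w\<close> on
\<open>S\<close> is bounded below, hence so is the norm of a column \<open>q \<delta>_y\<close> with \<open>y \<in> S\<close>, and a coordinate
\<open>\<xi>_x(y)\<close>, contradicting the choice of \<open>K\<close>. The bound \<open>c\<close> on the column depends only on the
cardinality of balls, so \<open>\<delta>\<close> can be fixed in advance.\<close>

lemma matching_bound: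
  fixes X :: "'a set" and Y :: "'b set" and u :: "'a ell2 \<Rightarrow>\<^sub>L 'b ell2"
  assumes X: "Metric_space X dX" and ulfX: "uniformly_locally_finite X dX"
    and Y: "Metric_space Y dY" and ulfY: "uniformly_locally_finite Y dY" and A: "property_A Y dY"
    and u: "clin u" "norm u \<le> 1" "adj u \<odot> u = cutoff X" "cutoff Y \<odot> u = u"
    and uR: "\<And>a. a \<in> uniform_Roe X dX \<Longrightarrow> u \<odot> a \<odot> adj u \<in> uniform_Roe Y dY"
  shows "\<exists>\<delta>>0. \<forall>F K. finite F \<and> F \<subseteq> X \<and> finite K \<and>
     (\<forall>x\<in>F. \<forall>y\<in>Y. \<delta> \<le> cmod (u (ell2_delta x) $$ y) \<longrightarrow> y \<in> K) \<longrightarrow> card F \<le> card K"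
proof -
  have "(1/10::real) > 0" by simp
  from equi_approx[OF X ulfX u(1,2) uR this, where r=0]
  obtain t where t: "\<And>E. finite E \<Longrightarrow> E \<subseteq> entourage X dX 0 \<Longrightarrow> approx Y dY t (1/10) (u \<odot> rel_op E \<odot> adj u)"
    by blast
  obtain R where R: "\<forall>q b v W. clin q \<and> norm q \<le> 1 \<and> prop_le Y dY t b \<and> norm (q - b) \<le> 1/10 \<and>
      finite W \<and> W \<subseteq> Y \<and> cutoff W v = v \<and> v \<noteq> 0 \<and> norm (v - q v) \<le> norm v / 10 \<longrightarrow>
      (\<exists>z\<in>Y. \<exists>w. w \<noteq> 0 \<and> cutoff {x\<in>W. dY z x \<le> R \<and> v $$ x \<noteq> 0} w = w \<and> norm (w - q w) \<le> norm w / 2)"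
    using property_A_localization[OF Y ulfY A] by blast
  obtain N where N: "\<And>y. y \<in> Y \<Longrightarrow> finite {z\<in>Y. dY y z \<le> R}" "\<And>y. y \<in> Y \<Longrightarrow> card {z\<in>Y. dY y z \<le> R} \<le> N"
    using ulf_ball_bound[OF Y ulfY] by blast
  define c where "c = 1 / 2 / (real N + 1)"
  have c: "c > 0" by (simp add: c_def)
  have cN: "real N * c < 1/2"
  proof -
    have "c * (real N + 1) = 1/2"
    proof -
      have "real N + 1 > 0" by simp
      then show ?thesis by (metis c_def nonzero_eq_divide_eq less_irrefl)
    qed
    then show ?thesis using c by (simp add: algebra_simps)
  qed
  have "\<exists>\<delta>>0. \<forall>F y. finite F \<and> F \<subseteq> X \<and> y \<in> Y \<and>
      c \<le> norm ((u \<odot> cutoff F \<odot> adj u) (ell2_delta y)) \<longrightarrow>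
      (\<exists>x\<in>F. \<delta> \<le> cmod (u (ell2_delta x) $$ y))"
    by (rule large_column_large_coordinate[OF X ulfX Y ulfY u(1-3) _ c]) (rule uR)
  then obtain \<delta> where \<delta>0: "\<delta> > 0 \<and> (\<forall>F y. finite F \<and> F \<subseteq> X \<and> y \<in> Y \<and>
      c \<le> norm ((u \<odot> cutoff F \<odot> adj u) (ell2_delta y)) \<longrightarrow>
      (\<exists>x\<in>F. \<delta> \<le> cmod (u (ell2_delta x) $$ y)))"
    by (elim exE)
  then have \<delta>: "\<delta> > 0" by (rule conjunct1)
  have \<delta>F: "\<exists>x\<in>F. \<delta> \<le> cmod (u (ell2_delta x) $$ y)"
    if "finite F" "F \<subseteq> X" "y \<in> Y" "c \<le> norm ((u \<odot> cutoff F \<odot> adj u) (ell2_delta y))" for F y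
    using \<delta>0[THEN conjunct2, THEN spec, THEN spec, THEN mp, of F y] that by blast
  have "card F \<le> card K" if F: "finite F" "F \<subseteq> X" and K: "finite K"
    and FK: "\<forall>x\<in>F. \<forall>y\<in>Y. \<delta> \<le> cmod (u (ell2_delta x) $$ y) \<longrightarrow> y \<in> K" for F K
  proof (rule ccontr)
    assume "\<not> ?thesis"
    then have "card K < card F" by simp
    from nontrivial_kernel[OF K F(1) this, of "\<lambda>x y. u (ell2_delta x) $$ y"]
    obtain a x0 where a: "x0 \<in> F" "a x0 \<noteq> 0" "\<And>y. y \<in> K \<Longrightarrow> (\<Sum>x\<in>F. a x * u (ell2_delta x) $$ y) = 0"
      by blast
    define g where "g = (\<Sum>x\<in>F. ell2_scaleC (a x) (ell2_delta x))"
    have gx: "g $$ x = (if x \<in> F then a x else 0)" for x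
      using F(1) by (auto simp: g_def if_distrib cong: if_cong)
    define v0 where "v0 = u g"
    define q where "q = u \<odot> cutoff F \<odot> adj u"
    have cF: "cutoff X g = g" "cutoff F g = g" by (rule ell2_eqI, use gx F(2) in auto)+
    have g0: "g \<noteq> 0" using gx[of x0] a by auto
    have "norm v0 = norm g" unfolding v0_def by (rule isometric_on[OF u(1,3) cF(1)])
    then have v0: "norm v0 > 0" using g0 by simp
    have qv0: "q v0 = v0"
    proof -
      have "q v0 = u (cutoff F ((adj u \<odot> u) g))" by (simp add: q_def v0_def)
      then show ?thesis unfolding u(3) cF by (simp add: v0_def cF)
    qed
    have v0K: "v0 $$ y = 0" if "y \<in> K" for y
      using a(3)[OF that] u(1) by (simp add: v0_def g_def blinfun.sum_right clinD)
    have v0Y: "cutoff Y v0 = v0" unfolding v0_def using u(4) by (metis blinfun_apply_blinfun_compose)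
    have q: "clin q" "norm q \<le> 1" "adj q = q"
    proof -
      show "clin q" using u by (simp add: q_def)
      show "adj q = q" using u by (simp add: q_def adj_compose compose_assoc)
      have "norm (u \<odot> cutoff F \<odot> adj u) \<le> norm (u \<odot> cutoff F)" using u by (intro norm_compose_contr_right) simp
      also have "\<dots> \<le> norm u" by (rule norm_compose_contr_right[OF norm_cutoff])
      finally show "norm q \<le> 1" using u(2) by (simp add: q_def)
    qed
    have "finite (Id_on F)" "Id_on F \<subseteq> entourage X dX 0"
      using F Metric_space.mdist_zero[OF X] by (auto simp: entourage_def Id_on_def)
    from t[OF this] obtain b where b: "prop_le Y dY t b" "norm (q - b) \<le> 1/10"
      by (auto simp: approx_def rel_op_Id_on q_def)
    have "norm v0 / 30 > 0" using v0 by simp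
    then obtain W0 where W0: "finite W0" "norm (v0 - cutoff W0 v0) < norm v0 / 30"
      by (metis cutoff_approx order_refl)
    define W where "W = W0 \<inter> Y"
    define v where "v = cutoff W v0"
    have vW0: "v = cutoff W0 v0" unfolding v_def W_def using v0Y by (metis cutoff_cutoff)
    have near: "norm (v0 - v) < norm v0 / 30" unfolding vW0 by (rule W0)
    then have nv: "norm v0 * 29/30 \<le> norm v" using norm_triangle_ineq2[of v0 v] by simp
    have "v - q v = q (v0 - v) - (v0 - v)" by (simp add: blinfun.diff_right qv0)
    also have "norm \<dots> \<le> norm q * norm (v0 - v) + norm (v0 - v)"
      by (rule order_trans[OF norm_triangle_ineq4 add_right_mono[OF norm_blinfun]])
    also have "\<dots> \<le> 1 * norm (v0 - v) + norm (v0 - v)" using q(2) by (intro add_right_mono mult_right_mono) auto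
    also have "\<dots> \<le> norm v / 10" using near nv v0 by linarith
    finally have vq: "norm (v - q v) \<le> norm v / 10" .
    have W: "finite W" "W \<subseteq> Y" "cutoff W v = v" "v \<noteq> 0"
      using W0 nv v0 by (auto simp: W_def v_def)
    obtain z w where zw: "z \<in> Y" "w \<noteq> 0" "cutoff {x\<in>W. dY z x \<le> R \<and> v $$ x \<noteq> 0} w = w"
      "norm (w - q w) \<le> norm w / 2"
      using R q(1,2) b W vq by blast
    define S where "S = {x\<in>W. dY z x \<le> R \<and> v $$ x \<noteq> 0}"
    have SK: "y \<notin> K" if "y \<in> S" for y
    proof
      assume "y \<in> K"
      then have "v $$ y = 0" using v0K by (simp add: v_def)
      then show False using that by (simp add: S_def)
    qed
    have SY: "S \<subseteq> {y\<in>Y. dY z y \<le> R}" using W(2) by (auto simp: S_def)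
    then have S: "finite S" "card S \<le> N"
      using N[OF zw(1)] by (auto intro: finite_subset) (meson card_mono order_trans)
    have "norm w = norm (cutoff S w)" using zw(3) by (simp add: S_def)
    also have "cutoff S w = cutoff S (w - q w) + cutoff S (q w)" by (simp add: blinfun.diff_right)
    also have "norm \<dots> \<le> norm w / 2 + norm (cutoff S (q w))"
      by (intro norm_triangle_mono order_trans[OF norm_cutoff_le zw(4)] order_refl)
    finally have half: "norm w / 2 \<le> norm (cutoff S (q w))" by simp
    have "\<exists>y\<in>S. c * norm w \<le> cmod (q w $$ y)"
    proof (rule ccontr)
      assume "\<not> ?thesis"
      then have lt: "cmod (q w $$ y) \<le> c * norm w" if "y \<in> S" for y using that by force
      have "norm (cutoff S (q w)) \<le> (\<Sum>y\<in>S. cmod (q w $$ y))" by (rule norm_cutoff_le_sum[OF S(1)])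
      also have "\<dots> \<le> (\<Sum>y\<in>S. c * norm w)" by (intro sum_mono lt)
      also have "\<dots> = real (card S) * (c * norm w)" by simp
      also have "\<dots> \<le> real N * (c * norm w)" using S(2) c by (intro mult_right_mono) auto
      also have "\<dots> < 1/2 * norm w" using cN zw(2) unfolding mult.assoc[symmetric] by (intro mult_strict_right_mono) auto
      finally show False using half by simp
    qed
    then obtain y where y: "y \<in> S" "c * norm w \<le> cmod (q w $$ y)" by blast
    have "q w $$ y = cinner w (q (ell2_delta y))"
      using cinner_adj_right[OF q(1), of w "ell2_delta y"] q(3) by simp
    then have "c * norm w \<le> norm w * norm (q (ell2_delta y))"
      using y(2) cinner_Cauchy_Schwarz[of w "q (ell2_delta y)"] by simp
    then have "c \<le> norm (q (ell2_delta y))" using zw(2) by (simp add: mult.commute)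
    then obtain x where "x \<in> F" "\<delta> \<le> cmod (u (ell2_delta x) $$ y)"
      using \<delta>F[OF F, of y] y(1) SY by (auto simp: q_def)
    then show False using FK SK[OF y(1)] y(1) SY by blast
  qed
  then show ?thesis using \<delta> by blast
qed

section \<open>The marriage theorem for infinite families\<close>

text \<open>Rado's proof. By Zorn's lemma and finiteness of the sets there is a maximal set \<open>M\<close> of pairs
\<open>(x, y)\<close> whose deletion from the family preserves Hall's condition. If two elements \<open>y_1\<close>, \<open>y_2\<close> of
some member were left, then deleting either of them would violate the condition for finite sets
\<open>G_1 \<union> {x}\<close> and \<open>G_2 \<union> {x}\<close>; counting the unions for \<open>G_1 \<union> G_2 \<union> {x}\<close> and for \<open>G_1 \<inter> G_2\<close> shows
that the condition would already have been violated. So every member has shrunk to a single point,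
and Hall's condition for pairs says that these points are distinct.\<close>

lemma infinite_marriage:
  fixes S :: "'a \<Rightarrow> 'b set"
  assumes fin: "\<And>x. x \<in> X \<Longrightarrow> finite (S x)"
    and hall: "\<And>F. finite F \<Longrightarrow> F \<subseteq> X \<Longrightarrow> card F \<le> card (\<Union>x\<in>F. S x)"
  shows "\<exists>g. inj_on g X \<and> (\<forall>x\<in>X. g x \<in> S x)"
proof -
  define T where "T D x = {y\<in>S x. (x, y) \<notin> D}" for D x
  define \<A> where "\<A> = {D. \<forall>F. finite F \<and> F \<subseteq> X \<longrightarrow> card F \<le> card (\<Union>x\<in>F. T D x)}"
  have "\<exists>M\<in>\<A>. \<forall>D\<in>\<A>. M \<subseteq> D \<longrightarrow> D = M"
  proof (rule subset_Zorn')
    fix C assume C: "subset.chain \<A> C"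
    show "\<Union>C \<in> \<A>"
      unfolding \<A>_def
    proof (intro CollectI allI impI)
      fix F assume F: "finite F \<and> F \<subseteq> X"
      show "card F \<le> card (\<Union>x\<in>F. T (\<Union>C) x)"
      proof (cases "C = {}")
        case True
        then show ?thesis using hall F by (simp add: T_def)
      next
        case False
        have "finite (Sigma F S \<inter> \<Union>C)" using F fin by (intro finite_Int disjI1 finite_SigmaI) auto
        then obtain D where D: "D \<in> C" "Sigma F S \<inter> \<Union>C \<subseteq> D"
          using finite_subset_Union_chain[OF _ _ False C] by blast
        have "T (\<Union>C) x = T D x" if "x \<in> F" for x
          using D that by (auto simp: T_def)
        then have "(\<Union>x\<in>F. T (\<Union>C) x) = (\<Union>x\<in>F. T D x)" by simp
        moreover have "D \<in> \<A>" using C D(1) by (auto simp: subset_chain_def)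
        ultimately show ?thesis using F by (simp add: \<A>_def)
      qed
    qed
  qed
  then obtain M where M: "M \<in> \<A>" "\<And>D. D \<in> \<A> \<Longrightarrow> M \<subseteq> D \<Longrightarrow> D = M" by blast
  define U where "U F = (\<Union>x\<in>F. T M x)" for F
  have UM: "card F \<le> card (U F)" if "finite F" "F \<subseteq> X" for F
    using M(1) that by (simp add: \<A>_def U_def)
  have finT: "finite (T M x)" if "x \<in> X" for x using fin[OF that] by (simp add: T_def)
  have finU: "finite (U F)" if "finite F" "F \<subseteq> X" for F using that finT by (auto simp: U_def)
  \<comment> \<open>a violation after deleting \<open>y\<close> from the member at \<open>x\<close> must involve \<open>x\<close> itself\<close>
  have critical: "\<exists>G. finite G \<and> G \<subseteq> X \<and> x \<notin> G \<and> card (U G \<union> (T M x - {y})) \<le> card G"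
    if x: "x \<in> X" and y: "y \<in> T M x" for x y
  proof -
    have "insert (x, y) M \<noteq> M" using y by (auto simp: T_def)
    then have "insert (x, y) M \<notin> \<A>" using M(2) by blast
    then obtain F where F: "finite F" "F \<subseteq> X" "card (\<Union>z\<in>F. T (insert (x, y) M) z) < card F"
      by (auto simp: \<A>_def not_le)
    have T1: "T (insert (x, y) M) z = (if z = x then T M x - {y} else T M z)" for z
      by (auto simp: T_def)
    have "x \<in> F"
    proof (rule ccontr)
      assume "x \<notin> F"
      then have "(\<Union>z\<in>F. T (insert (x, y) M) z) = U F" unfolding T1 U_def by (intro SUP_cong) auto
      then show False using F UM[of F] by simp
    qed
    define G where "G = F - {x}"
    have G: "F = insert x G" "x \<notin> G" "finite G" using \<open>x \<in> F\<close> F(1) by (auto simp: G_def)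
    have "(\<Union>z\<in>F. T (insert (x, y) M) z) = U G \<union> (T M x - {y})"
      unfolding T1 U_def G(1) using G(2) by auto
    then show ?thesis using F G by (intro exI[of _ G]) auto
  qed
  have single: "\<exists>y. T M x = {y}" if x: "x \<in> X" for x
  proof -
    have "card {x} \<le> card (U {x})" using x by (intro UM) auto
    then have "T M x \<noteq> {}" by (auto simp: U_def)
    moreover have "y1 = y2" if y: "y1 \<in> T M x" "y2 \<in> T M x" for y1 y2
    proof (rule ccontr)
      assume ne: "y1 \<noteq> y2"
      obtain G1 where G1: "finite G1" "G1 \<subseteq> X" "x \<notin> G1" "card (U G1 \<union> (T M x - {y1})) \<le> card G1"
        using critical[OF x y(1)] by blast
      obtain G2 where G2: "finite G2" "G2 \<subseteq> X" "x \<notin> G2" "card (U G2 \<union> (T M x - {y2})) \<le> card G2"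
        using critical[OF x y(2)] by blast
      let ?A1 = "U G1 \<union> (T M x - {y1})" and ?A2 = "U G2 \<union> (T M x - {y2})"
      have finA: "finite ?A1" "finite ?A2" using finU finT G1 G2 x by auto
      have "?A1 \<union> ?A2 = U (insert x (G1 \<union> G2))" using ne by (auto simp: U_def)
      then have "card (insert x (G1 \<union> G2)) \<le> card (?A1 \<union> ?A2)"
        using UM[of "insert x (G1 \<union> G2)"] G1 G2 x by simp
      moreover have "card (insert x (G1 \<union> G2)) = Suc (card (G1 \<union> G2))" using G1 G2 by simp
      moreover have "card (G1 \<inter> G2) \<le> card (?A1 \<inter> ?A2)"
      proof -
        have "card (G1 \<inter> G2) \<le> card (U (G1 \<inter> G2))" using G1 G2 by (intro UM) auto
        also have "\<dots> \<le> card (?A1 \<inter> ?A2)" using finA by (intro card_mono) (auto simp: U_def)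
        finally show ?thesis .
      qed
      moreover have "card G1 + card G2 = card (G1 \<union> G2) + card (G1 \<inter> G2)"
        using G1 G2 by (intro card_Un_Int) auto
      moreover have "card ?A1 + card ?A2 = card (?A1 \<union> ?A2) + card (?A1 \<inter> ?A2)"
        using finA by (intro card_Un_Int) auto
      ultimately show False using G1(4) G2(4) by linarith
    qed
    ultimately show ?thesis by blast
  qed
  then obtain g where g: "\<And>x. x \<in> X \<Longrightarrow> T M x = {g x}" by metis
  show ?thesis
  proof (intro exI[of _ g] conjI ballI)
    show "g x \<in> S x" if "x \<in> X" for x using g[OF that] by (auto simp: T_def)
    show "inj_on g X"
    proof (rule inj_onI, rule ccontr)
      fix x x' assume x: "x \<in> X" "x' \<in> X" "g x = g x'" "x \<noteq> x'"
      have "card {x, x'} \<le> card (U {x, x'})" using x by (intro UM) auto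
      moreover have "U {x, x'} = {g x}" using g x by (auto simp: U_def)
      ultimately show False using x by simp
    qed
  qed
qed

section \<open>Coarse embeddings\<close>

lemma coarse_embeddingI:
  assumes f: "f \<in> X \<rightarrow> Y"
    and coarse: "\<And>r. \<exists>s. \<forall>x\<in>X. \<forall>x'\<in>X. dX x x' \<le> r \<longrightarrow> dY (f x) (f x') \<le> s"
    and expanding: "\<And>s. \<exists>r. \<forall>x\<in>X. \<forall>x'\<in>X. dY (f x) (f x') \<le> s \<longrightarrow> dX x x' \<le> r"
  shows "coarse_embedding X dX Y dY f"
  unfolding coarse_embedding_def
proof (intro conjI f)
  show "coarse_map X dX dY f"
    unfolding coarse_map_def
  proof (intro allI impI)
    fix r :: real
    obtain s where "\<forall>x\<in>X. \<forall>x'\<in>X. dX x x' \<le> r \<longrightarrow> dY (f x) (f x') \<le> s" using coarse by blast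
    then show "bdd_above {dY (f x) (f y) |x y. x \<in> X \<and> y \<in> X \<and> dX x y \<le> r}"
      by (intro bdd_aboveI[of _ s]) blast
  qed
  show "expanding_map X dX dY f"
    unfolding expanding_map_def tendsto_PInfty
  proof
    fix K :: real
    obtain r0 where r0: "\<forall>x\<in>X. \<forall>x'\<in>X. dY (f x) (f x') \<le> K + 1 \<longrightarrow> dX x x' \<le> r0" using expanding by blast
    have "ereal K < (INF (x, y)\<in>{(x, y). x \<in> X \<and> y \<in> X \<and> dX x y \<ge> r}. ereal (dY (f x) (f y)))"
      if "r > r0" for r
    proof -
      have "ereal (K + 1) \<le> (INF (x, y)\<in>{(x, y). x \<in> X \<and> y \<in> X \<and> dX x y \<ge> r}. ereal (dY (f x) (f y)))"
        using r0 that by (intro INF_greatest) force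
      moreover have "ereal K < ereal (K + 1)" by simp
      ultimately show ?thesis by (rule less_le_trans[rotated])
    qed
    then show "\<forall>\<^sub>F r in at_top. ereal K < (INF (x, y)\<in>{(x, y). x \<in> X \<and> y \<in> X \<and> dX x y \<ge> r}. ereal (dY (f x) (f y)))"
      using eventually_gt_at_top[of r0] by (rule eventually_mono[rotated])
  qed
qed

lemma coarse_embedding_close:
  assumes Y: "Metric_space Y dY" and f: "f \<in> X \<rightarrow> Y" and g: "g \<in> X \<rightarrow> Y"
    and close: "\<And>x. x \<in> X \<Longrightarrow> dY (f x) (g x) \<le> R"
    and coarse: "\<And>r. \<exists>s. \<forall>x\<in>X. \<forall>x'\<in>X. dX x x' \<le> r \<longrightarrow> dY (f x) (f x') \<le> s"
    and expanding: "\<And>s. \<exists>r. \<forall>x\<in>X. \<forall>x'\<in>X. dY (f x) (f x') \<le> s \<longrightarrow> dX x x' \<le> r"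
  shows "coarse_embedding X dX Y dY g"
proof (rule coarse_embeddingI[OF g])
  have fg: "dY (g x) (g x') \<le> dY (f x) (f x') + 2 * R" "dY (f x) (f x') \<le> dY (g x) (g x') + 2 * R"
    if x: "x \<in> X" "x' \<in> X" for x x'
  proof -
    have in_Y: "f x \<in> Y" "f x' \<in> Y" "g x \<in> Y" "g x' \<in> Y" using f g x by auto
    note tri = Metric_space.triangle[OF Y] and com = Metric_space.commute[OF Y]
    show "dY (g x) (g x') \<le> dY (f x) (f x') + 2 * R"
      using tri[of "g x" "f x" "g x'"] tri[of "f x" "f x'" "g x'"] com[of "g x" "f x"]
        close[OF x(1)] close[OF x(2)] in_Y by linarith
    show "dY (f x) (f x') \<le> dY (g x) (g x') + 2 * R"
      using tri[of "f x" "g x" "f x'"] tri[of "g x" "g x'" "f x'"] com[of "g x'" "f x'"]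
        close[OF x(1)] close[OF x(2)] in_Y by linarith
  qed
  fix r
  obtain s where "\<forall>x\<in>X. \<forall>x'\<in>X. dX x x' \<le> r \<longrightarrow> dY (f x) (f x') \<le> s" using coarse by blast
  then show "\<exists>s. \<forall>x\<in>X. \<forall>x'\<in>X. dX x x' \<le> r \<longrightarrow> dY (g x) (g x') \<le> s"
    using fg(1) by (intro exI[of _ "s + 2 * R"]) fastforce
  obtain s where "\<forall>x\<in>X. \<forall>x'\<in>X. dY (f x) (f x') \<le> r + 2 * R \<longrightarrow> dX x x' \<le> s" using expanding by blast
  then show "\<exists>s. \<forall>x\<in>X. \<forall>x'\<in>X. dY (g x) (g x') \<le> r \<longrightarrow> dX x x' \<le> s"
    using fg(2) by (intro exI[of _ s]) fastforce
qed

theorem theorem1p4: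
  fixes X :: "'a set" and dX :: "'a \<Rightarrow> 'a \<Rightarrow> real"
    and Y :: "'b set" and dY :: "'b \<Rightarrow> 'b \<Rightarrow> real"
  assumes "Metric_space X dX" and "Metric_space Y dY"
    and "uniformly_locally_finite X dX" and "uniformly_locally_finite Y dY"
    and "\<exists>B. hereditary_cstar_subalgebra B (uniform_Roe Y dY) \<and>
             cstar_isomorphic (uniform_Roe X dX) B"
  shows "((\<forall>Z\<subseteq>Y. sparse_space Z dY \<longrightarrow> only_compact_ghost_projections Z dY) \<longrightarrow>
           (\<exists>f. coarse_embedding X dX Y dY f)) \<and>
         ((\<forall>Z\<subseteq>Y. sparse_space Z dY \<longrightarrow> only_compact_ghost_projections Z dY) \<and> property_A Y dY \<longrightarrow>
           (\<exists>f. coarse_embedding X dX Y dY f \<and> inj_on f X))"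
proof -
  note X = assms(1) and Y = assms(2) and ulfX = assms(3) and ulfY = assms(4)
  obtain u :: "'a ell2 \<Rightarrow>\<^sub>L 'b ell2" where u: "clin u" "norm u \<le> 1" "adj u \<odot> u = cutoff X" "cutoff Y \<odot> u = u"
    and uR: "\<And>a. a \<in> uniform_Roe X dX \<Longrightarrow> u \<odot> a \<odot> adj u \<in> uniform_Roe Y dY"
    and vR: "\<And>b. b \<in> uniform_Roe Y dY \<Longrightarrow> adj u \<odot> b \<odot> u \<in> uniform_Roe X dX"
    using assms(5) spatial_implementation[OF X Y] by metis
  have v: "clin (adj u)" "norm (adj u) \<le> 1" using u by auto
  have vR': "adj u \<odot> b \<odot> adj (adj u) \<in> uniform_Roe X dX" if "b \<in> uniform_Roe Y dY" for b
    using vR[OF that] u by simp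
  define \<xi> where "\<xi> x y = cmod (u (ell2_delta x) $$ y)" for x y
  have adj_\<xi>: "cmod (adj u (ell2_delta y) $$ x) = \<xi> x y" for x y
    using u(1) by (simp add: adj_apply \<xi>_def)
  have coarse: "\<exists>s. \<forall>x\<in>X. \<forall>x'\<in>X. \<forall>y\<in>Y. \<forall>y'\<in>Y. dX x x' \<le> r \<and> c \<le> \<xi> x y \<and> c \<le> \<xi> x' y' \<longrightarrow> dY y y' \<le> s"
    if "c > 0" for c r
    using coarse_on_atoms[OF X ulfX u(1,2) uR that] unfolding \<xi>_def by blast
  have expanding: "\<exists>s. \<forall>y\<in>Y. \<forall>y'\<in>Y. \<forall>x\<in>X. \<forall>x'\<in>X. dY y y' \<le> r \<and> c \<le> \<xi> x y \<and> c \<le> \<xi> x' y' \<longrightarrow> dX x x' \<le> s"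
    if "c > 0" for c r
    using coarse_on_atoms[OF Y ulfY v vR' that] unfolding adj_\<xi> by blast
  have main: "\<exists>f c. c > 0 \<and> f \<in> X \<rightarrow> Y \<and> (\<forall>x\<in>X. c \<le> \<xi> x (f x)) \<and>
      (\<forall>r. \<exists>s. \<forall>x\<in>X. \<forall>x'\<in>X. dX x x' \<le> r \<longrightarrow> dY (f x) (f x') \<le> s) \<and>
      (\<forall>s. \<exists>r. \<forall>x\<in>X. \<forall>x'\<in>X. dY (f x) (f x') \<le> s \<longrightarrow> dX x x' \<le> r)"
    if gh: "\<forall>Z\<subseteq>Y. sparse_space Z dY \<longrightarrow> only_compact_ghost_projections Z dY"
  proof -
    obtain c where c: "c > 0" "\<forall>x\<in>X. \<exists>y\<in>Y. c \<le> \<xi> x y"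
      using uniformly_large_coordinates[OF X Y ulfY u(1,3,4,2) uR] gh unfolding \<xi>_def by blast
    then obtain f where f: "\<forall>x\<in>X. f x \<in> Y \<and> c \<le> \<xi> x (f x)" by metis
    have "\<exists>s. \<forall>x\<in>X. \<forall>x'\<in>X. dX x x' \<le> r \<longrightarrow> dY (f x) (f x') \<le> s" for r
      using coarse[OF c(1), of r] f by blast
    moreover have "\<exists>r. \<forall>x\<in>X. \<forall>x'\<in>X. dY (f x) (f x') \<le> s \<longrightarrow> dX x x' \<le> r" for s
      using expanding[OF c(1), of s] f by blast
    ultimately show ?thesis using c(1) f by (intro exI[of _ f] exI[of _ c]) auto
  qed
  show ?thesis
  proof (intro conjI impI; (elim conjE)?)
    assume "\<forall>Z\<subseteq>Y. sparse_space Z dY \<longrightarrow> only_compact_ghost_projections Z dY"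
    from main[OF this] obtain f where f: "f \<in> X \<rightarrow> Y"
      and fc: "\<forall>r. \<exists>s. \<forall>x\<in>X. \<forall>x'\<in>X. dX x x' \<le> r \<longrightarrow> dY (f x) (f x') \<le> s"
      and fe: "\<forall>s. \<exists>r. \<forall>x\<in>X. \<forall>x'\<in>X. dY (f x) (f x') \<le> s \<longrightarrow> dX x x' \<le> r"
      by (elim exE conjE) (rule that)
    show "\<exists>f. coarse_embedding X dX Y dY f"
      by (rule exI, rule coarse_embeddingI[OF f fc[THEN spec] fe[THEN spec]])
  next
    assume gh: "\<forall>Z\<subseteq>Y. sparse_space Z dY \<longrightarrow> only_compact_ghost_projections Z dY" and A: "property_A Y dY"
    from main[OF gh] obtain f c where c: "c > 0" and f: "f \<in> X \<rightarrow> Y" "\<forall>x\<in>X. c \<le> \<xi> x (f x)"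
      and fcoarse: "\<forall>r. \<exists>s. \<forall>x\<in>X. \<forall>x'\<in>X. dX x x' \<le> r \<longrightarrow> dY (f x) (f x') \<le> s"
      and fexp: "\<forall>s. \<exists>r. \<forall>x\<in>X. \<forall>x'\<in>X. dY (f x) (f x') \<le> s \<longrightarrow> dX x x' \<le> r"
      by (elim exE conjE) (rule that)
    note fc = fcoarse[THEN spec] and fe = fexp[THEN spec]
    obtain \<delta> where \<delta>: "\<delta> > 0" "\<forall>F K. finite F \<and> F \<subseteq> X \<and> finite K \<and>
        (\<forall>x\<in>F. \<forall>y\<in>Y. \<delta> \<le> \<xi> x y \<longrightarrow> y \<in> K) \<longrightarrow> card F \<le> card K"
      using matching_bound[OF X ulfX Y ulfY A u uR] unfolding \<xi>_def by blast
    \<comment> \<open>all points where \<open>\<xi>_x\<close> exceeds \<open>\<delta>\<close> lie in a ball around \<open>f x\<close>, whose radius does not depend on \<open>x\<close>\<close>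
    have "min c \<delta> > 0" using c \<delta> by simp
    from coarse[OF this, of 0] obtain R where R: "\<And>x x' y y'. x \<in> X \<Longrightarrow> x' \<in> X \<Longrightarrow> y \<in> Y \<Longrightarrow> y' \<in> Y \<Longrightarrow>
        dX x x' \<le> 0 \<Longrightarrow> min c \<delta> \<le> \<xi> x y \<Longrightarrow> min c \<delta> \<le> \<xi> x' y' \<Longrightarrow> dY y y' \<le> R" by blast
    define S where "S x = {y\<in>Y. dY (f x) y \<le> R}" for x
    have near: "y \<in> S x" if "x \<in> X" "y \<in> Y" "\<delta> \<le> \<xi> x y" for x y
      unfolding S_def using R[of x x "f x" y] that f Metric_space.mdist_zero[OF X, of x] by fastforce
    have finS: "finite (S x)" if "x \<in> X" for x
      using ulf_ball_bound[OF Y ulfY, of R] f(1) that unfolding S_def by (metis PiE)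
    have "\<exists>g. inj_on g X \<and> (\<forall>x\<in>X. g x \<in> S x)"
    proof (rule infinite_marriage[of X S])
      show "finite (S x)" if "x \<in> X" for x by (rule finS[OF that])
      fix F assume F: "finite F" "F \<subseteq> X"
      have "finite (\<Union>x\<in>F. S x)" using F finS by auto
      moreover have "\<forall>x\<in>F. \<forall>y\<in>Y. \<delta> \<le> \<xi> x y \<longrightarrow> y \<in> (\<Union>x\<in>F. S x)" using near F by blast
      ultimately show "card F \<le> card (\<Union>x\<in>F. S x)" using \<delta>(2) F by blast
    qed
    then obtain g where g: "inj_on g X" "\<forall>x\<in>X. g x \<in> S x" by blast
    have "coarse_embedding X dX Y dY g"
      by (rule coarse_embedding_close[OF Y f(1) _ _ fc fe]) (use g(2) in \<open>auto simp: S_def\<close>)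
    then show "\<exists>f. coarse_embedding X dX Y dY f \<and> inj_on f X" using g(1) by blast
  qed
qed

end
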